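(* Let $\Xi_{a,\Delta,\theta}$ be a non-principal split representation of $GL(2,\mathcal O_r)$ as defined in the context, and let $\sigma:\mathcal O_r^\times\to\mathbb C^\times$ be the character $\sigma(\alpha)=\theta(\alpha I)$. Let $\epsilon\in\mathcal O_r^\times$ be a fixed non-square. Then, with $\delta_{i,r-1}$ the Kronecker symbol: \begin{itemize} \item for $\alpha\in\mathcal O_r^\times$, the character at $I_\alpha=\alpha I$ is $\mathrm{tr}(I_\alpha|_{\Xi_{a,\Delta,\theta}})=(q^2-1)q^{r-2}\,\tilde\chi_a(\alpha^2)\,\sigma(\alpha)$; \item for $0\le i\le r-1$ and $\alpha,\delta\in\mathcal O_r^\times$ with $\alpha-\delta\in\varpi^i\mathcal O_r^\times$, the character at $D_{i,\alpha,\delta}=\begin{pmatrix}\alpha&0\\0&\delta\end{pmatrix}$ is $\mathrm{tr}(D_{i,\alpha,\delta}|_{\Xi_{a,\Delta,\theta}})=\delta_{i,r-1}\,\tilde\chi_a(\alpha)\tilde\chi_a(\delta)\,\sigma(\delta)\,(q-1)q^{r-2}$; \item for $0\le i\le r-1$, $\alpha\in\mathcal O_r$, $\beta\in\mathcal O_r^\times$ with $\alpha^2-\epsilon\beta^2\varpi^{2i}\in\mathcal O_r^\times$, the character at $C_{i,\alpha,\beta}=\begin{pmatrix}\alpha&\varpi^i\epsilon\beta\\ \varpi^i\beta&\alpha\end{pmatrix}$ is $0$ if $i<r-1$, and is $-\tilde\chi_a(\alpha^2)\,\sigma(\alpha)\,q^{r-2}(q+1)$ if $i=r-1$. \end{i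temize}
   Context: $F$ is a non-archimedean local field with ring of integers $\mathcal O$, uniformizer $\varpi$, residue field of cardinality $q$ and characteristic $p\neq2$. $r\ge2$ is an even integer, $l=r/2$, $\mathcal O_r=\mathcal O/\varpi^r\mathcal O$, $G^{(r)}=GL(2,\mathcal O_r)$, $K_l=\{g\in G^{(r)}: g\equiv I \bmod \varpi^l\}$. $\psi:(\mathcal O,+)\to\mathbb C^\times$ is a fixed smooth additive character of level $r$ (trivial on $\varpi^r\mathcal O$ but not on $\varpi^{r-1}\mathcal O$), viewed as a character of $\mathcal O_r$. Let $\Delta\in\varpi\mathcal O_l$ where $\mathcal O_l=\mathcal O/\varpi^l\mathcal O$, let $\hat\Delta\in\varpi\mathcal O_r$ be a lift of $\Delta$, $\hat\beta=\begin{pmatrix}0&1\\-\hat\Delta&0\end{pmatrix}$, and $S=\mathcal O_r[\hat\beta]^\times=\left\{\begin{pmatrix}a&b\\-\hat\Delta b&a\end{pmatrix}: a\in\mathcal O_r^\times,\ b\in\mathcal O_r\right\}$. Let $\psi_{\hat\beta}(k)=\psi(\mathrm{Tr}(\hat\beta(k-I)))$ for $k\in K_l$; it depends only on $\Delta$. Let $\theta:S\to\mathbb C^\times$ be a character which coincides with $\psi_{\hat\beta}$ on $S\cap K_l$. Then $\theta\psi_{\hat\beta}:SK_l\to\mathbb C^\times$, $sk\mapsto\theta(s)\psi_{\hat\beta}(k)$, is a one-dimensional representation and $\Xi_{\Delta,\theta}=\mathrm{Ind}_{SK_l}^{G^{(r)}}(\theta\psi_{\hat\beta})$. For $a\in\mathcal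 O_l$, let $\tilde\chi_a:\mathcal O_r^\times\to\mathbb C^\times$ be a character with $\tilde\chi_a(1+\varpi^lz)=\psi(\varpi^laz)$ for all $z\in\mathcal O_r$; then $\Xi_{a,\Delta,\theta}=(\tilde\chi_a\circ\det)\otimes\Xi_{\Delta,\theta}$. *)

theory Defs
  imports
    "HOL-Algebra.Algebra"
    "HOL-Analysis.Abstract_Metric_Spaces"
    "HOL-Library.Function_Algebras"
begin

section \<open>Non-archimedean local fields\<close>

definition val_ring :: "('f::field \<Rightarrow> real) \<Rightarrow> 'f ring" where
  "val_ring absv = \<lparr>carrier = {x. absv x \<le> 1}, monoid.mult = (*), monoid.one = 1, ring.zero = 0, ring.add = (+)\<rparr>"

definition max_ideal :: "('f::field \<Rightarrow> real) \<Rightarrow> 'f set" where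
  "max_ideal absv = {x. absv x < 1}"

definition residue_field :: "('f::field \<Rightarrow> real) \<Rightarrow> 'f set ring" where
  "residue_field absv = val_ring absv Quot max_ideal absv"

definition uniformizer :: "('f::field \<Rightarrow> real) \<Rightarrow> 'f \<Rightarrow> bool" where
  "uniformizer absv w \<longleftrightarrow> w \<in> carrier (val_ring absv) \<and> w \<noteq> 0 \<and> max_ideal absv = PIdl\<^bsub>val_ring absv\<^esub> w"

text \<open>
  A field complete with respect to a non-trivial discrete non-archimedean absolute value, with
  finite residue field. Non-triviality and discreteness are both part of the existence of a
  uniformizer. Both characteristics (0 and p) are allowed.
\<close>

locale nonarch_local_field =
  fixes absv :: "'f::field \<Rightarrow> real"
  assumes absv_nonneg: "absv x \<ge> 0"
    and absv_eq_0_iff: "absv x = 0 \<longleftrightarrow> x = 0"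
    and absv_mult: "absv (x * y) = absv x * absv y"
    and absv_ultrametric: "absv (x + y) \<le> max (absv x) (absv y)"
    and discrete: "\<exists>w. uniformizer absv w"
    and complete: "Metric_space.mcomplete UNIV (\<lambda>x y. absv (x - y))"
    and finite_residue_field: "finite (carrier (residue_field absv))"

text \<open>The characteristic of a ring: the additive order of 1, and 0 if that order is infinite.\<close>

definition ring_char :: "('a, 'b) ring_scheme \<Rightarrow> nat" where
  "ring_char R = group.ord (add_monoid R) \<one>\<^bsub>R\<^esub>"

definition quot_ring :: "('f::field \<Rightarrow> real) \<Rightarrow> 'f \<Rightarrow> nat \<Rightarrow> 'f set ring" where
  "quot_ring absv w n = val_ring absv Quot (PIdl\<^bsub>val_ring absv\<^esub> (w ^ n))"

definition quot_map :: "('f::field \<Rightarrow> real) \<Rightarrow> 'f \<Rightarrow> nat \<Rightarrow> 'f \<Rightarrow> 'f set" where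
  "quot_map absv w n x = (PIdl\<^bsub>val_ring absv\<^esub> (w ^ n)) +>\<^bsub>val_ring absv\<^esub> x"

text \<open>\<open>A\<close>, a class modulo \<open>w ^ m\<close>, is a lift of \<open>B\<close>, a class modulo \<open>w ^ n\<close>, where \<open>n \<le> m\<close>.\<close>

definition is_lift :: "('f::field \<Rightarrow> real) \<Rightarrow> 'f \<Rightarrow> nat \<Rightarrow> nat \<Rightarrow> 'f set \<Rightarrow> 'f set \<Rightarrow> bool" where
  "is_lift absv w m n A B \<longleftrightarrow>
     (\<exists>x\<in>carrier (val_ring absv). A = quot_map absv w m x \<and> B = quot_map absv w n x)"


section \<open>Characters with values in the multiplicative group of complex numbers\<close>

definition complex_units :: "complex monoid" where
  "complex_units = \<lparr>carrier = - {0}, monoid.mult = (*), monoid.one = 1\<rparr>"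

text \<open>
  Additive characters of level \<open>r\<close>. Triviality on the open subgroup generated by \<open>w ^ r\<close> already
  makes such a homomorphism smooth.
\<close>

definition additive_character_of_level ::
    "('f::field \<Rightarrow> real) \<Rightarrow> 'f \<Rightarrow> nat \<Rightarrow> ('f \<Rightarrow> complex) \<Rightarrow> bool" where
  "additive_character_of_level absv w r \<psi> \<longleftrightarrow>
     \<psi> \<in> hom (add_monoid (val_ring absv)) complex_units \<and>
     (\<forall>x\<in>PIdl\<^bsub>val_ring absv\<^esub> (w ^ r). \<psi> x = 1) \<and>
     \<not> (\<forall>x\<in>PIdl\<^bsub>val_ring absv\<^esub> (w ^ (r - 1)). \<psi> x = 1)"

definition descend :: "('f \<Rightarrow> complex) \<Rightarrow> 'f set \<Rightarrow> complex" where
  "descend \<psi> A = the_elem (\<psi> ` A)"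


section \<open>Two by two matrices over a commutative ring\<close>

datatype 'r mat2 = Mat2 (e11: 'r) (e12: 'r) (e21: 'r) (e22: 'r)

definition mat2_mult :: "('r, 'm) ring_scheme \<Rightarrow> 'r mat2 \<Rightarrow> 'r mat2 \<Rightarrow> 'r mat2" where
  "mat2_mult R A B = Mat2
     (e11 A \<otimes>\<^bsub>R\<^esub> e11 B \<oplus>\<^bsub>R\<^esub> e12 A \<otimes>\<^bsub>R\<^esub> e21 B) (e11 A \<otimes>\<^bsub>R\<^esub> e12 B \<oplus>\<^bsub>R\<^esub> e12 A \<otimes>\<^bsub>R\<^esub> e22 B)
     (e21 A \<otimes>\<^bsub>R\<^esub> e11 B \<oplus>\<^bsub>R\<^esub> e22 A \<otimes>\<^bsub>R\<^esub> e21 B) (e21 A \<otimes>\<^bsub>R\<^esub> e12 B \<oplus>\<^bsub>R\<^esub> e22 A \<otimes>\<^bsub>R\<^esub> e22 B)"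

definition mat2_diff :: "('r, 'm) ring_scheme \<Rightarrow> 'r mat2 \<Rightarrow> 'r mat2 \<Rightarrow> 'r mat2" where
  "mat2_diff R A B = Mat2
     (e11 A \<ominus>\<^bsub>R\<^esub> e11 B) (e12 A \<ominus>\<^bsub>R\<^esub> e12 B) (e21 A \<ominus>\<^bsub>R\<^esub> e21 B) (e22 A \<ominus>\<^bsub>R\<^esub> e22 B)"

definition mat2_trace :: "('r, 'm) ring_scheme \<Rightarrow> 'r mat2 \<Rightarrow> 'r" where
  "mat2_trace R A = e11 A \<oplus>\<^bsub>R\<^esub> e22 A"

definition mat2_det :: "('r, 'm) ring_scheme \<Rightarrow> 'r mat2 \<Rightarrow> 'r" where
  "mat2_det R A = e11 A \<otimes>\<^bsub>R\<^esub> e22 A \<ominus>\<^bsub>R\<^esub> e12 A \<otimes>\<^bsub>R\<^esub> e21 A"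

definition mat2_scalar :: "('r, 'm) ring_scheme \<Rightarrow> 'r \<Rightarrow> 'r mat2" where
  "mat2_scalar R a = Mat2 a \<zero>\<^bsub>R\<^esub> \<zero>\<^bsub>R\<^esub> a"

definition mat2_monoid :: "('r, 'm) ring_scheme \<Rightarrow> 'r mat2 monoid" where
  "mat2_monoid R = \<lparr>carrier = {A. set_mat2 A \<subseteq> carrier R},
     monoid.mult = mat2_mult R, monoid.one = mat2_scalar R \<one>\<^bsub>R\<^esub>\<rparr>"

definition GL2 :: "('r, 'm) ring_scheme \<Rightarrow> 'r mat2 monoid" where
  "GL2 R = units_of (mat2_monoid R)"


section \<open>Representations and their characters\<close>

definition fun_scale :: "complex \<Rightarrow> ('x \<Rightarrow> complex) \<Rightarrow> 'x \<Rightarrow> complex" where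
  "fun_scale c f = (\<lambda>x. c * f x)"

text \<open>
  The trace of an endomorphism \<open>T\<close> of a finite-dimensional subspace \<open>V\<close>: the sum of the diagonal
  coefficients of \<open>T\<close> with respect to a basis of \<open>V\<close>.
\<close>

definition (in vector_space) trace_on :: "'b set \<Rightarrow> ('b \<Rightarrow> 'b) \<Rightarrow> 'a" where
  "trace_on V T = (let B = (SOME B. independent B \<and> span B = V) in \<Sum>b\<in>B. representation B (T b) b)"

global_interpretation fun_space: vector_space "fun_scale :: complex \<Rightarrow> ('x \<Rightarrow> complex) \<Rightarrow> _"
  by unfold_locales (simp_all add: fun_scale_def fun_eq_iff algebra_simps)

text \<open>A representation is given by its space and the action of the group elements on it.\<close>

type_synonym ('g, 'x) fun_rep = "('x \<Rightarrow> complex) set \<times> ('g \<Rightarrow> ('x \<Rightarrow> complex) \<Rightarrow> ('x \<Rightarrow> complex))"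

definition rep_character :: "('g, 'x) fun_rep \<Rightarrow> 'g \<Rightarrow> complex" where
  "rep_character \<rho> g = fun_space.trace_on (fst \<rho>) (snd \<rho> g)"

text \<open>
  The representation of \<open>G\<close> induced from a one-dimensional representation \<open>chi\<close> of a subgroup \<open>H\<close>:
  right translation on the functions with \<open>f (h g) = chi h * f g\<close>. Functions on \<open>G\<close> are extended
  by zero to the whole type.
\<close>

definition induced_rep :: "('g, 'm) monoid_scheme \<Rightarrow> 'g set \<Rightarrow> ('g \<Rightarrow> complex) \<Rightarrow> ('g, 'g) fun_rep" where
  "induced_rep G H chi =
     ({f. (\<forall>x. x \<notin> carrier G \<longrightarrow> f x = 0) \<and>
          (\<forall>h\<in>H. \<forall>x\<in>carrier G. f (h \<otimes>\<^bsub>G\<^esub> x) = chi h * f x)},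
      (\<lambda>g f x. if x \<in> carrier G then f (x \<otimes>\<^bsub>G\<^esub> g) else 0))"

text \<open>The tensor product of a one-dimensional representation \<open>chi\<close> with \<open>\<rho>\<close>, on the space of \<open>\<rho>\<close>.\<close>

definition twist_rep :: "('g \<Rightarrow> complex) \<Rightarrow> ('g, 'x) fun_rep \<Rightarrow> ('g, 'x) fun_rep" where
  "twist_rep chi \<rho> = (fst \<rho>, (\<lambda>g f. fun_scale (chi g) (snd \<rho> g f)))"


section \<open>The non-principal split representations\<close>

text \<open>
  Here \<open>R\<close> is the ring \<open>\<O>\<^sub>r\<close>, \<open>w\<close> the image of the uniformizer in it, \<open>\<psi>\<close> an additive character of
  \<open>R\<close>, and \<open>D\<close> the lift \<open>\<Delta>\<close>-hat in \<open>R\<close>.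
\<close>

definition cong_subgroup :: "('r, 'm) ring_scheme \<Rightarrow> 'r \<Rightarrow> nat \<Rightarrow> 'r mat2 set" where
  "cong_subgroup R w l =
     {g \<in> carrier (GL2 R). set_mat2 (mat2_diff R g (mat2_scalar R \<one>\<^bsub>R\<^esub>)) \<subseteq> PIdl\<^bsub>R\<^esub> (w [^]\<^bsub>R\<^esub> l)}"

definition beta_hat :: "('r, 'm) ring_scheme \<Rightarrow> 'r \<Rightarrow> 'r mat2" where
  "beta_hat R D = Mat2 \<zero>\<^bsub>R\<^esub> \<one>\<^bsub>R\<^esub> (\<ominus>\<^bsub>R\<^esub> D) \<zero>\<^bsub>R\<^esub>"

definition S_group :: "('r, 'm) ring_scheme \<Rightarrow> 'r \<Rightarrow> 'r mat2 set" where
  "S_group R D = {Mat2 a b (\<ominus>\<^bsub>R\<^esub> D \<otimes>\<^bsub>R\<^esub> b) a | a b. a \<in> Units R \<and> b \<in> carrier R}"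

definition psi_beta :: "('r, 'm) ring_scheme \<Rightarrow> ('r \<Rightarrow> complex) \<Rightarrow> 'r mat2 \<Rightarrow> 'r mat2 \<Rightarrow> complex" where
  "psi_beta R \<psi> \<beta> k = \<psi> (mat2_trace R (mat2_mult R \<beta> (mat2_diff R k (mat2_scalar R \<one>\<^bsub>R\<^esub>))))"

definition theta_psi :: "('r, 'm) ring_scheme \<Rightarrow> 'r \<Rightarrow> nat \<Rightarrow> ('r \<Rightarrow> complex) \<Rightarrow> 'r
    \<Rightarrow> ('r mat2 \<Rightarrow> complex) \<Rightarrow> 'r mat2 \<Rightarrow> complex" where
  "theta_psi R w l \<psi> D \<theta> g =
     (THE c. \<exists>s\<in>S_group R D. \<exists>k\<in>cong_subgroup R w l.
        g = s \<otimes>\<^bsub>GL2 R\<^esub> k \<and> c = \<theta> s * psi_beta R \<psi> (beta_hat R D) k)"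

definition Xi_rep :: "('r, 'm) ring_scheme \<Rightarrow> 'r \<Rightarrow> nat \<Rightarrow> ('r \<Rightarrow> complex) \<Rightarrow> 'r
    \<Rightarrow> ('r mat2 \<Rightarrow> complex) \<Rightarrow> ('r mat2, 'r mat2) fun_rep" where
  "Xi_rep R w l \<psi> D \<theta> =
     induced_rep (GL2 R) (S_group R D <#>\<^bsub>GL2 R\<^esub> cong_subgroup R w l) (theta_psi R w l \<psi> D \<theta>)"

text \<open>\<open>\<Xi>\<close> twisted by a character \<open>chi\<close> of the units, which plays the role of the extension attached to \<open>a\<close>.\<close>

definition Xi_twisted_rep :: "('r, 'm) ring_scheme \<Rightarrow> 'r \<Rightarrow> nat \<Rightarrow> ('r \<Rightarrow> complex) \<Rightarrow> ('r \<Rightarrow> complex) \<Rightarrow> 'r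
    \<Rightarrow> ('r mat2 \<Rightarrow> complex) \<Rightarrow> ('r mat2, 'r mat2) fun_rep" where
  "Xi_twisted_rep R w l \<psi> chi D \<theta> = twist_rep (\<lambda>g. chi (mat2_det R g)) (Xi_rep R w l \<psi> D \<theta>)"

end

theory Submission
  imports Defs
begin

text \<open>
  Let \<open>H = S K\<close> be the inducing subgroup and \<open>\<Theta>\<close> its character \<open>\<theta> \<psi>\<^sub>\<beta>\<close>. By Frobenius' formula
  (\<open>rep_character_twist_induced\<close>), \<open>card H\<close> times the trace at \<open>g\<close> is \<open>chi (det g)\<close> times the sum of
  \<open>\<Theta> (x g x\<inverse>)\<close> over those \<open>x\<close> in \<open>GL2 R\<close> with \<open>x g x\<inverse> \<in> H\<close>. All matrices of the theorem have the form
  \<open>g = z I + w\<^sup>i Y\<close> with \<open>z\<close> in \<open>R\<close>. For the two non-central families the discriminant of \<open>Y\<close> is a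
  unit; in the non-split case this uses that \<open>2\<close> is a unit. Conjugation gives
  \<open>x g x\<inverse> = z I + w\<^sup>i m\<close> with \<open>m = x Y x\<inverse>\<close>, and three ranges of \<open>i\<close> behave differently.

  If \<open>i < l\<close>, membership in \<open>H\<close> would force both \<open>m\<^sub>1\<^sub>1 - m\<^sub>2\<^sub>2\<close> and \<open>m\<^sub>2\<^sub>1\<close> into the maximal ideal, because
  \<open>D\<close> lies there. Then the discriminant of \<open>m\<close>, which is that of \<open>Y\<close>, would not be a unit. So the sum is
  empty (\<open>affine_notin_H\<close>).

  If \<open>l \<le> i\<close> and \<open>z\<close> is a unit, every conjugate lies in \<open>H\<close> and
  \<open>\<Theta> (x g x\<inverse>) = \<theta> (z I) \<psi> (z\<inverse> w\<^sup>i (m\<^sub>2\<^sub>1 - D m\<^sub>1\<^sub>2))\<close> (\<open>Theta_affine\<close>). For \<open>i < r - 1\<close>, left multiplication of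
  \<open>x\<close> by matrices congruent to \<open>I\<close> modulo \<open>w\<close> to the power \<open>r - 1 - i\<close> multiplies the summand by
  \<open>\<psi> (w\<^bsup>r - 1\<^esup> k s)\<close>, where \<open>s\<close> runs over \<open>R\<close> and \<open>k\<close> is a unit: diagonal matrices do it where \<open>m\<^sub>2\<^sub>1\<close> is a
  unit, and lower unipotent ones where \<open>m\<^sub>1\<^sub>1 - m\<^sub>2\<^sub>2\<close> is. Averaging over \<open>s\<close> kills the sum (\<open>sum_middle\<close>).

  For \<open>i = r - 1\<close> only \<open>m\<^sub>2\<^sub>1\<close> modulo \<open>w\<close> matters. Left multiplication by \<open>diag (v\<inverse>, 1)\<close> scales \<open>m\<^sub>2\<^sub>1\<close> by
  \<open>v\<close>, and averaging over all units \<open>v\<close> replaces the summand by \<open>1\<close> or by \<open>- 1 / (q - 1)\<close>, according to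
  whether \<open>m\<^sub>2\<^sub>1\<close> vanishes modulo \<open>w\<close> (\<open>sum_top\<close>). It remains to count the \<open>x\<close> for which it vanishes. For
  diagonal \<open>g\<close> these are the \<open>x\<close> whose lower row has an entry in the maximal ideal
  (\<open>e21_mconj_E11\<close>); for the non-split \<open>g\<close> there are none, as \<open>\<epsilon>\<close> is not a square modulo \<open>w\<close>
  (\<open>e21_mconj_nonsquare\<close>).

  The argument uses \<open>R\<close> only as a finite chain ring in which \<open>2\<close> is a unit, and is carried out at that
  generality; the last part shows that the quotient of the valuation ring is such a ring.
\<close>

section \<open>The character of an induced representation\<close>

text \<open>The trace is defined through an arbitrary basis. A finite family \<open>e\<close> in \<open>V\<close> and functions \<open>c\<close> with
  \<open>v = \<Sum>x. c x v e x\<close> already determine it: expanding the image of every basis vector in the family and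
  exchanging the two sums gives \<open>\<Sum>x. c x (T (e x))\<close>. The family may be linearly dependent, so for an
  induced representation it can be indexed by the whole group instead of by coset representatives.\<close>

lemma (in vector_space) trace_on_eq_sum:
  fixes c :: "'c \<Rightarrow> 'b \<Rightarrow> 'a" and e :: "'c \<Rightarrow> 'b"
  assumes V: "subspace V" and I: "finite I" and e: "\<And>x. x \<in> I \<Longrightarrow> e x \<in> V"
    and expand: "\<And>v. v \<in> V \<Longrightarrow> v = (\<Sum>x\<in>I. scale (c x v) (e x))"
    and T: "\<And>v. v \<in> V \<Longrightarrow> T v \<in> V"
    and lin: "\<And>x B a. finite B \<Longrightarrow> B \<subseteq> V \<Longrightarrow> x \<in> I \<Longrightarrow>
                c x (T (\<Sum>b\<in>B. scale (a b) b)) = (\<Sum>b\<in>B. a b * c x (T b))"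
  shows "trace_on V T = (\<Sum>x\<in>I. c x (T (e x)))"
proof -
  define B where "B = (SOME B. independent B \<and> span B = V)"
  obtain B0 where B0: "B0 \<subseteq> V" "independent B0" "V \<subseteq> span B0"
    using maximal_independent_subset[of V] by blast
  have "span B0 \<subseteq> V"
    using B0(1) V by (rule span_minimal)
  with B0 have "independent B0 \<and> span B0 = V" by blast
  then have B: "independent B" "span B = V"
    unfolding B_def by (metis (mono_tags, lifting) someI_ex)+
  have BV: "B \<subseteq> V"
    using B(2) span_superset by blast
  have "V \<subseteq> span (e ` I)"
  proof
    fix v assume "v \<in> V"
    have "(\<Sum>x\<in>I. scale (c x v) (e x)) \<in> span (e ` I)"
      by (intro span_sum span_scale span_base imageI)
    then show "v \<in> span (e ` I)"
      using expand[OF \<open>v \<in> V\<close>] by simp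
  qed
  then have finB: "finite B"
    using independent_span_bound[of "e ` I" B] B BV I by auto
  have coeff: "representation B (T b) b = (\<Sum>x\<in>I. c x (T b) * representation B (e x) b)"
    if "b \<in> B" for b
  proof -
    have "T b \<in> V" using T BV that by blast
    have "representation B (T b) b = representation B (\<Sum>x\<in>I. scale (c x (T b)) (e x)) b"
      using expand[OF \<open>T b \<in> V\<close>] by simp
    also have "\<dots> = (\<Sum>x\<in>I. representation B (scale (c x (T b)) (e x)) b)"
      using B e by (subst representation_sum) (auto intro!: span_scale)
    also have "\<dots> = (\<Sum>x\<in>I. c x (T b) * representation B (e x) b)"
      using B e by (intro sum.cong refl) (simp add: representation_scale)
    finally show ?thesis .
  qed
  have "trace_on V T = (\<Sum>b\<in>B. representation B (T b) b)"
    by (simp add: trace_on_def B_def Let_def)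
  also have "\<dots> = (\<Sum>b\<in>B. \<Sum>x\<in>I. c x (T b) * representation B (e x) b)"
    by (simp add: coeff)
  also have "\<dots> = (\<Sum>x\<in>I. \<Sum>b\<in>B. representation B (e x) b * c x (T b))"
    by (subst sum.swap) (simp add: mult.commute)
  also have "\<dots> = (\<Sum>x\<in>I. c x (T (\<Sum>b\<in>B. scale (representation B (e x) b) b)))"
    by (intro sum.cong refl) (simp add: lin finB BV)
  also have "\<dots> = (\<Sum>x\<in>I. c x (T (e x)))"
    using B e finB by (intro sum.cong refl) (simp add: sum_representation_eq)
  finally show ?thesis .
qed

lemma fun_scale_sum_apply:
  "(\<Sum>b\<in>B. fun_scale (a b) (f b)) x = (\<Sum>b\<in>B. a b * f b x)"
  by (induction B rule: infinite_finite_induct) (simp_all add: fun_scale_def)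

text \<open>Frobenius' formula in averaged form. The family \<open>e x\<close> consists of the functions supported on \<open>H x\<close> that
  extend \<open>\<eta>\<close>. Every coset is counted \<open>card H\<close> times when \<open>x\<close> runs over the group, which explains the
  normalisation of \<open>e x\<close>.\<close>

lemma (in group) rep_character_twist_induced:
  fixes \<eta> :: "'a \<Rightarrow> complex"
  assumes fin: "finite (carrier G)" and H: "subgroup H G"
    and mult: "\<And>h k. h \<in> H \<Longrightarrow> k \<in> H \<Longrightarrow> \<eta> (h \<otimes> k) = \<eta> h * \<eta> k"
    and nz: "\<And>h. h \<in> H \<Longrightarrow> \<eta> h \<noteq> 0"
    and g: "g \<in> carrier G"
  shows "of_nat (card H) * rep_character (twist_rep c (induced_rep G H \<eta>)) g
    = c g * (\<Sum>x\<in>carrier G. if x \<otimes> g \<otimes> inv x \<in> H then \<eta> (x \<otimes> g \<otimes> inv x) else 0)"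
proof -
  note Hc = subgroup.mem_carrier[OF H]
  define V where "V = fst (induced_rep G H \<eta>)"
  define T where "T = snd (twist_rep c (induced_rep G H \<eta>)) g"
  define e where "e = (\<lambda>x y. if y \<in> carrier G \<and> y \<otimes> inv x \<in> H then \<eta> (y \<otimes> inv x) / of_nat (card H) else 0)"
  have finH: "finite H" using H fin by (meson finite_subset subgroup.subset)
  have cardH: "of_nat (card H) \<noteq> (0::complex)"
    using finH subgroup.one_closed[OF H] by auto
  have V: "f \<in> V \<longleftrightarrow> (\<forall>x. x \<notin> carrier G \<longrightarrow> f x = 0) \<and>
        (\<forall>h\<in>H. \<forall>x\<in>carrier G. f (h \<otimes> x) = \<eta> h * f x)" for f
    by (simp add: V_def induced_rep_def)
  have T: "T f = (\<lambda>x. c g * (if x \<in> carrier G then f (x \<otimes> g) else 0))" for f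
    by (simp add: T_def twist_rep_def induced_rep_def fun_scale_def)
  have one: "\<eta> \<one> = 1"
    using mult[of \<one> \<one>] nz[of \<one>] subgroup.one_closed[OF H] by simp
  have chi_inv: "\<eta> (inv h) * \<eta> h = 1" if "h \<in> H" for h
    using mult[of "inv h" h] that one Hc[OF that] subgroup.m_inv_closed[OF H that] by simp
  have sub: "fun_space.subspace V"
    by (auto simp: fun_space.subspace_def V fun_scale_def algebra_simps)
  have eV: "e x \<in> V" if x: "x \<in> carrier G" for x
    unfolding V
  proof (intro conjI allI ballI impI)
    fix h y assume h: "h \<in> H" and y: "y \<in> carrier G"
    have eq: "h \<otimes> y \<otimes> inv x = h \<otimes> (y \<otimes> inv x)"
      using Hc[OF h] x y by (simp add: m_assoc)
    have "y \<otimes> inv x \<in> H" if "h \<otimes> (y \<otimes> inv x) \<in> H"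
    proof -
      have "inv h \<otimes> (h \<otimes> (y \<otimes> inv x)) \<in> H"
        using that h H by (simp add: subgroup.m_closed subgroup.m_inv_closed)
      then show ?thesis using Hc[OF h] x y by (simp add: m_assoc[symmetric])
    qed
    then show "e x (h \<otimes> y) = \<eta> h * e x y"
      using h Hc[OF h] x y H by (auto simp: e_def eq mult subgroup.m_closed)
  qed (simp add: e_def)
  have expand: "f = (\<Sum>x\<in>carrier G. fun_scale (f x) (e x))" if f: "f \<in> V" for f
  proof
    fix y
    show "f y = (\<Sum>x\<in>carrier G. fun_scale (f x) (e x)) y"
    proof (cases "y \<in> carrier G")
      case False
      then show ?thesis using f by (simp add: fun_scale_sum_apply e_def V)
    next
      case y: True
      have "(\<Sum>x\<in>carrier G. f x * e x y) = (\<Sum>x\<in>(\<lambda>h. inv h \<otimes> y) ` H. f x * e x y)"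
      proof (intro sum.mono_neutral_right fin ballI)
        show "(\<lambda>h. inv h \<otimes> y) ` H \<subseteq> carrier G" using Hc y by auto
        fix x assume x: "x \<in> carrier G - (\<lambda>h. inv h \<otimes> y) ` H"
        have "x = inv (y \<otimes> inv x) \<otimes> y"
          using x y by (simp add: inv_mult_group m_assoc)
        then have "y \<otimes> inv x \<notin> H" using x by blast
        then show "f x * e x y = 0" by (simp add: e_def)
      qed
      also have "\<dots> = (\<Sum>h\<in>H. f (inv h \<otimes> y) * e (inv h \<otimes> y) y)"
      proof (intro sum.reindex_cong[OF _ refl refl] inj_onI)
        fix h k assume h: "h \<in> H" and k: "k \<in> H" and eq: "inv h \<otimes> y = inv k \<otimes> y"
        then show "h = k" using Hc y by (metis inv_closed inv_inv r_cancel)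
      qed
      also have "\<dots> = (\<Sum>h\<in>H. f y / of_nat (card H))"
      proof (intro sum.cong refl)
        fix h assume h: "h \<in> H"
        have "f (inv h \<otimes> y) = \<eta> (inv h) * f y"
          using f h y H by (simp add: V subgroup.m_inv_closed)
        moreover have "y \<otimes> inv (inv h \<otimes> y) = h"
          using Hc[OF h] y by (simp add: inv_mult_group m_assoc[symmetric])
        ultimately show "f (inv h \<otimes> y) * e (inv h \<otimes> y) y = f y / of_nat (card H)"
          using h y chi_inv[OF h] by (simp add: e_def algebra_simps)
      qed
      also have "\<dots> = f y" using cardH by simp
      finally show ?thesis by (simp add: fun_scale_sum_apply)
    qed
  qed
  have TV: "T f \<in> V" if "f \<in> V" for f
    using that g Hc by (auto simp: V T m_assoc)
  have lin: "T (\<Sum>b\<in>B. fun_scale (a b) b) x = (\<Sum>b\<in>B. a b * T b x)" for x B a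
    by (simp add: T fun_scale_sum_apply sum_distrib_left mult.left_commute)
  have "rep_character (twist_rep c (induced_rep G H \<eta>)) g = fun_space.trace_on V T"
    by (simp add: rep_character_def V_def T_def twist_rep_def)
  also have "\<dots> = (\<Sum>x\<in>carrier G. T (e x) x)"
    by (rule fun_space.trace_on_eq_sum[where c = "\<lambda>x f. f x"])
      (use sub fin eV expand TV lin in auto)
  also have "\<dots> = (\<Sum>x\<in>carrier G. c g * (if x \<otimes> g \<otimes> inv x \<in> H then \<eta> (x \<otimes> g \<otimes> inv x) else 0) / of_nat (card H))"
    using g by (intro sum.cong refl) (simp add: T e_def)
  finally show ?thesis
    using cardH by (simp add: sum_divide_distrib[symmetric] sum_distrib_left[symmetric])
qed

section \<open>Gluing characters of two subgroups\<close>

context group begin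

text \<open>Two characters \<open>\<theta>\<close> of \<open>S\<close> and \<open>\<kappa>\<close> of a normal subgroup \<open>K\<close>, agreeing on \<open>S \<inter> K\<close>, glue to a
  character of \<open>S K\<close> as soon as \<open>\<kappa>\<close> is invariant under conjugation by \<open>S\<close>.\<close>

context
  fixes S K and \<theta> \<kappa> :: "'a \<Rightarrow> complex" and E :: "'a \<Rightarrow> complex"
  assumes S: "subgroup S G" and K: "K \<lhd> G"
    and \<theta>: "\<theta> \<in> hom (G\<lparr>carrier := S\<rparr>) complex_units"
    and \<kappa>_mult: "\<And>k k'. k \<in> K \<Longrightarrow> k' \<in> K \<Longrightarrow> \<kappa> (k \<otimes> k') = \<kappa> k * \<kappa> k'"
    and \<kappa>_conj: "\<And>s k. s \<in> S \<Longrightarrow> k \<in> K \<Longrightarrow> \<kappa> (s \<otimes> k \<otimes> inv s) = \<kappa> k"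
    and \<kappa>_nz: "\<And>k. k \<in> K \<Longrightarrow> \<kappa> k \<noteq> 0"
    and agree: "\<And>k. k \<in> S \<inter> K \<Longrightarrow> \<theta> k = \<kappa> k"
    and E: "\<And>g. E g = (THE c. \<exists>s\<in>S. \<exists>k\<in>K. g = s \<otimes> k \<and> c = \<theta> s * \<kappa> k)"
begin

lemma glue_theta_mult: "s \<in> S \<Longrightarrow> s' \<in> S \<Longrightarrow> \<theta> (s \<otimes> s') = \<theta> s * \<theta> s'"
  and glue_theta_nz: "s \<in> S \<Longrightarrow> \<theta> s \<noteq> 0"
  using \<theta> by (auto simp: hom_def complex_units_def)

lemma glue_apply:
  assumes s: "s \<in> S" and k: "k \<in> K"
  shows "E (s \<otimes> k) = \<theta> s * \<kappa> k"
  unfolding E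
proof (rule the_equality)
  fix c assume "\<exists>s'\<in>S. \<exists>k'\<in>K. s \<otimes> k = s' \<otimes> k' \<and> c = \<theta> s' * \<kappa> k'"
  then obtain s' k' where s': "s' \<in> S" "k' \<in> K" and eq: "s \<otimes> k = s' \<otimes> k'"
    and c: "c = \<theta> s' * \<kappa> k'" by blast
  have Kg: "subgroup K G" using K by (rule normal_imp_subgroup)
  note car = subgroup.mem_carrier[OF S s] subgroup.mem_carrier[OF S s'(1)]
    subgroup.mem_carrier[OF Kg k] subgroup.mem_carrier[OF Kg s'(2)]
  define t where "t = inv s' \<otimes> s"
  have "t \<otimes> k = k'"
  proof -
    have "t \<otimes> k = inv s' \<otimes> (s' \<otimes> k')"
      unfolding t_def using car by (simp add: m_assoc eq)
    then show ?thesis using car by (simp add: m_assoc[symmetric])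
  qed
  then have t_eq: "t = k' \<otimes> inv k"
    using car by (metis inv_solve_right t_def inv_closed m_closed)
  have tS: "t \<in> S" unfolding t_def using S s s' by (simp add: subgroup.m_closed subgroup.m_inv_closed)
  have tK: "t \<in> K" unfolding t_eq using Kg k s' by (simp add: subgroup.m_closed subgroup.m_inv_closed)
  have "s = s' \<otimes> t" unfolding t_def using car by (simp add: m_assoc[symmetric])
  then have "\<theta> s = \<theta> s' * \<theta> t" using s' tS glue_theta_mult by simp
  moreover have "\<kappa> k' = \<theta> t * \<kappa> k"
    using \<open>t \<otimes> k = k'\<close> \<kappa>_mult[OF tK k] agree tS tK by simp
  ultimately show "c = \<theta> s * \<kappa> k" by (simp add: c)
qed (use s k in blast)

lemma glue_subgroup: "subgroup (S <#> K) G"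
  using mult_norm_subgroup[OF K S] commut_normal[OF S K] by simp

lemma glue_mult:
  assumes "g \<in> S <#> K" "h \<in> S <#> K"
  shows "E (g \<otimes> h) = E g * E h"
proof -
  from assms obtain s k s' k' where s: "s \<in> S" "k \<in> K" "g = s \<otimes> k" and s': "s' \<in> S" "k' \<in> K" "h = s' \<otimes> k'"
    by (auto simp: set_mult_def)
  have Kg: "subgroup K G" using K by (rule normal_imp_subgroup)
  note car = subgroup.mem_carrier[OF S s(1)] subgroup.mem_carrier[OF S s'(1)]
    subgroup.mem_carrier[OF Kg s(2)] subgroup.mem_carrier[OF Kg s'(2)]
  define k'' where "k'' = inv s' \<otimes> k \<otimes> s'"
  have k'': "k'' \<in> K" unfolding k''_def using K car(2) s(2) by (rule normal.inv_op_closed1)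
  have conj: "k = s' \<otimes> k'' \<otimes> inv s'"
    unfolding k''_def using car by (simp add: m_assoc inv_solve_left r_inv_ex) (simp add: m_assoc[symmetric])
  have eq: "g \<otimes> h = (s \<otimes> s') \<otimes> (k'' \<otimes> k')"
    unfolding s s' k''_def using car by (simp add: m_assoc) (simp add: m_assoc[symmetric])
  have "\<kappa> k'' = \<kappa> k" using \<kappa>_conj[OF s'(1) k''] conj by simp
  moreover have "s \<otimes> s' \<in> S" "k'' \<otimes> k' \<in> K" using S Kg s s' k'' by (simp_all add: subgroup.m_closed)
  ultimately have "E (g \<otimes> h) = \<theta> s * \<theta> s' * (\<kappa> k * \<kappa> k')"
    unfolding eq using s(1,2) s'(1,2) k'' by (simp add: glue_apply \<kappa>_mult glue_theta_mult)
  moreover have "E g = \<theta> s * \<kappa> k" "E h = \<theta> s' * \<kappa> k'"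
    using s s' glue_apply by auto
  ultimately show ?thesis by simp
qed

lemma glue_nz: "g \<in> S <#> K \<Longrightarrow> E g \<noteq> 0"
  by (auto simp: set_mult_def glue_apply glue_theta_nz \<kappa>_nz)

end

end

section \<open>Invertible matrices and conjugation\<close>

context cring begin

abbreviation M2 :: "'a mat2 set" where "M2 \<equiv> carrier (mat2_monoid R)"
abbreviation mmul :: "'a mat2 \<Rightarrow> 'a mat2 \<Rightarrow> 'a mat2" (infixl "\<star>" 70) where "x \<star> y \<equiv> mat2_mult R x y"

lemma M2_iff: "A \<in> M2 \<longleftrightarrow> e11 A \<in> carrier R \<and> e12 A \<in> carrier R \<and> e21 A \<in> carrier R \<and> e22 A \<in> carrier R"
  by (cases A) (auto simp: mat2_monoid_def)

lemma Mat2_in_M2 [simp]: "Mat2 a b c d \<in> M2 \<longleftrightarrow> a \<in> carrier R \<and> b \<in> carrier R \<and> c \<in> carrier R \<and> d \<in> carrier R"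
  by (simp add: M2_iff)

lemma M2_E:
  assumes "A \<in> M2"
  obtains a b c d where "A = Mat2 a b c d" "a \<in> carrier R" "b \<in> carrier R" "c \<in> carrier R" "d \<in> carrier R"
  using assms by (cases A) simp

lemma mmul_Mat2 [simp]:
  "Mat2 a b c d \<star> Mat2 a' b' c' d' = Mat2 (a \<otimes> a' \<oplus> b \<otimes> c') (a \<otimes> b' \<oplus> b \<otimes> d') (c \<otimes> a' \<oplus> d \<otimes> c') (c \<otimes> b' \<oplus> d \<otimes> d')"
  by (simp add: mat2_mult_def)

lemma mat2_diff_Mat2 [simp]:
  "mat2_diff R (Mat2 a b c d) (Mat2 a' b' c' d') = Mat2 (a \<ominus> a') (b \<ominus> b') (c \<ominus> c') (d \<ominus> d')"
  by (simp add: mat2_diff_def)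

lemma mat2_trace_Mat2 [simp]: "mat2_trace R (Mat2 a b c d) = a \<oplus> d"
  by (simp add: mat2_trace_def)

lemma mat2_det_Mat2 [simp]: "mat2_det R (Mat2 a b c d) = a \<otimes> d \<ominus> b \<otimes> c"
  by (simp add: mat2_det_def)

lemma mmul_closed [simp, intro]: "x \<in> M2 \<Longrightarrow> y \<in> M2 \<Longrightarrow> x \<star> y \<in> M2"
  by (auto elim!: M2_E)

lemma mat2_diff_closed [simp, intro]: "x \<in> M2 \<Longrightarrow> y \<in> M2 \<Longrightarrow> mat2_diff R x y \<in> M2"
  by (auto elim!: M2_E)

lemma mat2_scalar_closed [simp, intro]: "a \<in> carrier R \<Longrightarrow> mat2_scalar R a \<in> M2"
  by (simp add: mat2_scalar_def)

lemma mat2_det_closed [simp, intro]: "x \<in> M2 \<Longrightarrow> mat2_det R x \<in> carrier R"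
  by (auto elim!: M2_E)

lemma mat2_monoid_simps: "x \<otimes>\<^bsub>mat2_monoid R\<^esub> y = x \<star> y" "\<one>\<^bsub>mat2_monoid R\<^esub> = mat2_scalar R \<one>"
  by (simp_all add: mat2_monoid_def)

lemma mmul_assoc: "x \<in> M2 \<Longrightarrow> y \<in> M2 \<Longrightarrow> z \<in> M2 \<Longrightarrow> (x \<star> y) \<star> z = x \<star> (y \<star> z)"
  by (elim M2_E) (simp, algebra)

lemma mmul_one [simp]: "x \<in> M2 \<Longrightarrow> mat2_scalar R \<one> \<star> x = x" "x \<in> M2 \<Longrightarrow> x \<star> mat2_scalar R \<one> = x"
  by (auto elim!: M2_E simp: mat2_scalar_def)

lemma monoid_mat2: "Group.monoid (mat2_monoid R)"
  by (rule Group.monoidI) (simp_all add: mat2_monoid_simps mmul_assoc)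

lemma mat2_det_mult: "x \<in> M2 \<Longrightarrow> y \<in> M2 \<Longrightarrow> mat2_det R (x \<star> y) = mat2_det R x \<otimes> mat2_det R y"
  by (elim M2_E) (simp, algebra)

lemma mat2_trace_comm: "x \<in> M2 \<Longrightarrow> y \<in> M2 \<Longrightarrow> mat2_trace R (x \<star> y) = mat2_trace R (y \<star> x)"
  by (elim M2_E) (simp, algebra)

lemma mmul_diff_distrib:
  assumes "x \<in> M2" "y \<in> M2" "z \<in> M2"
  shows "x \<star> mat2_diff R y z = mat2_diff R (x \<star> y) (x \<star> z)"
    and "mat2_diff R y z \<star> x = mat2_diff R (y \<star> x) (z \<star> x)"
proof -
  have l: "a \<otimes> (p \<ominus> p') \<oplus> b \<otimes> (s \<ominus> s') = (a \<otimes> p \<oplus> b \<otimes> s) \<ominus> (a \<otimes> p' \<oplus> b \<otimes> s')"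
    and r: "(p \<ominus> p') \<otimes> a \<oplus> (s \<ominus> s') \<otimes> b = (p \<otimes> a \<oplus> s \<otimes> b) \<ominus> (p' \<otimes> a \<oplus> s' \<otimes> b)"
    if "a \<in> carrier R" "b \<in> carrier R" "p \<in> carrier R" "p' \<in> carrier R" "s \<in> carrier R" "s' \<in> carrier R"
    for a b p p' s s'
    using that by algebra+
  show "x \<star> mat2_diff R y z = mat2_diff R (x \<star> y) (x \<star> z)"
    using assms by (elim M2_E) (simp add: l)
  show "mat2_diff R y z \<star> x = mat2_diff R (y \<star> x) (z \<star> x)"
    using assms by (elim M2_E) (simp add: r)
qed

text \<open>Invertibility in the matrix monoid is detected by the determinant, through the adjugate.\<close>

lemma carrier_GL2: "carrier (GL2 R) = {x \<in> M2. mat2_det R x \<in> Units R}"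
proof (intro equalityI subsetI)
  fix x assume "x \<in> carrier (GL2 R)"
  then obtain y where x: "x \<in> M2" and y: "y \<in> M2" "y \<star> x = mat2_scalar R \<one>" "x \<star> y = mat2_scalar R \<one>"
    by (auto simp: GL2_def units_of_def Units_def mat2_monoid_simps)
  have "mat2_det R x \<otimes> mat2_det R y = \<one>"
    using mat2_det_mult[OF x y(1)] y by (simp add: mat2_scalar_def a_minus_def)
  then show "x \<in> {x \<in> M2. mat2_det R x \<in> Units R}"
    using x y unit_factor[of "mat2_det R x" "mat2_det R y"] by simp
next
  fix x assume "x \<in> {x \<in> M2. mat2_det R x \<in> Units R}"
  then obtain a b c d where x: "x = Mat2 a b c d" "x \<in> M2" "a \<in> carrier R" "b \<in> carrier R" "c \<in> carrier R" "d \<in> carrier R"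
    and D: "a \<otimes> d \<ominus> b \<otimes> c \<in> Units R"
    by (auto elim!: M2_E)
  define e where "e = inv (a \<otimes> d \<ominus> b \<otimes> c)"
  have e: "e \<in> carrier R" "(a \<otimes> d \<ominus> b \<otimes> c) \<otimes> e = \<one>"
    using D by (auto simp: e_def)
  define y where "y = Mat2 (e \<otimes> d) (\<ominus> (e \<otimes> b)) (\<ominus> (e \<otimes> c)) (e \<otimes> a)"
  have "a \<otimes> (e \<otimes> d) \<oplus> b \<otimes> \<ominus> (e \<otimes> c) = (a \<otimes> d \<ominus> b \<otimes> c) \<otimes> e"
    "a \<otimes> \<ominus> (e \<otimes> b) \<oplus> b \<otimes> (e \<otimes> a) = \<zero>"
    "c \<otimes> (e \<otimes> d) \<oplus> d \<otimes> \<ominus> (e \<otimes> c) = \<zero>"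
    "c \<otimes> \<ominus> (e \<otimes> b) \<oplus> d \<otimes> (e \<otimes> a) = (a \<otimes> d \<ominus> b \<otimes> c) \<otimes> e"
    "e \<otimes> d \<otimes> a \<oplus> \<ominus> (e \<otimes> b) \<otimes> c = (a \<otimes> d \<ominus> b \<otimes> c) \<otimes> e"
    "e \<otimes> d \<otimes> b \<oplus> \<ominus> (e \<otimes> b) \<otimes> d = \<zero>"
    "\<ominus> (e \<otimes> c) \<otimes> a \<oplus> e \<otimes> a \<otimes> c = \<zero>"
    "\<ominus> (e \<otimes> c) \<otimes> b \<oplus> e \<otimes> a \<otimes> d = (a \<otimes> d \<ominus> b \<otimes> c) \<otimes> e"
    using x e(1) by algebra+
  then have "x \<star> y = mat2_scalar R \<one>" "y \<star> x = mat2_scalar R \<one>"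
    using e(2) by (simp_all add: x y_def mat2_scalar_def)
  moreover have "y \<in> M2" using x e by (simp add: y_def)
  ultimately show "x \<in> carrier (GL2 R)"
    using x by (auto simp: GL2_def units_of_def Units_def mat2_monoid_simps)
qed

lemma GL2_mult: "x \<otimes>\<^bsub>GL2 R\<^esub> y = x \<star> y"
  by (simp add: GL2_def units_of_mult mat2_monoid_simps)

lemma GL2_one: "\<one>\<^bsub>GL2 R\<^esub> = mat2_scalar R \<one>"
  by (simp add: GL2_def units_of_one mat2_monoid_simps)

lemma group_GL2: "group (GL2 R)"
  unfolding GL2_def using monoid_mat2 by (rule Group.monoid.units_group)

definition minv :: "'a mat2 \<Rightarrow> 'a mat2" where "minv x = inv\<^bsub>GL2 R\<^esub> x"

lemma GL2_M2: "x \<in> carrier (GL2 R) \<Longrightarrow> x \<in> M2"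
  by (simp add: carrier_GL2)

lemma minv_GL2: "x \<in> carrier (GL2 R) \<Longrightarrow> minv x \<in> carrier (GL2 R)"
  unfolding minv_def using group_GL2 by (rule group.inv_closed)

lemma minv_M2: "x \<in> carrier (GL2 R) \<Longrightarrow> minv x \<in> M2"
  by (intro GL2_M2 minv_GL2)

lemma minv_right: "x \<in> carrier (GL2 R) \<Longrightarrow> x \<star> minv x = mat2_scalar R \<one>"
  and minv_left: "x \<in> carrier (GL2 R) \<Longrightarrow> minv x \<star> x = mat2_scalar R \<one>"
  using group.r_inv[OF group_GL2] group.l_inv[OF group_GL2] by (simp_all add: minv_def GL2_mult GL2_one)

lemma minv_unique:
  assumes "x \<in> carrier (GL2 R)" "y \<in> M2" "x \<star> y = mat2_scalar R \<one>"
  shows "minv x = y"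
  by (metis (no_types, lifting) GL2_M2 assms minv_M2 minv_left mmul_assoc mmul_one(1) mmul_one(2))

definition mconj :: "'a mat2 \<Rightarrow> 'a mat2 \<Rightarrow> 'a mat2" where
  "mconj x y = x \<star> y \<star> minv x"

lemma mconj_closed: "x \<in> carrier (GL2 R) \<Longrightarrow> y \<in> M2 \<Longrightarrow> mconj x y \<in> M2"
  by (simp add: mconj_def GL2_M2 minv_M2)

lemma mconj_mult:
  assumes u: "u \<in> carrier (GL2 R)" and x: "x \<in> carrier (GL2 R)" and y: "y \<in> M2"
  shows "mconj (u \<star> x) y = u \<star> mconj x y \<star> minv u"
proof -
  have "minv (u \<star> x) = minv x \<star> minv u"
    using group.inv_mult_group[OF group_GL2 u x] by (simp add: minv_def GL2_mult)
  then show ?thesis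
    using assms by (simp add: mconj_def mmul_assoc GL2_M2 minv_M2)
qed

lemma mconj_trace: "x \<in> carrier (GL2 R) \<Longrightarrow> y \<in> M2 \<Longrightarrow> mat2_trace R (mconj x y) = mat2_trace R y"
  unfolding mconj_def
  by (subst mat2_trace_comm) (simp_all add: mmul_assoc[symmetric] GL2_M2 minv_M2 minv_left)

lemma mconj_det:
  assumes x: "x \<in> carrier (GL2 R)" and y: "y \<in> M2"
  shows "mat2_det R (mconj x y) = mat2_det R y"
proof -
  have "mat2_det R (mconj x y) = mat2_det R (minv x \<star> x) \<otimes> mat2_det R y"
    unfolding mconj_def using assms by (simp add: mat2_det_mult GL2_M2 minv_M2 m_ac)
  moreover have "mat2_det R (minv x \<star> x) = \<one>"
    using x by (simp add: minv_left) (simp add: mat2_scalar_def a_minus_def)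
  ultimately show ?thesis using y by simp
qed

text \<open>The discriminant of the characteristic polynomial, in a form that makes its reduction readable from the entries.
  Multiplication by \<open>4\<close> is a fourfold sum, which suits the normalisation of ring expressions.\<close>

definition disc :: "'a mat2 \<Rightarrow> 'a" where
  "disc x = (e11 x \<ominus> e22 x) \<otimes> (e11 x \<ominus> e22 x) \<oplus>
    (e12 x \<otimes> e21 x \<oplus> e12 x \<otimes> e21 x \<oplus> (e12 x \<otimes> e21 x \<oplus> e12 x \<otimes> e21 x))"

lemma disc_eq:
  assumes "x \<in> M2"
  shows "disc x = mat2_trace R x \<otimes> mat2_trace R x \<ominus>
    (mat2_det R x \<oplus> mat2_det R x \<oplus> (mat2_det R x \<oplus> mat2_det R x))"
  using assms by (elim M2_E) (simp add: disc_def, algebra)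

lemma mconj_disc: "x \<in> carrier (GL2 R) \<Longrightarrow> y \<in> M2 \<Longrightarrow> disc (mconj x y) = disc y"
  by (simp add: disc_eq mconj_closed mconj_trace mconj_det)

text \<open>This is \<open>z I + W y\<close>. Conjugation acts on it through \<open>y\<close> alone.\<close>

definition affine :: "'a \<Rightarrow> 'a \<Rightarrow> 'a mat2 \<Rightarrow> 'a mat2" where
  "affine z W y = Mat2 (z \<oplus> W \<otimes> e11 y) (W \<otimes> e12 y) (W \<otimes> e21 y) (z \<oplus> W \<otimes> e22 y)"

lemma mconj_affine:
  assumes x: "x \<in> carrier (GL2 R)" and y: "y \<in> M2" and z: "z \<in> carrier R" and W: "W \<in> carrier R"
  shows "mconj x (affine z W y) = affine z W (mconj x y)"
proof -
  obtain a b c d where x': "x = Mat2 a b c d" and ac: "a \<in> carrier R" "b \<in> carrier R" "c \<in> carrier R" "d \<in> carrier R"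
    using GL2_M2[OF x] by (rule M2_E)
  obtain p q s t where i': "minv x = Mat2 p q s t" and pc: "p \<in> carrier R" "q \<in> carrier R" "s \<in> carrier R" "t \<in> carrier R"
    using minv_M2[OF x] by (rule M2_E)
  obtain e f g h where y': "y = Mat2 e f g h" and ec: "e \<in> carrier R" "f \<in> carrier R" "g \<in> carrier R" "h \<in> carrier R"
    using y by (rule M2_E)
  have i: "a \<otimes> p \<oplus> b \<otimes> s = \<one>" "a \<otimes> q \<oplus> b \<otimes> t = \<zero>" "c \<otimes> p \<oplus> d \<otimes> s = \<zero>" "c \<otimes> q \<oplus> d \<otimes> t = \<one>"
    using minv_right[OF x] unfolding i' unfolding x' by (simp_all add: mat2_scalar_def)
  have id: "(a \<otimes> (z \<oplus> W \<otimes> e) \<oplus> b \<otimes> (W \<otimes> g)) \<otimes> p \<oplus> (a \<otimes> (W \<otimes> f) \<oplus> b \<otimes> (z \<oplus> W \<otimes> h)) \<otimes> s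
     = z \<otimes> (a \<otimes> p \<oplus> b \<otimes> s) \<oplus> W \<otimes> ((a \<otimes> e \<oplus> b \<otimes> g) \<otimes> p \<oplus> (a \<otimes> f \<oplus> b \<otimes> h) \<otimes> s)"
    if "a \<in> carrier R" "b \<in> carrier R" "p \<in> carrier R" "s \<in> carrier R" for a b p s
    using that ec z W by algebra
  show ?thesis
    unfolding mconj_def affine_def i' unfolding x' y'
    using ac pc ec z W by (simp add: id i)
qed

end

section \<open>Finite chain rings\<close>

text \<open>The finite quotients of a discrete valuation ring, described by what the argument needs: the maximal ideal is
  generated by \<open>w\<close>, annihilators of powers of \<open>w\<close> are as small as nilpotency permits, and \<open>T\<close>
  represents the residue field.\<close>

locale chain_ring = cring R for R (structure) +
  fixes w :: 'a and r q :: nat and T :: "'a set"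
  assumes w_closed [simp, intro]: "w \<in> carrier R"
    and r_pos: "r \<ge> 1"
    and unit_or_dvd: "x \<in> carrier R \<Longrightarrow> x \<in> Units R \<or> x \<in> PIdl w"
    and w_nilpotent: "w [^] r = \<zero>"
    and w_nonzero: "w [^] (r - 1) \<noteq> \<zero>"
    and ann_w: "x \<in> carrier R \<Longrightarrow> i \<le> r \<Longrightarrow> w [^] i \<otimes> x = \<zero> \<Longrightarrow> x \<in> PIdl (w [^] (r - i))"
    and T: "T \<subseteq> carrier R" "finite T" "card T = q"
    and T_ex: "x \<in> carrier R \<Longrightarrow> \<exists>t\<in>T. x \<ominus> t \<in> PIdl w"
    and T_inj: "t \<in> T \<Longrightarrow> t' \<in> T \<Longrightarrow> t \<ominus> t' \<in> PIdl w \<Longrightarrow> t = t'"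
    and two_unit: "\<one> \<oplus> \<one> \<in> Units R"
begin

definition I :: "nat \<Rightarrow> 'a set" where "I n = PIdl (w [^] n)"

lemma I_iff: "x \<in> I n \<longleftrightarrow> (\<exists>y\<in>carrier R. x = w [^] n \<otimes> y)"
proof -
  have "x \<in> I n \<longleftrightarrow> (\<exists>y\<in>carrier R. x = y \<otimes> w [^] n)"
    unfolding I_def cgenideal_def by blast
  also have "\<dots> \<longleftrightarrow> (\<exists>y\<in>carrier R. x = w [^] n \<otimes> y)"
    by (intro bex_cong refl) (simp add: m_comm)
  finally show ?thesis .
qed

lemma I_mult_w [simp, intro]: "y \<in> carrier R \<Longrightarrow> w [^] n \<otimes> y \<in> I n"
  unfolding I_iff by blast

lemma I_ideal: "ideal (I n) R"
  unfolding I_def by (rule cgenideal_ideal) simp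

lemma I_closed: "x \<in> I n \<Longrightarrow> x \<in> carrier R"
  by (rule ideal.Icarr[OF I_ideal])

lemma I_add: "x \<in> I n \<Longrightarrow> y \<in> I n \<Longrightarrow> x \<oplus> y \<in> I n"
  by (rule additive_subgroup.a_closed[OF ideal.axioms(1)[OF I_ideal]])

lemma I_minus: "x \<in> I n \<Longrightarrow> \<ominus> x \<in> I n"
  by (rule additive_subgroup.a_inv_closed[OF ideal.axioms(1)[OF I_ideal]])

lemma I_diff: "x \<in> I n \<Longrightarrow> y \<in> I n \<Longrightarrow> x \<ominus> y \<in> I n"
  unfolding a_minus_def by (intro I_add I_minus)

lemma I_mult: "x \<in> I n \<Longrightarrow> y \<in> carrier R \<Longrightarrow> x \<otimes> y \<in> I n" "x \<in> I n \<Longrightarrow> y \<in> carrier R \<Longrightarrow> y \<otimes> x \<in> I n"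
  by (rule ideal.I_r_closed[OF I_ideal] ideal.I_l_closed[OF I_ideal]; assumption)+

lemma I_zero [simp]: "\<zero> \<in> I n"
  using I_mult(1)[OF I_mult_w[of \<one> n] zero_closed] by simp

lemma I_times: "x \<in> I m \<Longrightarrow> y \<in> I n \<Longrightarrow> x \<otimes> y \<in> I (m + n)"
proof -
  assume "x \<in> I m" "y \<in> I n"
  then obtain a b where a: "a \<in> carrier R" "x = w [^] m \<otimes> a" and b: "b \<in> carrier R" "y = w [^] n \<otimes> b"
    by (auto simp: I_iff)
  have "x \<otimes> y = w [^] (m + n) \<otimes> (a \<otimes> b)"
    using a b by (simp add: nat_pow_mult[symmetric] m_ac)
  then show ?thesis using a b by simp
qed

lemma I_mono: "n \<le> m \<Longrightarrow> x \<in> I m \<Longrightarrow> x \<in> I n"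
proof -
  assume n: "n \<le> m" and "x \<in> I m"
  then obtain y where y: "y \<in> carrier R" "x = w [^] m \<otimes> y" by (auto simp: I_iff)
  have "w [^] m = w [^] n \<otimes> w [^] (m - n)" using n by (simp add: nat_pow_mult)
  then have "x = w [^] n \<otimes> (w [^] (m - n) \<otimes> y)" using y by (simp add: m_assoc)
  then show ?thesis using y by simp
qed

lemma I_0: "I 0 = carrier R"
  using I_mult_w[of _ 0] I_closed[of _ 0] by auto

lemma I_big: "r \<le> n \<Longrightarrow> x \<in> I n \<Longrightarrow> x = \<zero>"
  using I_mono[of r n x] by (auto simp: I_iff w_nilpotent)

lemma I_1: "I 1 = PIdl w"
  by (simp add: I_def)

lemma I_cancel:
  assumes x: "x \<in> carrier R" and ij: "i + j \<le> r" and h: "w [^] i \<otimes> x \<in> I (i + j)"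
  shows "x \<in> I j"
proof -
  from h obtain y where y: "y \<in> carrier R" "w [^] i \<otimes> x = w [^] (i + j) \<otimes> y" by (auto simp: I_iff)
  have "w [^] i \<otimes> (x \<ominus> w [^] j \<otimes> y) = w [^] i \<otimes> x \<ominus> w [^] (i + j) \<otimes> y"
    using x y(1) by (simp add: nat_pow_mult[symmetric] a_minus_def r_distr r_minus m_assoc)
  then have "w [^] i \<otimes> (x \<ominus> w [^] j \<otimes> y) = \<zero>" using x y by simp
  then have "x \<ominus> w [^] j \<otimes> y \<in> I (r - i)"
    using ann_w[of "x \<ominus> w [^] j \<otimes> y" i] x y ij by (simp add: I_def)
  then have "x \<ominus> w [^] j \<otimes> y \<in> I j" using I_mono[of j "r - i"] ij by simp
  from I_add[OF this I_mult_w[OF y(1), of j]] show ?thesis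
    using x y(1) by (simp add: a_minus_def a_assoc l_neg)
qed

lemma one_notin_I1: "\<one> \<notin> I 1"
proof
  assume "\<one> \<in> I 1"
  moreover have "w [^] (r - 1) \<in> I (r - 1)" using I_mult_w[of \<one> "r - 1"] by simp
  ultimately have "w [^] (r - 1) \<otimes> \<one> \<in> I (r - 1 + 1)" by (rule I_times[rotated])
  then show False using w_nonzero r_pos I_big[of r] by simp
qed

lemma Units_iff: "x \<in> Units R \<longleftrightarrow> x \<in> carrier R \<and> x \<notin> I 1"
proof -
  have "x \<notin> I 1" if x: "x \<in> Units R"
  proof
    assume "x \<in> I 1"
    from I_mult(1)[OF this, of "inv x"] show False using x one_notin_I1 by simp
  qed
  then show ?thesis using unit_or_dvd[of x] I_1 by auto
qed

lemma Units_add_I1: "x \<in> Units R \<Longrightarrow> y \<in> I 1 \<Longrightarrow> x \<oplus> y \<in> Units R"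
proof -
  assume x: "x \<in> Units R" and y: "y \<in> I 1"
  have "x \<in> I 1" if "x \<oplus> y \<in> I 1"
    using I_diff[OF that y] x I_closed[OF y] Units_closed by (simp add: a_minus_def a_assoc r_neg)
  then show ?thesis using x y I_closed[OF y] by (auto simp: Units_iff)
qed

lemma Units_prime:
  assumes "x \<in> carrier R" "y \<in> carrier R" shows "x \<otimes> y \<in> I 1 \<longleftrightarrow> x \<in> I 1 \<or> y \<in> I 1"
  using assms I_mult Units_m_closed[of x y] Units_iff by blast

text \<open>Downward induction on \<open>n\<close>: an element of the ideal of \<open>w\<^sup>n\<close> is uniquely \<open>w\<^sup>n t + z\<close> with \<open>t\<close> in the transversal
  and \<open>z\<close> in the next ideal. This also yields finiteness of the ring.\<close>

lemma card_I: "n \<le> r \<Longrightarrow> finite (I n) \<and> card (I n) = q ^ (r - n)"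
proof (induction n rule: inc_induct)
  case base
  have "I r = {\<zero>}" using I_big[of r] I_zero[of r] by blast
  then show ?case by simp
next
  case (step n)
  define f where "f = (\<lambda>(t, z). w [^] n \<otimes> t \<oplus> z)"
  have inj: "inj_on f (T \<times> I (Suc n))"
  proof (intro inj_onI, clarsimp simp: f_def)
    fix t z t' z' assume t: "t \<in> T" "t' \<in> T" and z: "z \<in> I (Suc n)" "z' \<in> I (Suc n)"
      and eq: "w [^] n \<otimes> t \<oplus> z = w [^] n \<otimes> t' \<oplus> z'"
    have tc: "t \<in> carrier R" "t' \<in> carrier R" using t T by auto
    note zc = I_closed[OF z(1)] I_closed[OF z(2)]
    have "W \<otimes> (t \<ominus> t') = (W \<otimes> t \<oplus> z) \<ominus> (W \<otimes> t' \<oplus> z') \<oplus> (z' \<ominus> z)" if "W \<in> carrier R" for W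
      using that tc zc by algebra
    then have "w [^] n \<otimes> (t \<ominus> t') = (w [^] n \<otimes> t \<oplus> z) \<ominus> (w [^] n \<otimes> t' \<oplus> z') \<oplus> (z' \<ominus> z)"
      by simp
    also have "\<dots> = z' \<ominus> z" unfolding eq using tc zc by (simp add: a_minus_def r_neg)
    finally have "w [^] n \<otimes> (t \<ominus> t') \<in> I (n + 1)" using I_diff[OF z(2,1)] by simp
    then have "t \<ominus> t' \<in> I 1" using I_cancel[of "t \<ominus> t'" n 1] step.hyps tc by simp
    then have "t = t'" using T_inj t I_1 by simp
    then show "t = t' \<and> z = z'" using eq tc zc by simp
  qed
  have im: "f ` (T \<times> I (Suc n)) = I n"
  proof (intro equalityI subsetI)
    fix x assume "x \<in> f ` (T \<times> I (Suc n))"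
    then obtain t z where "t \<in> T" "z \<in> I (Suc n)" "x = w [^] n \<otimes> t \<oplus> z" by (auto simp: f_def)
    then show "x \<in> I n" using T(1) I_mono[of n "Suc n" z] by (auto intro!: I_add I_mult_w)
  next
    fix x assume "x \<in> I n"
    then obtain y where y: "y \<in> carrier R" "x = w [^] n \<otimes> y" by (auto simp: I_iff)
    obtain t where t: "t \<in> T" "y \<ominus> t \<in> I 1" using T_ex[OF y(1)] I_1 by auto
    have tc: "t \<in> carrier R" using t T by auto
    have "w [^] n \<in> I n" using I_mult_w[of \<one> n] by simp
    from I_times[OF this t(2)] have "w [^] n \<otimes> (y \<ominus> t) \<in> I (Suc n)" by simp
    moreover have "W \<otimes> y = W \<otimes> t \<oplus> W \<otimes> (y \<ominus> t)" if "W \<in> carrier R" for W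
      using that y(1) tc by algebra
    then have "x = f (t, w [^] n \<otimes> (y \<ominus> t))"
      unfolding f_def y(2) by simp
    ultimately show "x \<in> f ` (T \<times> I (Suc n))" using t(1) by blast
  qed
  have "finite (f ` (T \<times> I (Suc n)))" using T step.IH by simp
  moreover have "card (I n) = q * card (I (Suc n))"
    using card_image[OF inj] T step.IH im by (simp add: card_cartesian_product)
  ultimately have "finite (I n)" "card (I n) = q * card (I (Suc n))" using im by simp_all
  moreover have "r - n = Suc (r - Suc n)" using step.hyps by simp
  ultimately show ?case using step.IH by simp
qed

lemma finite_R: "finite (carrier R)" and card_R: "card (carrier R) = q ^ r"
  using card_I[of 0] I_0 by auto

lemma finite_Units [simp]: "finite (Units R)"
  using finite_R by (rule finite_subset[rotated]) (auto simp: Units_def)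

lemma q_ge_2: "q \<ge> 2"
proof -
  have "q \<noteq> 0" using card_R finite_R r_pos by (metis card_0_eq empty_iff less_le_trans zero_closed zero_less_one zero_power)
  moreover have "q \<noteq> 1"
  proof
    assume "q = 1"
    then have "card (carrier R) = 1" using card_R by simp
    then have "\<one> = \<zero>" by (metis card_1_singletonE one_closed singletonD zero_closed)
    then show False using one_notin_I1 I_zero[of 1] by simp
  qed
  ultimately show ?thesis by simp
qed

lemma card_Units: "card (Units R) = (q - 1) * q ^ (r - 1)"
proof -
  have "Units R = carrier R - I 1" using Units_iff by blast
  then have "card (Units R) = q ^ r - q ^ (r - 1)"
    using card_Diff_subset[of "I 1" "carrier R"] card_I[of 1] card_R r_pos I_closed by (simp add: subsetI)
  also have "q ^ r = q * q ^ (r - 1)" using r_pos by (cases r) auto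
  finally show ?thesis by (simp add: diff_mult_distrib)
qed

text \<open>A substitute for Hensel's lemma. As \<open>2\<close> is a unit, squaring is injective on the units congruent to \<open>1\<close>
  modulo \<open>w\<close>, hence by finiteness surjective there.\<close>

lemma square_of_square_mod:
  assumes e: "e \<in> Units R" and x: "x \<in> carrier R" and h: "e \<ominus> x \<otimes> x \<in> I 1"
  shows "\<exists>y\<in>carrier R. e = y \<otimes> y"
proof -
  have ec: "e \<in> carrier R" using e Units_iff by blast
  have "x \<notin> I 1"
  proof
    assume "x \<in> I 1"
    from I_add[OF h I_mult(1)[OF this x]] have "e \<in> I 1"
      using ec x by (simp add: a_minus_def a_assoc l_neg)
    then show False using e Units_iff by blast
  qed
  then have xu: "x \<in> Units R" using x Units_iff by blast
  \<comment> \<open>The group of units congruent to \<open>1\<close>, on which squaring is bijective.\<close>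
  define A where "A = (\<lambda>y. \<one> \<oplus> y) ` I 1"
  have finA: "finite A" using card_I[of 1] r_pos by (simp add: A_def)
  have A_iff: "u \<in> A \<longleftrightarrow> u \<in> carrier R \<and> u \<ominus> \<one> \<in> I 1" for u
  proof
    assume "u \<in> A"
    then obtain y where y: "y \<in> I 1" "u = \<one> \<oplus> y" by (auto simp: A_def)
    have "u \<ominus> \<one> = y" unfolding y(2) using I_closed[OF y(1)] by (simp add: a_minus_def a_comm[of \<one>] a_assoc r_neg)
    then show "u \<in> carrier R \<and> u \<ominus> \<one> \<in> I 1" using y I_closed[OF y(1)] by simp
  next
    assume u: "u \<in> carrier R \<and> u \<ominus> \<one> \<in> I 1"
    have "u = \<one> \<oplus> (u \<ominus> \<one>)" using u by (simp add: a_minus_def a_comm[of u] r_neg2)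
    then show "u \<in> A" unfolding A_def using u by blast
  qed
  have sq: "(\<lambda>u. u \<otimes> u) ` A \<subseteq> A"
  proof (intro image_subsetI)
    fix u assume "u \<in> A"
    then have u: "u \<in> carrier R" "u \<ominus> \<one> \<in> I 1" by (auto simp: A_iff)
    have "u \<otimes> u \<ominus> v \<otimes> v = (u \<ominus> v) \<otimes> (u \<oplus> v)" if "v \<in> carrier R" for v using u(1) that by algebra
    from this[of \<one>] have "u \<otimes> u \<ominus> \<one> = (u \<ominus> \<one>) \<otimes> (u \<oplus> \<one>)" by simp
    then show "u \<otimes> u \<in> A" using u I_mult(1) by (simp add: A_iff)
  qed
  have "inj_on (\<lambda>u. u \<otimes> u) A"
  proof (rule inj_onI)
    fix u v assume "u \<in> A" "v \<in> A" and eq: "u \<otimes> u = v \<otimes> v"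
    then have u: "u \<in> carrier R" "u \<ominus> \<one> \<in> I 1" and v: "v \<in> carrier R" "v \<ominus> \<one> \<in> I 1" by (auto simp: A_iff)
    have "u \<oplus> v = (k \<oplus> k) \<oplus> ((u \<ominus> k) \<oplus> (v \<ominus> k))" if "k \<in> carrier R" for k
      using u(1) v(1) that by algebra
    from this[of \<one>] have s: "u \<oplus> v \<in> Units R" using Units_add_I1[OF two_unit I_add[OF u(2) v(2)]] by simp
    have "(u \<oplus> v) \<otimes> (u \<ominus> v) = u \<otimes> u \<ominus> v \<otimes> v" using u(1) v(1) by algebra
    also have "\<dots> = (u \<oplus> v) \<otimes> \<zero>" using eq u(1) v(1) by (simp add: a_minus_def r_neg)
    finally have "u \<ominus> v = \<zero>" using Units_l_cancel[OF s, of "u \<ominus> v" \<zero>] u v by simp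
    then show "u = v" using u v by simp
  qed
  then have surj: "(\<lambda>u. u \<otimes> u) ` A = A" using endo_inj_surj[OF finA sq] by simp
  define i where "i = inv x"
  have i: "i \<in> carrier R" "i \<otimes> x = \<one>" using xu by (auto simp: i_def)
  have "e \<otimes> (i \<otimes> i) \<ominus> k = (e \<ominus> x \<otimes> x) \<otimes> (i \<otimes> i) \<oplus> ((i \<otimes> x) \<otimes> (i \<otimes> x) \<ominus> k)"
    if "k \<in> carrier R" for k
    using ec x i(1) that by algebra
  from this[of \<one>] have "e \<otimes> (i \<otimes> i) \<ominus> \<one> = (e \<ominus> x \<otimes> x) \<otimes> (i \<otimes> i)"
    using ec x i by (simp add: a_minus_def r_neg)
  then have "e \<otimes> (i \<otimes> i) \<in> A" using h I_mult(1) i ec by (simp add: A_iff)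
  then have "e \<otimes> (i \<otimes> i) \<in> (\<lambda>u. u \<otimes> u) ` A" by (simp only: surj)
  then obtain u where "u \<in> A" and u: "e \<otimes> (i \<otimes> i) = u \<otimes> u" by blast
  then have uc: "u \<in> carrier R" by (simp add: A_iff)
  have "e \<otimes> ((i \<otimes> x) \<otimes> (i \<otimes> x)) = (e \<otimes> (i \<otimes> i)) \<otimes> (x \<otimes> x)" using ec i(1) x by algebra
  also have "\<dots> = (u \<otimes> x) \<otimes> (u \<otimes> x)" unfolding u using uc x by algebra
  finally show ?thesis using i ec uc x by auto
qed

end

section \<open>Character sums\<close>

locale chain_ring_char = chain_ring +
  fixes \<psi> :: "'a \<Rightarrow> complex"
  assumes psi_hom: "\<psi> \<in> hom (add_monoid R) complex_units"
    and psi_nontriv: "\<exists>x\<in>carrier R. \<psi> (w [^] (r - 1) \<otimes> x) \<noteq> 1"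
begin

lemma psi_add: "x \<in> carrier R \<Longrightarrow> y \<in> carrier R \<Longrightarrow> \<psi> (x \<oplus> y) = \<psi> x * \<psi> y"
  using psi_hom by (auto simp: hom_def complex_units_def)

lemma psi_nz: "x \<in> carrier R \<Longrightarrow> \<psi> x \<noteq> 0"
  using psi_hom by (auto simp: hom_def complex_units_def)

lemma psi_zero [simp]: "\<psi> \<zero> = 1"
  using psi_add[of \<zero> \<zero>] psi_nz[of \<zero>] by simp

lemma Units_r_inv_cancel: "k \<in> Units R \<Longrightarrow> x \<in> carrier R \<Longrightarrow> k \<otimes> (inv k \<otimes> x) = x"
  by (simp add: m_assoc[symmetric] Units_closed)

text \<open>Orthogonality: \<open>s \<mapsto> \<psi> (w\<^bsup>r - 1\<^esup> k s)\<close> is a non-trivial additive character when \<open>k\<close> is a unit.\<close>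

lemma psi_sum_zero:
  assumes k: "k \<in> Units R"
  shows "(\<Sum>s\<in>carrier R. \<psi> (w [^] (r - 1) \<otimes> k \<otimes> s)) = 0"
proof -
  obtain x where x: "x \<in> carrier R" "\<psi> (w [^] (r - 1) \<otimes> x) \<noteq> 1" using psi_nontriv by blast
  define f where "f s = \<psi> (w [^] (r - 1) \<otimes> k \<otimes> s)" for s
  define c where "c = inv k \<otimes> x"
  have c: "c \<in> carrier R" "w [^] (r - 1) \<otimes> k \<otimes> c = w [^] (r - 1) \<otimes> x"
    using k x(1) Units_closed[OF k] by (simp_all add: c_def m_assoc Units_r_inv_cancel)
  have shift: "f (s \<oplus> c) = f s * \<psi> (w [^] (r - 1) \<otimes> x)" if "s \<in> carrier R" for s
    using that c Units_closed[OF k] psi_add[of "w [^] (r - 1) \<otimes> k \<otimes> s" "w [^] (r - 1) \<otimes> x"] x(1)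
    by (simp add: f_def r_distr)
  have "(\<Sum>s\<in>carrier R. f s) = (\<Sum>s\<in>carrier R. f (s \<oplus> c))"
    by (rule sum.reindex_bij_witness[where i = "\<lambda>s. s \<oplus> c" and j = "\<lambda>s. s \<ominus> c"])
      (use c in \<open>auto simp: a_minus_def a_assoc l_neg r_neg\<close>)
  also have "\<dots> = (\<Sum>s\<in>carrier R. f s) * \<psi> (w [^] (r - 1) \<otimes> x)"
    by (simp add: shift sum_distrib_right)
  finally have "(\<Sum>s\<in>carrier R. f s) = 0" using x(2) by (simp add: algebra_simps)
  then show ?thesis by (simp add: f_def)
qed

text \<open>For \<open>k\<close> a unit the sum over the units is minus the sum over the maximal ideal, where the character is
  trivial.\<close>

lemma psi_sum_Units:
  assumes k: "k \<in> carrier R"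
  shows "(\<Sum>v\<in>Units R. \<psi> (w [^] (r - 1) \<otimes> k \<otimes> v)) = (if k \<in> I 1 then of_nat (card (Units R)) else - of_nat (q ^ (r - 1)))"
proof (cases "k \<in> I 1")
  case True
  have "w [^] (r - 1) \<otimes> k = \<zero>"
    using I_times[OF I_mult_w[of \<one> "r - 1"] True] I_big[of r] r_pos by simp
  then have "\<psi> (w [^] (r - 1) \<otimes> k \<otimes> v) = 1" if "v \<in> Units R" for v
    using Units_closed[OF that] by simp
  then show ?thesis using True by simp
next
  case False
  then have ku: "k \<in> Units R" using k Units_iff by blast
  have z: "w [^] (r - 1) \<otimes> k \<otimes> v = \<zero>" if "v \<in> I 1" for v
    using I_times[OF I_mult_w[OF k, of "r - 1"] that] I_big[of r] r_pos by simp
  have "carrier R = Units R \<union> I 1" "Units R \<inter> I 1 = {}" using Units_iff I_closed by auto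
  then have "(\<Sum>v\<in>carrier R. \<psi> (w [^] (r - 1) \<otimes> k \<otimes> v)) = (\<Sum>v\<in>Units R. \<psi> (w [^] (r - 1) \<otimes> k \<otimes> v)) + (\<Sum>v\<in>I 1. \<psi> (w [^] (r - 1) \<otimes> k \<otimes> v))"
    using card_I[of 1] r_pos by (simp add: sum.union_disjoint)
  then have "0 = (\<Sum>v\<in>Units R. \<psi> (w [^] (r - 1) \<otimes> k \<otimes> v)) + (\<Sum>v\<in>I 1. \<psi> (w [^] (r - 1) \<otimes> k \<otimes> v))"
    using psi_sum_zero[OF ku] by simp
  also have "(\<Sum>v\<in>I 1. \<psi> (w [^] (r - 1) \<otimes> k \<otimes> v)) = of_nat (q ^ (r - 1))"
  proof -
    have "(\<Sum>v\<in>I 1. \<psi> (w [^] (r - 1) \<otimes> k \<otimes> v)) = (\<Sum>v\<in>I 1. 1)"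
      by (intro sum.cong refl) (simp add: z del: One_nat_def)
    then show ?thesis using card_I[of 1] r_pos by simp
  qed
  finally show ?thesis using False by (simp add: eq_neg_iff_add_eq_0)
qed

end

section \<open>The inducing subgroup and its character\<close>

context chain_ring begin

text \<open>Compatibility of this congruence with multiplication makes the normality of the congruence subgroups and the
  comparison of \<open>S K\<close> with \<open>S\<close> formal.\<close>

definition mcong :: "nat \<Rightarrow> 'a mat2 \<Rightarrow> 'a mat2 \<Rightarrow> bool" where
  "mcong n x y \<longleftrightarrow> set_mat2 (mat2_diff R x y) \<subseteq> I n"

lemma mcong_Mat2: "mcong n (Mat2 a b c d) (Mat2 a' b' c' d') \<longleftrightarrow>
    a \<ominus> a' \<in> I n \<and> b \<ominus> b' \<in> I n \<and> c \<ominus> c' \<in> I n \<and> d \<ominus> d' \<in> I n"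
  by (simp add: mcong_def)

lemma diff_I_sym: "a \<in> carrier R \<Longrightarrow> b \<in> carrier R \<Longrightarrow> a \<ominus> b \<in> I n \<Longrightarrow> b \<ominus> a \<in> I n"
  using I_minus[of "a \<ominus> b" n] by (simp add: a_minus_def minus_add a_comm)

lemma diff_I_trans:
  assumes "a \<in> carrier R" "b \<in> carrier R" "c \<in> carrier R" "a \<ominus> b \<in> I n" "b \<ominus> c \<in> I n"
  shows "a \<ominus> c \<in> I n"
proof -
  have "a \<ominus> c = (a \<ominus> b) \<oplus> (b \<ominus> c)" using assms(1-3) by algebra
  then show ?thesis using I_add assms(4,5) by simp
qed

lemma mcong_refl: "x \<in> M2 \<Longrightarrow> mcong n x x"
  by (elim M2_E) (simp add: mcong_Mat2 a_minus_def r_neg)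

lemma mcong_sym: "x \<in> M2 \<Longrightarrow> y \<in> M2 \<Longrightarrow> mcong n x y \<Longrightarrow> mcong n y x"
  by (elim M2_E) (simp add: mcong_Mat2 diff_I_sym)

lemma mcong_trans: "x \<in> M2 \<Longrightarrow> y \<in> M2 \<Longrightarrow> z \<in> M2 \<Longrightarrow> mcong n x y \<Longrightarrow> mcong n y z \<Longrightarrow> mcong n x z"
  by (elim M2_E) (auto simp: mcong_Mat2 intro: diff_I_trans)

lemma mcong_mult:
  assumes "x \<in> M2" "y \<in> M2" "z \<in> M2" "mcong n x y"
  shows "mcong n (z \<star> x) (z \<star> y)" "mcong n (x \<star> z) (y \<star> z)"
proof -
  have "set_mat2 (z \<star> u) \<subseteq> I n \<and> set_mat2 (u \<star> z) \<subseteq> I n" if "u \<in> M2" "set_mat2 u \<subseteq> I n" for u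
    using that assms(3) by (elim M2_E) (simp add: I_add I_mult)
  from this[of "mat2_diff R x y"] show "mcong n (z \<star> x) (z \<star> y)" "mcong n (x \<star> z) (y \<star> z)"
    using assms by (simp_all add: mcong_def mmul_diff_distrib)
qed

lemma cong_subgroup_iff:
  "k \<in> cong_subgroup R w n \<longleftrightarrow> k \<in> carrier (GL2 R) \<and> mcong n k (mat2_scalar R \<one>)"
  by (simp add: cong_subgroup_def mcong_def I_def)

lemma cong_subgroup_normal: "cong_subgroup R w n \<lhd> GL2 R"
proof -
  interpret G: group "GL2 R" by (rule group_GL2)
  have one: "mat2_scalar R \<one> \<in> M2" by simp
  have mult: "mcong n (x \<star> k \<star> minv x) (mat2_scalar R \<one>)"
    if "x \<in> carrier (GL2 R)" "k \<in> M2" "mcong n k (mat2_scalar R \<one>)" for x k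
  proof -
    have "mcong n (x \<star> k \<star> minv x) (x \<star> mat2_scalar R \<one> \<star> minv x)"
      using that by (intro mcong_mult) (auto simp: GL2_M2 minv_M2)
    then show ?thesis using that by (simp add: GL2_M2 minv_right)
  qed
  have "subgroup (cong_subgroup R w n) (GL2 R)"
  proof (rule G.subgroupI)
    show "cong_subgroup R w n \<subseteq> carrier (GL2 R)" by (auto simp: cong_subgroup_iff)
    have "mat2_scalar R \<one> \<in> cong_subgroup R w n"
      using G.one_closed by (simp add: cong_subgroup_iff GL2_one mcong_refl)
    then show "cong_subgroup R w n \<noteq> {}" by blast
    fix k assume k: "k \<in> cong_subgroup R w n"
    then have k': "k \<in> carrier (GL2 R)" "mcong n k (mat2_scalar R \<one>)" by (simp_all add: cong_subgroup_iff)
    have "mcong n (minv k \<star> k) (minv k \<star> mat2_scalar R \<one>)"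
      using k' by (intro mcong_mult) (auto simp: GL2_M2 minv_M2)
    then have "mcong n (minv k) (mat2_scalar R \<one>)"
      using k' by (auto intro!: mcong_sym[of "mat2_scalar R \<one>" "minv k"] simp add: minv_M2 minv_left)
    then show "inv\<^bsub>GL2 R\<^esub> k \<in> cong_subgroup R w n"
      using k' minv_GL2[of k] by (simp add: cong_subgroup_iff minv_def)
    fix j assume j: "j \<in> cong_subgroup R w n"
    then have j': "j \<in> carrier (GL2 R)" "mcong n j (mat2_scalar R \<one>)" by (simp_all add: cong_subgroup_iff)
    have "mcong n (k \<star> j) (mat2_scalar R \<one> \<star> j)"
      using k' j' by (intro mcong_mult) (auto simp: GL2_M2)
    then have "mcong n (k \<star> j) (mat2_scalar R \<one>)"
      using k' j' mcong_trans[of "k \<star> j" j "mat2_scalar R \<one>" n] by (simp add: GL2_M2)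
    then show "k \<otimes>\<^bsub>GL2 R\<^esub> j \<in> cong_subgroup R w n"
      using k' j' G.m_closed[of k j] by (simp add: cong_subgroup_iff GL2_mult)
  qed
  moreover have "x \<otimes>\<^bsub>GL2 R\<^esub> k \<otimes>\<^bsub>GL2 R\<^esub> inv\<^bsub>GL2 R\<^esub> x \<in> cong_subgroup R w n"
    if "x \<in> carrier (GL2 R)" "k \<in> cong_subgroup R w n" for x k
    using that mult[of x k] G.m_closed G.inv_closed
    by (simp add: cong_subgroup_iff GL2_M2 minv_def GL2_mult)
  ultimately show ?thesis by (intro G.normal_invI) auto
qed

lemma Units_mult_add:
  "a \<in> Units R \<Longrightarrow> a' \<in> Units R \<Longrightarrow> y \<in> I 1 \<Longrightarrow> a \<otimes> a' \<oplus> y \<in> Units R"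
  by (intro Units_add_I1 Units_m_closed)

definition S_elem :: "'a \<Rightarrow> 'a \<Rightarrow> 'a \<Rightarrow> 'a mat2" where
  "S_elem D a b = Mat2 a b (\<ominus> D \<otimes> b) a"

lemma S_elem_mult:
  assumes "D \<in> carrier R" "a \<in> carrier R" "b \<in> carrier R" "a' \<in> carrier R" "b' \<in> carrier R"
  shows "S_elem D a b \<star> S_elem D a' b' = S_elem D (a \<otimes> a' \<oplus> \<ominus> D \<otimes> (b \<otimes> b')) (a \<otimes> b' \<oplus> b \<otimes> a')"
proof -
  have "a \<otimes> a' \<oplus> b \<otimes> (\<ominus> D \<otimes> b') = a \<otimes> a' \<oplus> \<ominus> D \<otimes> (b \<otimes> b')"
    "\<ominus> D \<otimes> b \<otimes> a' \<oplus> a \<otimes> (\<ominus> D \<otimes> b') = \<ominus> D \<otimes> (a \<otimes> b' \<oplus> b \<otimes> a')"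
    "\<ominus> D \<otimes> b \<otimes> b' \<oplus> a \<otimes> a' = a \<otimes> a' \<oplus> \<ominus> D \<otimes> (b \<otimes> b')"
    using assms by algebra+
  then show ?thesis by (simp add: S_elem_def)
qed

lemma S_group_E:
  assumes "s \<in> S_group R D"
  obtains a b where "s = S_elem D a b" "a \<in> Units R" "b \<in> carrier R"
  using assms by (auto simp: S_group_def S_elem_def)

lemma S_elem_S: "a \<in> Units R \<Longrightarrow> b \<in> carrier R \<Longrightarrow> S_elem D a b \<in> S_group R D"
  by (auto simp: S_group_def S_elem_def)

lemma S_elem_M2: "D \<in> carrier R \<Longrightarrow> a \<in> carrier R \<Longrightarrow> b \<in> carrier R \<Longrightarrow> S_elem D a b \<in> M2"
  by (simp add: S_elem_def)

lemma S_group_GL2: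
  assumes D: "D \<in> I 1" and s: "s \<in> S_group R D"
  shows "s \<in> carrier (GL2 R)"
proof -
  obtain a b where s: "s = S_elem D a b" "a \<in> Units R" "b \<in> carrier R" using s by (rule S_group_E)
  have "a \<otimes> a \<oplus> \<ominus> (b \<otimes> (\<ominus> D \<otimes> b)) \<in> Units R"
    using s D by (intro Units_mult_add I_minus I_mult)
  then show ?thesis
    using s I_closed[OF D] Units_closed by (simp add: carrier_GL2 S_elem_def a_minus_def)
qed

lemma S_group_subgroup:
  assumes D: "D \<in> I 1"
  shows "subgroup (S_group R D) (GL2 R)"
proof -
  interpret G: group "GL2 R" by (rule group_GL2)
  note Dc = I_closed[OF D]
  show ?thesis
  proof (rule G.subgroupI)
    show "S_group R D \<subseteq> carrier (GL2 R)" using S_group_GL2[OF D] by blast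
    show "S_group R D \<noteq> {}" using S_elem_S[of \<one> \<zero> D] by auto
    fix s assume s0: "s \<in> S_group R D"
    then obtain a b where s: "s = S_elem D a b" "a \<in> Units R" "b \<in> carrier R" by (rule S_group_E)
    have ac: "a \<in> carrier R" using s(2) Units_closed by blast
    define d where "d = a \<otimes> a \<oplus> D \<otimes> (b \<otimes> b)"
    have d: "d \<in> Units R" unfolding d_def using s D by (intro Units_mult_add I_mult) auto
    define e where "e = inv d"
    have e: "e \<in> Units R" "e \<in> carrier R" "e \<otimes> d = \<one>" using d by (simp_all add: e_def)
    have "a \<otimes> (e \<otimes> a) \<oplus> \<ominus> D \<otimes> (b \<otimes> (\<ominus> e \<otimes> b)) = e \<otimes> d"
      "a \<otimes> (\<ominus> e \<otimes> b) \<oplus> b \<otimes> (e \<otimes> a) = \<zero>"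
      unfolding d_def using ac s(3) e(2) Dc by algebra+
    then have "s \<star> S_elem D (e \<otimes> a) (\<ominus> e \<otimes> b) = mat2_scalar R \<one>"
      using s ac e Dc by (simp add: S_elem_mult) (simp add: S_elem_def mat2_scalar_def)
    then have "minv s = S_elem D (e \<otimes> a) (\<ominus> e \<otimes> b)"
      using S_group_GL2[OF D s0] ac s(3) e(2) Dc by (intro minv_unique) (auto simp: S_elem_M2)
    then show "inv\<^bsub>GL2 R\<^esub> s \<in> S_group R D"
      using s e by (simp add: minv_def S_elem_S)
    fix t assume "t \<in> S_group R D"
    then obtain a' b' where t: "t = S_elem D a' b'" "a' \<in> Units R" "b' \<in> carrier R" by (rule S_group_E)
    have "a \<otimes> a' \<oplus> \<ominus> D \<otimes> (b \<otimes> b') \<in> Units R"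
      using s t D by (intro Units_mult_add I_mult I_minus) auto
    then show "s \<otimes>\<^bsub>GL2 R\<^esub> t \<in> S_group R D"
      using s t ac Units_closed Dc by (simp add: GL2_mult S_elem_mult S_elem_S)
  qed
qed

lemma S_elem_beta_comm:
  assumes "D \<in> carrier R" "a \<in> carrier R" "b \<in> carrier R"
  shows "S_elem D a b \<star> beta_hat R D = beta_hat R D \<star> S_elem D a b"
  using assms by (simp add: S_elem_def beta_hat_def l_minus r_minus m_comm)

end

text \<open>As \<open>r = 2 l\<close>, products of two elements of the ideal of \<open>w\<^sup>l\<close> vanish. This is why \<open>\<psi>\<^sub>\<beta>\<close> is multiplicative
  on \<open>K\<close>.\<close>

locale split_data = chain_ring_char R w r q T \<psi>
  for R (structure) and w and r q :: nat and T and \<psi> +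
  fixes l :: nat and D and \<theta> :: "'a mat2 \<Rightarrow> complex"
  assumes r_eq: "r = 2 * l" and D: "D \<in> I 1"
    and theta_hom: "\<theta> \<in> hom ((GL2 R)\<lparr>carrier := S_group R D\<rparr>) complex_units"
    and theta_agrees: "k \<in> S_group R D \<inter> cong_subgroup R w l \<Longrightarrow> \<theta> k = psi_beta R \<psi> (beta_hat R D) k"
begin

abbreviation "K \<equiv> cong_subgroup R w l"
abbreviation "S \<equiv> S_group R D"
abbreviation "H \<equiv> S <#>\<^bsub>GL2 R\<^esub> K"
abbreviation "\<kappa> \<equiv> psi_beta R \<psi> (beta_hat R D)"
abbreviation "\<Theta> \<equiv> theta_psi R w l \<psi> D \<theta>"

lemma l_pos: "l \<ge> 1" and l_le_r: "l \<le> r"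
  using r_eq r_pos by auto

lemma D_carrier [simp]: "D \<in> carrier R"
  using D I_closed by blast

lemma psi_beta_eq: "k \<in> M2 \<Longrightarrow> \<kappa> k = \<psi> (e21 k \<ominus> D \<otimes> e12 k)"
  by (elim M2_E) (simp add: psi_beta_def beta_hat_def mat2_scalar_def a_minus_def l_minus)

lemma mult_one_mod:
  assumes x: "x \<in> I l" and y: "y \<in> carrier R" "y \<ominus> \<one> \<in> I l"
  shows "x \<otimes> y = x" "y \<otimes> x = x"
proof -
  have "x \<otimes> (y \<ominus> \<one>) = \<zero>"
    using I_times[OF x y(2)] I_big[of "l + l"] r_eq by simp
  moreover have "x \<otimes> (y \<ominus> \<one>) = x \<otimes> y \<ominus> x"
    using I_closed[OF x] y(1) by (simp add: a_minus_def r_distr r_minus)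
  ultimately show "x \<otimes> y = x" using I_closed[OF x] y(1) by simp
  then show "y \<otimes> x = x" using I_closed[OF x] y(1) by (simp add: m_comm)
qed

lemma kappa_mult:
  assumes "k \<in> K" "k' \<in> K"
  shows "\<kappa> (k \<otimes>\<^bsub>GL2 R\<^esub> k') = \<kappa> k * \<kappa> k'"
proof -
  have "k \<in> M2" "k' \<in> M2" using assms by (auto simp: cong_subgroup_iff GL2_M2)
  then obtain a b c d a' b' c' d' where k: "k = Mat2 a b c d" "k' = Mat2 a' b' c' d'"
    and car: "a \<in> carrier R" "b \<in> carrier R" "c \<in> carrier R" "d \<in> carrier R"
    "a' \<in> carrier R" "b' \<in> carrier R" "c' \<in> carrier R" "d' \<in> carrier R"
    by (elim M2_E) blast
  have mem: "a \<ominus> \<one> \<in> I l" "b \<in> I l" "c \<in> I l" "d \<ominus> \<one> \<in> I l"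
    "a' \<ominus> \<one> \<in> I l" "b' \<in> I l" "c' \<in> I l" "d' \<ominus> \<one> \<in> I l"
    using assms car by (simp_all add: k cong_subgroup_iff mcong_Mat2 mat2_scalar_def a_minus_def)
  have "\<kappa> (k \<star> k') = \<psi> ((c \<oplus> c') \<ominus> D \<otimes> (b' \<oplus> b))"
    using car mem by (simp add: k psi_beta_eq mult_one_mod)
  also have "(c \<oplus> c') \<ominus> D \<otimes> (b' \<oplus> b) = (c \<ominus> D \<otimes> b) \<oplus> (c' \<ominus> D \<otimes> b')"
    using car D_carrier by algebra
  finally show ?thesis
    using car by (simp add: GL2_mult k psi_beta_eq psi_add)
qed

text \<open>Elements of \<open>S\<close> commute with \<open>\<beta>\<close>, so cyclicity of the trace makes \<open>\<psi>\<^sub>\<beta>\<close> invariant under \<open>S\<close>.\<close>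

lemma kappa_conj:
  assumes s: "s \<in> S" and k: "k \<in> K"
  shows "\<kappa> (s \<otimes>\<^bsub>GL2 R\<^esub> k \<otimes>\<^bsub>GL2 R\<^esub> inv\<^bsub>GL2 R\<^esub> s) = \<kappa> k"
proof -
  define B where "B = beta_hat R D"
  define Y where "Y = mat2_diff R k (mat2_scalar R \<one>)"
  have sG: "s \<in> carrier (GL2 R)" using S_group_GL2[OF D s] .
  have B: "B \<in> M2" by (simp add: B_def beta_hat_def)
  have kM: "k \<in> M2" using k by (simp add: cong_subgroup_iff GL2_M2)
  then have Y: "Y \<in> M2" by (simp add: Y_def)
  note cl = B Y GL2_M2[OF sG] minv_M2[OF sG]
  obtain a b where "s = S_elem D a b" "a \<in> Units R" "b \<in> carrier R" using s by (rule S_group_E)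
  then have comm: "B \<star> s = s \<star> B" using S_elem_beta_comm[of D a b] Units_closed by (simp add: B_def)
  have "mat2_diff R (s \<star> k \<star> minv s) (mat2_scalar R \<one>) = s \<star> Y \<star> minv s"
    using cl kM minv_right[OF sG] by (simp add: Y_def mmul_diff_distrib)
  then have "mat2_trace R (B \<star> mat2_diff R (s \<star> k \<star> minv s) (mat2_scalar R \<one>))
      = mat2_trace R (s \<star> (B \<star> Y \<star> minv s))"
    using cl comm by (simp add: mmul_assoc[symmetric])
  also have "\<dots> = mat2_trace R (B \<star> Y \<star> minv s \<star> s)"
    using cl by (intro mat2_trace_comm) auto
  also have "\<dots> = mat2_trace R (B \<star> Y)"
    using cl minv_left[OF sG] by (simp add: mmul_assoc)
  finally show ?thesis
    by (simp add: psi_beta_def B_def Y_def GL2_mult minv_def)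
qed

lemma kappa_nz: "k \<in> K \<Longrightarrow> \<kappa> k \<noteq> 0"
proof -
  assume "k \<in> K"
  then have k: "k \<in> M2" by (simp add: cong_subgroup_iff GL2_M2)
  then have "e21 k \<ominus> D \<otimes> e12 k \<in> carrier R" by (simp add: M2_iff)
  then show ?thesis using psi_nz by (simp add: psi_beta_eq[OF k])
qed

lemmas glue_assms = S_group_subgroup[OF D] cong_subgroup_normal theta_hom kappa_mult kappa_conj
  kappa_nz theta_agrees theta_psi_def

lemma Theta_apply: "s \<in> S \<Longrightarrow> k \<in> K \<Longrightarrow> \<Theta> (s \<star> k) = \<theta> s * \<kappa> k"
  using group.glue_apply[OF group_GL2 glue_assms] by (simp add: GL2_mult)

lemma H_subgroup: "subgroup H (GL2 R)"
  by (rule group.glue_subgroup[OF group_GL2 glue_assms])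

lemma Theta_mult: "g \<in> H \<Longrightarrow> h \<in> H \<Longrightarrow> \<Theta> (g \<otimes>\<^bsub>GL2 R\<^esub> h) = \<Theta> g * \<Theta> h"
  by (rule group.glue_mult[OF group_GL2 glue_assms])

lemma Theta_nz: "g \<in> H \<Longrightarrow> \<Theta> g \<noteq> 0"
  by (rule group.glue_nz[OF group_GL2 glue_assms])

text \<open>Together with the converse \<open>H_mem\<close> this describes \<open>H\<close> as the matrices congruent modulo \<open>w\<^sup>l\<close> to an element
  of \<open>S\<close>; the description serves for counting and for excluding conjugates.\<close>

lemma H_cong:
  assumes g: "Mat2 a b c d \<in> H"
  shows "a \<in> Units R" "b \<in> carrier R" "c \<oplus> D \<otimes> b \<in> I l" "d \<ominus> a \<in> I l" "c \<in> carrier R" "d \<in> carrier R"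
proof -
  obtain s k where s: "s \<in> S" and k: "k \<in> K" and eq: "Mat2 a b c d = s \<star> k"
    using g by (auto simp: set_mult_def GL2_mult)
  obtain a' b' where s': "s = S_elem D a' b'" "a' \<in> Units R" "b' \<in> carrier R" using s by (rule S_group_E)
  have kM: "k \<in> M2" "mcong l k (mat2_scalar R \<one>)" using k by (auto simp: cong_subgroup_iff GL2_M2)
  have sM: "s \<in> M2" using S_group_GL2[OF D s] by (rule GL2_M2)
  have "Mat2 a b c d \<in> M2" using eq sM kM by simp
  then show car: "b \<in> carrier R" "c \<in> carrier R" "d \<in> carrier R" by simp_all
  have ac: "a \<in> carrier R" using \<open>Mat2 a b c d \<in> M2\<close> by simp
  have a'c: "a' \<in> carrier R" using s'(2) Units_closed by blast
  have "mcong l (s \<star> k) (s \<star> mat2_scalar R \<one>)"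
    using kM sM by (intro mcong_mult) auto
  then have "mcong l (Mat2 a b c d) (Mat2 a' b' (\<ominus> D \<otimes> b') a')"
    using sM by (simp add: eq) (simp add: s' S_elem_def)
  then have m: "a \<ominus> a' \<in> I l" "b \<ominus> b' \<in> I l" "c \<ominus> \<ominus> D \<otimes> b' \<in> I l" "d \<ominus> a' \<in> I l"
    by (simp_all add: mcong_Mat2)
  have "a = a' \<oplus> (a \<ominus> a')" using ac a'c by algebra
  then show "a \<in> Units R"
    using Units_add_I1[OF s'(2) I_mono[OF l_pos m(1)]] by simp
  have "c \<oplus> D \<otimes> b = (c \<ominus> \<ominus> D \<otimes> b') \<oplus> D \<otimes> (b \<ominus> b')"
    using car s' D_carrier by algebra
  then show "c \<oplus> D \<otimes> b \<in> I l" using m D_carrier I_add I_mult by simp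
  have "d \<ominus> a = (d \<ominus> a') \<ominus> (a \<ominus> a')" using ac a'c car by algebra
  then show "d \<ominus> a \<in> I l" using I_diff m by simp
qed

lemma H_mem:
  assumes a: "a \<in> Units R" and b: "b \<in> carrier R" and y: "y \<in> I l" and z: "z \<in> I l"
  shows "Mat2 a b (\<ominus> D \<otimes> b \<oplus> y) (a \<oplus> z) \<in> H"
proof -
  define g where "g = Mat2 a b (\<ominus> D \<otimes> b \<oplus> y) (a \<oplus> z)"
  define s where "s = S_elem D a b"
  have ac: "a \<in> carrier R" using a Units_closed by blast
  note car = ac b I_closed[OF y] I_closed[OF z] D_carrier
  have s: "s \<in> S" using a b by (simp add: s_def S_elem_S)
  have sG: "s \<in> carrier (GL2 R)" using S_group_GL2[OF D s] .
  have gM: "g \<in> M2" using car by (simp add: g_def)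
  have "a \<otimes> (a \<oplus> z) \<ominus> b \<otimes> (\<ominus> D \<otimes> b \<oplus> y) = a \<otimes> a \<oplus> (a \<otimes> z \<oplus> (D \<otimes> (b \<otimes> b) \<ominus> b \<otimes> y))"
    using car by algebra
  moreover have "a \<otimes> z \<oplus> (D \<otimes> (b \<otimes> b) \<ominus> b \<otimes> y) \<in> I 1"
    using car D I_mono[OF l_pos y] I_mono[OF l_pos z] by (intro I_add I_diff I_mult) auto
  ultimately have "mat2_det R g \<in> Units R"
    using Units_mult_add[OF a a] by (simp add: g_def)
  then have gG: "g \<in> carrier (GL2 R)" using gM by (simp add: carrier_GL2)
  have "\<ominus> D \<otimes> b \<oplus> y \<ominus> \<ominus> D \<otimes> b = y" "a \<oplus> z \<ominus> a = z"
    using car by algebra+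
  then have "mcong l g s"
    using car y z by (simp add: g_def s_def S_elem_def mcong_Mat2) (simp add: a_minus_def r_neg)
  then have "mcong l (minv s \<star> g) (minv s \<star> s)"
    using gM minv_M2[OF sG] GL2_M2[OF sG] by (intro mcong_mult) auto
  moreover have "minv s \<star> g \<in> carrier (GL2 R)"
    using group.inv_closed[OF group_GL2 sG] gG monoid.m_closed[OF group.is_monoid[OF group_GL2]]
    by (simp add: minv_def GL2_mult[symmetric])
  ultimately have "minv s \<star> g \<in> K"
    using minv_left[OF sG] by (simp add: cong_subgroup_iff)
  moreover have "g = s \<star> (minv s \<star> g)"
    using minv_right[OF sG] gM minv_M2[OF sG] GL2_M2[OF sG] by (simp add: mmul_assoc[symmetric])
  ultimately have "g \<in> H" using s by (auto simp: set_mult_def GL2_mult)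
  then show ?thesis by (simp add: g_def)
qed

lemma card_H: "card H = card (Units R) * q ^ (2 * r)"
proof -
  define f where "f = (\<lambda>(a, b, y, z). Mat2 a b (\<ominus> D \<otimes> b \<oplus> y) (a \<oplus> z))"
  define P where "P = Units R \<times> carrier R \<times> I l \<times> I l"
  have inj: "inj_on f P"
  proof (rule inj_onI)
    fix u v assume u: "u \<in> P" "v \<in> P" and eq: "f u = f v"
    obtain a b y z a' b' y' z' where uv: "u = (a, b, y, z)" "v = (a', b', y', z')" by (metis prod_cases4)
    have car: "a \<in> carrier R" "y \<in> carrier R" "z \<in> carrier R" "b \<in> carrier R" "y' \<in> carrier R" "z' \<in> carrier R"
      using u I_closed Units_closed by (auto simp: P_def uv)
    have "a = a'" "b = b'" "\<ominus> D \<otimes> b \<oplus> y = \<ominus> D \<otimes> b \<oplus> y'" "a \<oplus> z = a \<oplus> z'"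
      using eq by (auto simp: f_def uv)
    then show "u = v" using car by (simp add: uv)
  qed
  have "f ` P = H"
  proof (intro equalityI subsetI)
    fix g assume "g \<in> f ` P"
    then show "g \<in> H" using H_mem by (auto simp: f_def P_def)
  next
    fix g assume g: "g \<in> H"
    obtain a b c d where eq: "g = Mat2 a b c d" by (cases g)
    note h = H_cong[OF g[unfolded eq]]
    have ac: "a \<in> carrier R" using h(1) Units_closed by blast
    have "c = \<ominus> D \<otimes> b \<oplus> (c \<oplus> D \<otimes> b)" "d = a \<oplus> (d \<ominus> a)"
      using h ac D_carrier by algebra+
    then have "g = f (a, b, c \<oplus> D \<otimes> b, d \<ominus> a)" by (simp add: f_def eq)
    moreover have "(a, b, c \<oplus> D \<otimes> b, d \<ominus> a) \<in> P" using h by (simp add: P_def)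
    ultimately show "g \<in> f ` P" by blast
  qed
  then have "card H = card P" using card_image[OF inj] by simp
  also have "\<dots> = card (Units R) * (q ^ r * (q ^ l * q ^ l))"
    using card_I[OF l_le_r] r_eq by (simp add: P_def card_cartesian_product card_R)
  also have "q ^ r * (q ^ l * q ^ l) = q ^ (2 * r)"
    by (simp add: r_eq power_add[symmetric] mult_2)
  finally show ?thesis .
qed

text \<open>The factorisation is \<open>z I + W m = (z I) (I + z\<inverse> W m)\<close>, with the first factor in \<open>S\<close> and the second in
  \<open>K\<close>.\<close>

lemma Theta_affine:
  assumes z: "z \<in> Units R" and W: "W \<in> I l" and m: "m \<in> M2"
  shows "affine z W m \<in> H"
    and "\<Theta> (affine z W m) = \<theta> (mat2_scalar R z) * \<psi> (inv z \<otimes> W \<otimes> (e21 m \<ominus> D \<otimes> e12 m))"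
proof -
  define v where "v = inv z"
  have zc: "z \<in> carrier R" and v: "v \<in> carrier R" "z \<otimes> v = \<one>" using z Units_closed by (simp_all add: v_def)
  have Wc: "W \<in> carrier R" using W I_closed by blast
  obtain a b c d where m': "m = Mat2 a b c d"
    and mc: "a \<in> carrier R" "b \<in> carrier R" "c \<in> carrier R" "d \<in> carrier R" using m by (rule M2_E)
  define k where "k = affine \<one> (v \<otimes> W) m"
  have vW: "v \<otimes> W \<in> I l" using W v I_mult by simp
  have kM: "k \<in> M2" using mc v Wc by (simp add: k_def affine_def m')
  have cancel: "z \<otimes> (v \<otimes> W \<otimes> x) = W \<otimes> x" if "x \<in> carrier R" for x
    using v zc Wc that by (simp add: m_assoc[symmetric])
  have zk: "mat2_scalar R z \<star> k = affine z W m"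
    using mc v Wc zc by (simp add: k_def affine_def m' mat2_scalar_def r_distr cancel)
  have sS: "mat2_scalar R z \<in> S"
    using S_elem_S[of z \<zero> D] z by (simp add: S_elem_def mat2_scalar_def)
  define V where "V = v \<otimes> W"
  have V: "V \<in> carrier R" "V \<in> I 1" using vW I_closed I_mono[OF l_pos] by (auto simp: V_def)
  have "(u \<oplus> V \<otimes> a) \<otimes> (u \<oplus> V \<otimes> d) \<ominus> V \<otimes> b \<otimes> (V \<otimes> c)
      = u \<otimes> u \<oplus> V \<otimes> (u \<otimes> a \<oplus> u \<otimes> d \<oplus> V \<otimes> (a \<otimes> d) \<ominus> V \<otimes> (b \<otimes> c))" if "u \<in> carrier R" for u
    using that V(1) mc by algebra
  from this[of \<one>] have "mat2_det R k \<in> Units R"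
    using Units_mult_add[OF Units_one_closed Units_one_closed I_mult(1)[OF V(2)]] V mc
    by (simp add: k_def affine_def m' V_def[symmetric])
  then have "k \<in> K"
    using kM mc vW I_mult I_closed[OF vW]
    by (auto simp: cong_subgroup_iff carrier_GL2 k_def affine_def m' mat2_scalar_def mcong_Mat2 a_minus_def a_comm[of \<one>] a_assoc r_neg)
  with sS zk show "affine z W m \<in> H"
    by (auto simp: set_mult_def GL2_mult) metis
  have "v \<otimes> W \<otimes> c \<ominus> D \<otimes> (v \<otimes> W \<otimes> b) = v \<otimes> W \<otimes> (c \<ominus> D \<otimes> b)"
    using v Wc mc D_carrier by algebra
  then have "\<kappa> k = \<psi> (v \<otimes> W \<otimes> (e21 m \<ominus> D \<otimes> e12 m))"
    using kM by (simp add: psi_beta_eq) (simp add: k_def affine_def m')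
  then show "\<Theta> (affine z W m) = \<theta> (mat2_scalar R z) * \<psi> (inv z \<otimes> W \<otimes> (e21 m \<ominus> D \<otimes> e12 m))"
    using Theta_apply[OF sS \<open>k \<in> K\<close>] zk by (simp add: v_def)
qed

text \<open>Membership would put \<open>m\<^sub>2\<^sub>2 - m\<^sub>1\<^sub>1\<close> and \<open>m\<^sub>2\<^sub>1 + D m\<^sub>1\<^sub>2\<close> into the maximal ideal after cancelling \<open>w\<^sup>i\<close>, and with
  them the discriminant.\<close>

lemma affine_notin_H:
  assumes i: "i < l" and z: "z \<in> carrier R" and m: "m \<in> M2" and disc: "disc m \<in> Units R"
  shows "affine z (w [^] i) m \<notin> H"
proof
  assume h: "affine z (w [^] i) m \<in> H"
  obtain a b c d where m': "m = Mat2 a b c d"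
    and mc: "a \<in> carrier R" "b \<in> carrier R" "c \<in> carrier R" "d \<in> carrier R" using m by (rule M2_E)
  note h' = H_cong[OF h[unfolded affine_def m' mat2.sel]]
  have "W \<otimes> c \<oplus> D \<otimes> (W \<otimes> b) = W \<otimes> (c \<oplus> D \<otimes> b)" if "W \<in> carrier R" for W
    using that mc D_carrier by algebra
  then have "w [^] i \<otimes> (c \<oplus> D \<otimes> b) \<in> I (i + (l - i))" using h'(3) i by simp
  then have "c \<oplus> D \<otimes> b \<in> I (l - i)" using I_cancel[of "c \<oplus> D \<otimes> b" i "l - i"] i mc l_le_r by simp
  then have "c \<oplus> D \<otimes> b \<in> I 1" using I_mono[of 1 "l - i"] i by simp
  then have "(c \<oplus> D \<otimes> b) \<ominus> D \<otimes> b \<in> I 1" using D mc by (intro I_diff I_mult)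
  moreover have "(c \<oplus> D \<otimes> b) \<ominus> D \<otimes> b = c" using mc D_carrier by algebra
  ultimately have c: "c \<in> I 1" by simp
  have "(z \<oplus> W \<otimes> d) \<ominus> (z \<oplus> W \<otimes> a) = W \<otimes> (d \<ominus> a)" if "W \<in> carrier R" for W
    using that mc z by algebra
  then have "w [^] i \<otimes> (d \<ominus> a) \<in> I (i + (l - i))" using h'(4) i by simp
  then have "d \<ominus> a \<in> I (l - i)" using I_cancel[of "d \<ominus> a" i "l - i"] i mc l_le_r by simp
  then have "d \<ominus> a \<in> I 1" using I_mono[of 1 "l - i"] i by simp
  then have "a \<ominus> d \<in> I 1" using mc by (simp add: diff_I_sym)
  then have "disc m \<in> I 1" using c mc by (simp add: disc_def m' I_add I_mult)
  then show False using disc Units_iff by blast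
qed

end

section \<open>Counting invertible matrices\<close>

context chain_ring begin

lemma finite_M2: "finite M2"
proof -
  have "M2 \<subseteq> (\<lambda>(a, b, c, d). Mat2 a b c d) ` (carrier R \<times> carrier R \<times> carrier R \<times> carrier R)"
    by (force elim!: M2_E)
  then show ?thesis by (rule finite_subset) (use finite_R in auto)
qed

lemma finite_GL2: "finite (carrier (GL2 R))"
  using finite_M2 by (rule finite_subset[rotated]) (auto simp: carrier_GL2)

lemma Units_diff_I1: "x \<in> carrier R \<Longrightarrow> y \<in> I 1 \<Longrightarrow> x \<ominus> y \<in> Units R \<longleftrightarrow> x \<in> Units R"
proof
  assume x: "x \<in> carrier R" and y: "y \<in> I 1" and "x \<ominus> y \<in> Units R"
  then have "(x \<ominus> y) \<oplus> y \<in> Units R" by (intro Units_add_I1)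
  moreover have "(x \<ominus> y) \<oplus> y = x" using x I_closed[OF y] by algebra
  ultimately show "x \<in> Units R" by simp
next
  assume "x \<in> Units R" "y \<in> I 1"
  then show "x \<ominus> y \<in> Units R" unfolding a_minus_def by (intro Units_add_I1 I_minus)
qed

lemma Units_mult_iff:
  "x \<in> carrier R \<Longrightarrow> y \<in> carrier R \<Longrightarrow> x \<otimes> y \<in> Units R \<longleftrightarrow> x \<in> Units R \<and> y \<in> Units R"
  using Units_prime Units_iff by blast

text \<open>For \<open>i \<ge> 1\<close> the scalar part of a non-split matrix is invertible, so \<open>\<theta>\<close> may be evaluated on it.\<close>

lemma nonsplit_unit:
  assumes i: "1 \<le> (i::nat)" and c: "\<alpha> \<in> carrier R" "\<epsilon> \<in> carrier R" "\<beta> \<in> carrier R"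
    and det: "\<alpha> [^] (2::nat) \<ominus> \<epsilon> \<otimes> \<beta> [^] (2::nat) \<otimes> w [^] (2 * i) \<in> Units R"
  shows "\<alpha> \<in> Units R"
proof -
  have "w [^] (2 * i) \<in> I 1" using I_mult_w[of \<one> "2 * i"] I_mono[of 1 "2 * i"] i by simp
  then have "\<alpha> [^] (2::nat) \<in> Units R"
    using det Units_diff_I1[of "\<alpha> [^] (2::nat)" "\<epsilon> \<otimes> \<beta> [^] (2::nat) \<otimes> w [^] (2 * i)"] c I_mult by simp
  then show ?thesis using c Units_mult_iff by (simp add: numeral_2_eq_2)
qed

text \<open>The invertible matrices whose lower row is \<open>(0, *)\<close>, respectively \<open>(*, 0)\<close>, modulo \<open>w\<close>. In both cases
  invertibility decouples into two unit conditions, so they are easy to count.\<close>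

definition GL2_c :: "'a mat2 set" where "GL2_c = {x \<in> carrier (GL2 R). e21 x \<in> I 1}"
definition GL2_d :: "'a mat2 set" where "GL2_d = {x \<in> carrier (GL2 R). e22 x \<in> I 1}"

lemma GL2_c_iff: "Mat2 a b c d \<in> GL2_c \<longleftrightarrow> a \<in> Units R \<and> b \<in> carrier R \<and> c \<in> I 1 \<and> d \<in> Units R"
proof -
  have "a \<otimes> d \<ominus> b \<otimes> c \<in> Units R \<longleftrightarrow> a \<in> Units R \<and> d \<in> Units R"
    if "a \<in> carrier R" "b \<in> carrier R" "c \<in> I 1" "d \<in> carrier R"
    using that Units_diff_I1[of "a \<otimes> d" "b \<otimes> c"] by (simp add: I_mult Units_mult_iff)
  then show ?thesis using I_closed Units_closed by (auto simp: GL2_c_def carrier_GL2)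
qed

lemma GL2_d_iff: "Mat2 a b c d \<in> GL2_d \<longleftrightarrow> a \<in> carrier R \<and> b \<in> Units R \<and> c \<in> Units R \<and> d \<in> I 1"
proof -
  have "a \<otimes> d \<ominus> b \<otimes> c \<in> Units R \<longleftrightarrow> b \<in> Units R \<and> c \<in> Units R"
    if "a \<in> carrier R" "b \<in> carrier R" "c \<in> carrier R" "d \<in> I 1"
  proof -
    have "a \<otimes> d \<ominus> b \<otimes> c = \<ominus> (b \<otimes> c \<ominus> a \<otimes> d)"
      using that(1-3) I_closed[OF that(4)] by algebra
    moreover have "\<ominus> x \<in> Units R \<longleftrightarrow> x \<in> Units R" if "x \<in> carrier R" for x
      using that I_minus[of x 1] I_minus[of "\<ominus> x" 1] by (auto simp: Units_iff)
    ultimately show ?thesis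
      using that I_closed[OF that(4)] Units_diff_I1[of "b \<otimes> c" "a \<otimes> d"] by (simp add: I_mult Units_mult_iff)
  qed
  then show ?thesis using I_closed Units_closed by (auto simp: GL2_d_def carrier_GL2)
qed

lemma card_GL2_c: "card GL2_c = card (Units R) ^ 2 * (q ^ r * q ^ (r - 1))"
proof -
  have "bij_betw (\<lambda>(a, b, c, d). Mat2 a b c d) (Units R \<times> carrier R \<times> I 1 \<times> Units R) GL2_c"
    unfolding bij_betw_def
  proof (intro conjI equalityI subsetI)
    fix x assume x: "x \<in> GL2_c"
    obtain a b c d where x': "x = Mat2 a b c d" by (cases x)
    show "x \<in> (\<lambda>(a, b, c, d). Mat2 a b c d) ` (Units R \<times> carrier R \<times> I 1 \<times> Units R)"
      using x unfolding x' GL2_c_iff by (intro image_eqI[of _ _ "(a, b, c, d)"]) auto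
  next
    show "inj_on (\<lambda>(a, b, c, d). Mat2 a b c d) (Units R \<times> carrier R \<times> I 1 \<times> Units R)"
      by (rule inj_onI) auto
  next
    fix x assume "x \<in> (\<lambda>(a, b, c, d). Mat2 a b c d) ` (Units R \<times> carrier R \<times> I 1 \<times> Units R)"
    then show "x \<in> GL2_c" by (auto simp: GL2_c_iff)
  qed
  from bij_betw_same_card[OF this] show ?thesis
    using card_I[of 1] r_pos by (simp add: card_cartesian_product card_R power2_eq_square ac_simps)
qed

lemma card_GL2_d: "card GL2_d = card (Units R) ^ 2 * (q ^ r * q ^ (r - 1))"
proof -
  have "bij_betw (\<lambda>(a, b, c, d). Mat2 a b c d) (carrier R \<times> Units R \<times> Units R \<times> I 1) GL2_d"
    unfolding bij_betw_def
  proof (intro conjI equalityI subsetI)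
    fix x assume x: "x \<in> GL2_d"
    obtain a b c d where x': "x = Mat2 a b c d" by (cases x)
    show "x \<in> (\<lambda>(a, b, c, d). Mat2 a b c d) ` (carrier R \<times> Units R \<times> Units R \<times> I 1)"
      using x unfolding x' GL2_d_iff by (intro image_eqI[of _ _ "(a, b, c, d)"]) auto
  next
    show "inj_on (\<lambda>(a, b, c, d). Mat2 a b c d) (carrier R \<times> Units R \<times> Units R \<times> I 1)"
      by (rule inj_onI) auto
  next
    fix x assume "x \<in> (\<lambda>(a, b, c, d). Mat2 a b c d) ` (carrier R \<times> Units R \<times> Units R \<times> I 1)"
    then show "x \<in> GL2_d" by (auto simp: GL2_d_iff)
  qed
  from bij_betw_same_card[OF this] show ?thesis
    using card_I[of 1] r_pos by (simp add: card_cartesian_product card_R power2_eq_square ac_simps)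
qed

lemma GL2_c_d_disjoint: "GL2_c \<inter> GL2_d = {}"
proof -
  have "Mat2 a b c d \<notin> GL2_c \<inter> GL2_d" for a b c d
    using Units_iff by (auto simp: GL2_c_iff GL2_d_iff)
  then show ?thesis by (metis all_not_in_conv mat2.exhaust)
qed

text \<open>Outside \<open>GL2_d\<close> the lower right entry is a unit, and the upper left entry is determined by the determinant
  and the other three entries.\<close>

lemma card_GL2: "card (carrier (GL2 R)) = card (Units R) ^ 2 * (q ^ r * q ^ r + q ^ r * q ^ (r - 1))"
proof -
  define f where "f = (\<lambda>(e, b, c, d). Mat2 ((e \<oplus> b \<otimes> c) \<otimes> inv d) b c d)"
  define P where "P = Units R \<times> carrier R \<times> carrier R \<times> Units R"
  have cancel: "x \<otimes> inv d \<otimes> d = x" "x \<otimes> d \<otimes> inv d = x" if "x \<in> carrier R" "d \<in> Units R" for x d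
    using that Units_closed by (simp_all add: m_assoc)
  have inj: "inj_on f P"
  proof (rule inj_onI)
    fix u v assume u: "u \<in> P" "v \<in> P" and eq: "f u = f v"
    obtain e b c d e' b' c' d' where uv: "u = (e, b, c, d)" "v = (e', b', c', d')" by (metis prod_cases4)
    have "(e \<oplus> b \<otimes> c) \<otimes> inv d \<otimes> d = (e' \<oplus> b \<otimes> c) \<otimes> inv d \<otimes> d" "b = b'" "c = c'" "d = d'"
      using eq by (auto simp: f_def uv)
    then show "u = v" using u Units_closed by (simp add: uv P_def cancel)
  qed
  have im: "f ` P = carrier (GL2 R) - GL2_d"
  proof (intro equalityI subsetI)
    fix x assume "x \<in> f ` P"
    then obtain e b c d where x: "x = f (e, b, c, d)" "e \<in> Units R" "b \<in> carrier R" "c \<in> carrier R" "d \<in> Units R"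
      by (auto simp: P_def)
    have ec: "e \<in> carrier R" "d \<in> carrier R" using x Units_closed by auto
    have "mat2_det R x = (e \<oplus> b \<otimes> c) \<ominus> b \<otimes> c" using x ec by (simp add: f_def cancel)
    also have "\<dots> = e" using x(3,4) ec by algebra
    finally show "x \<in> carrier (GL2 R) - GL2_d"
      using x ec by (auto simp: carrier_GL2 GL2_d_def f_def Units_iff)
  next
    fix x assume x: "x \<in> carrier (GL2 R) - GL2_d"
    then obtain a b c d where x': "x = Mat2 a b c d" "a \<in> carrier R" "b \<in> carrier R" "c \<in> carrier R" "d \<in> carrier R"
      by (auto simp: carrier_GL2 elim: M2_E)
    have d: "d \<in> Units R" and e: "a \<otimes> d \<ominus> b \<otimes> c \<in> Units R"
      using x x' by (auto simp: carrier_GL2 GL2_d_def Units_iff)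
    have "(a \<otimes> d \<ominus> b \<otimes> c) \<oplus> b \<otimes> c = a \<otimes> d" using x' by algebra
    then have "x = f (a \<otimes> d \<ominus> b \<otimes> c, b, c, d)" using x' d by (simp add: f_def cancel)
    moreover have "(a \<otimes> d \<ominus> b \<otimes> c, b, c, d) \<in> P" using x' d e by (simp add: P_def)
    ultimately show "x \<in> f ` P" by blast
  qed
  have sub: "GL2_d \<subseteq> carrier (GL2 R)" by (auto simp: GL2_d_def)
  have "card (carrier (GL2 R)) = card (carrier (GL2 R) - GL2_d) + card GL2_d"
    using sub finite_GL2 by (metis card_Diff_subset card_mono finite_subset le_add_diff_inverse2)
  also have "card (carrier (GL2 R) - GL2_d) = card P"
    using card_image[OF inj] im by simp
  finally show ?thesis
    by (simp add: card_GL2_d P_def card_cartesian_product card_R power2_eq_square algebra_simps)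
qed

text \<open>With \<open>(c, d)\<close> the lower row of \<open>x\<close>, the entry in question is \<open>u c d / det x\<close>. The proof reads off the needed
  information on the inverse of \<open>x\<close> from the equations for a two-sided inverse.\<close>

lemma e21_mconj_E11:
  assumes x: "x \<in> carrier (GL2 R)" and u: "u \<in> Units R"
  shows "e21 (mconj x (Mat2 u \<zero> \<zero> \<zero>)) \<in> I 1 \<longleftrightarrow> x \<in> GL2_c \<union> GL2_d"
proof -
  obtain a b c d where x': "x = Mat2 a b c d" and ac: "a \<in> carrier R" "b \<in> carrier R" "c \<in> carrier R" "d \<in> carrier R"
    using GL2_M2[OF x] by (rule M2_E)
  obtain p k s t where i': "minv x = Mat2 p k s t" and pc: "p \<in> carrier R" "k \<in> carrier R" "s \<in> carrier R" "t \<in> carrier R"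
    using minv_M2[OF x] by (rule M2_E)
  have uc: "u \<in> carrier R" "u \<notin> I 1" using u Units_iff by blast+
  have i: "c \<otimes> p \<oplus> d \<otimes> s = \<zero>" "c \<otimes> k \<oplus> d \<otimes> t = \<one>"
    using minv_right[OF x] unfolding i' unfolding x' by (simp_all add: mat2_scalar_def)
  have j: "p \<otimes> a \<oplus> k \<otimes> c = \<one>" "p \<otimes> b \<oplus> k \<otimes> d = \<zero>"
    using minv_left[OF x] unfolding i' unfolding x' by (simp_all add: mat2_scalar_def)
  have "p \<in> I 1 \<longleftrightarrow> d \<in> I 1"
  proof
    assume p: "p \<in> I 1"
    have "k \<notin> I 1" using I_add[of "p \<otimes> a" 1 "k \<otimes> c"] I_mult[OF p] I_mult[of k 1] ac pc j(1) one_notin_I1 by auto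
    moreover have "k \<otimes> d = \<ominus> (p \<otimes> b)" using j(2) ac pc by (metis add.inv_equality add.m_comm m_closed)
    then have "k \<otimes> d \<in> I 1" using I_minus[OF I_mult(1)[OF p ac(2)]] by simp
    ultimately show "d \<in> I 1" using Units_prime pc ac by blast
  next
    assume d: "d \<in> I 1"
    have "c \<notin> I 1" using I_add[of "c \<otimes> k" 1 "d \<otimes> t"] I_mult[OF d] I_mult[of c 1] ac pc i(2) one_notin_I1 by auto
    moreover have "c \<otimes> p = \<ominus> (d \<otimes> s)" using i(1) ac pc by (metis add.inv_equality m_closed)
    then have "c \<otimes> p \<in> I 1" using I_minus[OF I_mult(1)[OF d pc(3)]] by simp
    ultimately show "p \<in> I 1" using Units_prime pc ac by blast
  qed
  moreover have "e21 (mconj x (Mat2 u \<zero> \<zero> \<zero>)) = c \<otimes> u \<otimes> p"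
    unfolding mconj_def i' unfolding x' using ac pc uc by simp
  ultimately show ?thesis
    using ac pc uc x by (simp add: Units_prime GL2_c_def GL2_d_def x' del: One_nat_def)
qed

text \<open>The conjugate has trace \<open>0\<close> and determinant \<open>- e b\<^sup>2\<close>. If its lower left entry vanished modulo \<open>w\<close>, then
  \<open>e b\<^sup>2\<close> would be a square modulo \<open>w\<close>, hence \<open>e\<close> a square.\<close>

lemma e21_mconj_nonsquare:
  assumes x: "x \<in> carrier (GL2 R)" and e: "e \<in> Units R" and b: "b \<in> Units R"
    and nonsq: "\<not> (\<exists>y\<in>carrier R. e = y \<otimes> y)"
  shows "e21 (mconj x (Mat2 \<zero> (e \<otimes> b) b \<zero>)) \<notin> I 1"
proof
  assume h: "e21 (mconj x (Mat2 \<zero> (e \<otimes> b) b \<zero>)) \<in> I 1"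
  define Y where "Y = Mat2 \<zero> (e \<otimes> b) b \<zero>"
  have ec: "e \<in> carrier R" "b \<in> carrier R" using e b Units_closed by blast+
  have Y: "Y \<in> M2" using ec by (simp add: Y_def)
  obtain m n s t where M: "mconj x Y = Mat2 m n s t"
    and c: "m \<in> carrier R" "n \<in> carrier R" "s \<in> carrier R" "t \<in> carrier R"
    using mconj_closed[OF x Y] by (rule M2_E)
  have s: "s \<in> I 1" using h M by (simp add: Y_def)
  have "m \<oplus> t = \<zero>" "m \<otimes> t \<ominus> n \<otimes> s = \<zero> \<ominus> e \<otimes> b \<otimes> b"
    using mconj_trace[OF x Y] mconj_det[OF x Y] ec c by (simp_all add: M) (simp_all add: Y_def)
  then have t: "t = \<ominus> m" and det: "m \<otimes> t \<ominus> n \<otimes> s = \<ominus> (e \<otimes> b \<otimes> b)"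
    using c ec by (auto simp: a_minus_def minus_equality[symmetric] a_comm intro: minus_equality[symmetric])
  define v where "v = inv b"
  have v: "v \<in> carrier R" "b \<otimes> v = \<one>" using b by (simp_all add: v_def)
  have "e \<otimes> (b \<otimes> v) \<otimes> (b \<otimes> v) \<ominus> (m \<otimes> v) \<otimes> (m \<otimes> v) = \<ominus> (\<ominus> (e \<otimes> b \<otimes> b)) \<otimes> (v \<otimes> v) \<ominus> (m \<otimes> v) \<otimes> (m \<otimes> v)"
    using ec c v(1) by algebra
  also have "\<dots> = s \<otimes> (n \<otimes> (v \<otimes> v))"
    unfolding det[symmetric] t using ec c v(1) by algebra
  finally have "e \<ominus> (m \<otimes> v) \<otimes> (m \<otimes> v) = s \<otimes> (n \<otimes> (v \<otimes> v))"
    using ec v by simp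
  then have "e \<ominus> (m \<otimes> v) \<otimes> (m \<otimes> v) \<in> I 1" using I_mult(1)[OF s] c v by simp
  then show False using square_of_square_mod[OF e, of "m \<otimes> v"] nonsq c v by simp
qed

end

section \<open>Sums over conjugates\<close>

context split_data begin

lemma sum_left_mult:
  assumes u: "u \<in> carrier (GL2 R)"
  shows "(\<Sum>x\<in>carrier (GL2 R). f (u \<star> x)) = (\<Sum>x\<in>carrier (GL2 R). f x)"
proof -
  interpret G: group "GL2 R" by (rule group_GL2)
  show ?thesis
    by (rule sum.reindex_bij_witness[where i = "\<lambda>x. minv u \<star> x" and j = "\<lambda>x. u \<star> x"])
      (use u in \<open>auto simp: GL2_mult[symmetric] minv_def G.m_assoc[symmetric]\<close>)
qed

text \<open>Averaging: the translations by \<open>u s\<close> permute \<open>A\<close>, and the factors by which they change \<open>F\<close> sum to zero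
  over \<open>s\<close>.\<close>

lemma sum_zero_by_shift:
  fixes F :: "'a mat2 \<Rightarrow> complex"
  assumes A: "A \<subseteq> carrier (GL2 R)"
    and u: "\<And>s. s \<in> carrier R \<Longrightarrow> u s \<in> carrier (GL2 R)"
    and stable: "\<And>s x. s \<in> carrier R \<Longrightarrow> x \<in> A \<Longrightarrow> u s \<star> x \<in> A"
    and shift: "\<And>s x. s \<in> carrier R \<Longrightarrow> x \<in> A \<Longrightarrow> F (u s \<star> x) = F x * \<psi> (w [^] (r - 1) \<otimes> k x \<otimes> s)"
    and k: "\<And>x. x \<in> A \<Longrightarrow> k x \<in> Units R"
  shows "(\<Sum>x\<in>A. F x) = 0"
proof -
  interpret G: group "GL2 R" by (rule group_GL2)
  have finA: "finite A" using A finite_GL2 by (rule finite_subset)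
  have inv: "(\<Sum>x\<in>A. F (u s \<star> x)) = (\<Sum>x\<in>A. F x)" if s: "s \<in> carrier R" for s
  proof -
    have inj: "inj_on (\<lambda>x. u s \<star> x) A"
    proof (rule inj_onI)
      fix x y assume xy: "x \<in> A" "y \<in> A" and "u s \<star> x = u s \<star> y"
      then have "u s \<otimes>\<^bsub>GL2 R\<^esub> x = u s \<otimes>\<^bsub>GL2 R\<^esub> y" by (simp add: GL2_mult)
      then show "x = y" using G.l_cancel u[OF s] xy A by blast
    qed
    have "(\<lambda>x. u s \<star> x) ` A = A"
      using stable[OF s] inj by (intro endo_inj_surj finA) auto
    then show ?thesis using sum.reindex[OF inj, of F] by simp
  qed
  have "of_nat (card (carrier R)) * (\<Sum>x\<in>A. F x) = (\<Sum>s\<in>carrier R. \<Sum>x\<in>A. F (u s \<star> x))"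
    by (simp add: inv)
  also have "\<dots> = (\<Sum>x\<in>A. \<Sum>s\<in>carrier R. F x * \<psi> (w [^] (r - 1) \<otimes> k x \<otimes> s))"
    by (subst sum.swap) (simp add: shift)
  also have "\<dots> = 0"
    by (rule sum.neutral) (simp add: sum_distrib_left[symmetric] psi_sum_zero[OF k] del: One_nat_def)
  finally show ?thesis
    using card_R q_ge_2 by simp
qed

text \<open>The inverse is placed in the matrix so that the lower left entry is multiplied by \<open>v\<close> itself.\<close>

lemma diag_conj:
  assumes v: "v \<in> Units R"
  defines "u \<equiv> Mat2 (inv v) \<zero> \<zero> \<one>"
  shows "u \<in> carrier (GL2 R)"
    and "a \<in> carrier R \<Longrightarrow> b \<in> carrier R \<Longrightarrow> c \<in> carrier R \<Longrightarrow> d \<in> carrier R \<Longrightarrow>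
      u \<star> Mat2 a b c d \<star> minv u = Mat2 a (inv v \<otimes> b) (c \<otimes> v) d"
proof -
  have vc: "v \<in> carrier R" using v Units_closed by blast
  show u: "u \<in> carrier (GL2 R)" using v by (simp add: u_def carrier_GL2 a_minus_def)
  have m: "minv u = Mat2 v \<zero> \<zero> \<one>"
    using u v vc by (intro minv_unique) (simp_all add: u_def mat2_scalar_def)
  have "inv v \<otimes> a \<otimes> v = a" if "a \<in> carrier R"
  proof -
    have "inv v \<otimes> a \<otimes> v = a \<otimes> (inv v \<otimes> v)" using that v vc Units_inv_closed[OF v] by (simp add: m_ac)
    then show ?thesis using that v by simp
  qed
  then show "u \<star> Mat2 a b c d \<star> minv u = Mat2 a (inv v \<otimes> b) (c \<otimes> v) d"
    if "a \<in> carrier R" "b \<in> carrier R" "c \<in> carrier R" "d \<in> carrier R"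
    using that v vc by (simp add: m) (simp add: u_def)
qed

lemma unip_conj:
  assumes s: "s \<in> carrier R"
  defines "u \<equiv> Mat2 \<one> \<zero> s \<one>"
  shows "u \<in> carrier (GL2 R)"
    and "a \<in> carrier R \<Longrightarrow> b \<in> carrier R \<Longrightarrow> c \<in> carrier R \<Longrightarrow> d \<in> carrier R \<Longrightarrow>
      e12 (u \<star> Mat2 a b c d \<star> minv u) = b \<and>
      e21 (u \<star> Mat2 a b c d \<star> minv u) = c \<oplus> s \<otimes> (a \<ominus> d) \<ominus> s \<otimes> s \<otimes> b"
proof -
  show u: "u \<in> carrier (GL2 R)" using s by (simp add: u_def carrier_GL2 a_minus_def)
  have m: "minv u = Mat2 \<one> \<zero> (\<ominus> s) \<one>"
    using u s by (intro minv_unique) (simp_all add: u_def mat2_scalar_def r_neg)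
  assume c: "a \<in> carrier R" "b \<in> carrier R" "c \<in> carrier R" "d \<in> carrier R"
  have "s \<otimes> a \<oplus> c \<oplus> (s \<otimes> b \<oplus> d) \<otimes> \<ominus> s = c \<oplus> s \<otimes> (a \<ominus> d) \<ominus> s \<otimes> s \<otimes> b"
    using c s by algebra
  then show "e12 (u \<star> Mat2 a b c d \<star> minv u) = b \<and>
      e21 (u \<star> Mat2 a b c d \<star> minv u) = c \<oplus> s \<otimes> (a \<ominus> d) \<ominus> s \<otimes> s \<otimes> b"
    using c s by (simp add: m) (simp add: u_def)
qed

text \<open>Since the discriminant is a unit, \<open>m\<^sub>2\<^sub>1\<close> or \<open>m\<^sub>1\<^sub>1 - m\<^sub>2\<^sub>2\<close> is a unit for every conjugate \<open>m\<close>. On the set \<open>A\<close>,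
  where \<open>m\<^sub>2\<^sub>1\<close> is one, diagonal matrices shift the argument of \<open>\<psi>\<close> by a unit multiple of \<open>w\<^bsup>r - 1\<^esup> s\<close>; on
  the complement \<open>B\<close> lower unipotent matrices do. The contribution of \<open>D m\<^sub>1\<^sub>2\<close> is unaffected, as
  \<open>w\<^bsup>r - 1\<^esup> D = 0\<close>.\<close>

lemma sum_middle:
  assumes i: "i < r - 1" and t: "t \<in> Units R" and Y: "Y \<in> M2" and disc: "disc Y \<in> Units R"
  shows "(\<Sum>x\<in>carrier (GL2 R). \<psi> (t \<otimes> w [^] i \<otimes> (e21 (mconj x Y) \<ominus> D \<otimes> e12 (mconj x Y)))) = 0"
proof -
  define n where "n = r - 1 - i"
  define W where "W = w [^] i"
  define N where "N = w [^] n"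
  define F where "F x = \<psi> (t \<otimes> W \<otimes> (e21 (mconj x Y) \<ominus> D \<otimes> e12 (mconj x Y)))" for x
  define A where "A = {x \<in> carrier (GL2 R). e21 (mconj x Y) \<in> Units R}"
  define B where "B = {x \<in> carrier (GL2 R). e21 (mconj x Y) \<in> I 1}"
  have tc: "t \<in> carrier R" using t Units_closed by blast
  have WN: "W \<in> carrier R" "N \<in> carrier R" by (simp_all add: W_def N_def)
  have N1: "N \<in> I 1" using I_mult_w[of \<one> n] I_mono[of 1 n] i by (simp add: N_def n_def)
  have WN_eq: "W \<otimes> N = w [^] (r - 1)" using i by (simp add: W_def N_def n_def nat_pow_mult)
  have WNI: "W \<otimes> N \<in> I (r - 1)" using I_mult_w[of \<one> "r - 1"] by (simp add: WN_eq)
  have kill: "W \<otimes> N \<otimes> y = \<zero>" if "y \<in> I 1" for y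
    using I_times[OF WNI that] I_big[of r] r_pos by simp
  have ex: "\<exists>a b c d. mconj x Y = Mat2 a b c d \<and> a \<in> carrier R \<and> b \<in> carrier R \<and> c \<in> carrier R \<and> d \<in> carrier R"
    if "x \<in> carrier (GL2 R)" for x
    using mconj_closed[OF that Y] by (auto elim!: M2_E)
  have "(\<Sum>x\<in>A. F x) = 0"
  proof (rule sum_zero_by_shift[where u = "\<lambda>s. Mat2 (inv (\<one> \<oplus> N \<otimes> s)) \<zero> \<zero> \<one>" and k = "\<lambda>x. t \<otimes> e21 (mconj x Y)"])
    show "A \<subseteq> carrier (GL2 R)" by (auto simp: A_def)
    show "t \<otimes> e21 (mconj x Y) \<in> Units R" if "x \<in> A" for x using that t by (simp add: A_def)
    fix s assume s: "s \<in> carrier R"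
    define v where "v = \<one> \<oplus> N \<otimes> s"
    have v: "v \<in> Units R" unfolding v_def using s N1 by (intro Units_add_I1 I_mult) auto
    have vc: "v \<in> carrier R" using v Units_closed by blast
    show "Mat2 (inv (\<one> \<oplus> N \<otimes> s)) \<zero> \<zero> \<one> \<in> carrier (GL2 R)"
      using diag_conj(1)[OF v] by (simp add: v_def)
    fix x assume xA: "x \<in> A"
    then have x: "x \<in> carrier (GL2 R)" by (simp add: A_def)
    from ex[OF x] obtain a b c d where M: "mconj x Y = Mat2 a b c d"
      and ac: "a \<in> carrier R" "b \<in> carrier R" "c \<in> carrier R" "d \<in> carrier R" by blast
    define u where "u = Mat2 (inv v) \<zero> \<zero> \<one>"
    have uG: "u \<in> carrier (GL2 R)" using diag_conj(1)[OF v] by (simp add: u_def)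
    have M': "mconj (u \<star> x) Y = Mat2 a (inv v \<otimes> b) (c \<otimes> v) d"
      using mconj_mult[OF uG x Y] diag_conj(2)[OF v ac] by (simp add: M u_def)
    have cu: "c \<in> Units R" using xA by (simp add: A_def M)
    have "u \<otimes>\<^bsub>GL2 R\<^esub> x \<in> carrier (GL2 R)"
      using uG x by (simp add: group.is_monoid[OF group_GL2] monoid.m_closed)
    then have uA: "u \<star> x \<in> A" using cu v by (simp add: A_def M' GL2_mult)
    then show "Mat2 (inv (\<one> \<oplus> N \<otimes> s)) \<zero> \<zero> \<one> \<star> x \<in> A" by (simp add: u_def v_def)
    define j where "j = inv v"
    have j: "j \<in> carrier R" "j \<otimes> v = \<one>" using v by (simp_all add: j_def)
    have "j \<oplus> N \<otimes> s \<otimes> j = \<one>" using j WN s by (simp add: v_def r_distr m_comm)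
    then have je: "j = \<one> \<ominus> N \<otimes> s \<otimes> j"
      using j(1) WN s by (metis a_minus_def add.inv_solve_right m_closed one_closed)
    \<comment> \<open>The inverse \<open>j\<close> of \<open>v = 1 + N s\<close> is \<open>1 - N s j\<close>; the variable \<open>g\<close> stands for \<open>1\<close> to keep the identity homogeneous.\<close>
    have "t \<otimes> W \<otimes> (c \<otimes> (g \<oplus> N \<otimes> s) \<ominus> D \<otimes> ((g \<ominus> N \<otimes> s \<otimes> j) \<otimes> b))
      = t \<otimes> W \<otimes> (c \<otimes> g \<ominus> D \<otimes> (g \<otimes> b)) \<oplus> (W \<otimes> N \<otimes> (t \<otimes> c) \<otimes> s \<oplus> (W \<otimes> N \<otimes> D) \<otimes> (t \<otimes> s \<otimes> j \<otimes> b))"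
      if "g \<in> carrier R" for g
      using that tc WN ac j(1) s D_carrier by algebra
    from this[of \<one>] have "t \<otimes> W \<otimes> (c \<otimes> v \<ominus> D \<otimes> (j \<otimes> b)) = t \<otimes> W \<otimes> (c \<ominus> D \<otimes> b) \<oplus> W \<otimes> N \<otimes> (t \<otimes> c) \<otimes> s"
      using je[symmetric] kill[OF D] ac tc WN j(1) s by (simp add: v_def)
    moreover have "mconj (Mat2 (inv (\<one> \<oplus> N \<otimes> s)) \<zero> \<zero> \<one> \<star> x) Y = Mat2 a (j \<otimes> b) (c \<otimes> v) d"
      using M' by (simp only: u_def v_def j_def)
    ultimately show "F (Mat2 (inv (\<one> \<oplus> N \<otimes> s)) \<zero> \<zero> \<one> \<star> x) = F x * \<psi> (w [^] (r - 1) \<otimes> (t \<otimes> e21 (mconj x Y)) \<otimes> s)"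
      using ac tc WN s by (simp add: F_def M WN_eq[symmetric] psi_add del: One_nat_def)
  qed
  moreover have "(\<Sum>x\<in>B. F x) = 0"
  proof (rule sum_zero_by_shift[where u = "\<lambda>s. Mat2 \<one> \<zero> (N \<otimes> s) \<one>" and k = "\<lambda>x. t \<otimes> (e11 (mconj x Y) \<ominus> e22 (mconj x Y))"])
    show "B \<subseteq> carrier (GL2 R)" by (auto simp: B_def)
    show "t \<otimes> (e11 (mconj x Y) \<ominus> e22 (mconj x Y)) \<in> Units R" if xB: "x \<in> B" for x
    proof -
      have x: "x \<in> carrier (GL2 R)" using xB by (simp add: B_def)
      from ex[OF x] obtain a b c d where M: "mconj x Y = Mat2 a b c d"
        and ac: "a \<in> carrier R" "b \<in> carrier R" "c \<in> carrier R" "d \<in> carrier R" by blast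
      have c: "c \<in> I 1" using xB by (simp add: B_def M)
      have du: "disc (Mat2 a b c d) \<in> Units R" using mconj_disc[OF x Y] disc by (simp add: M)
      have "a \<ominus> d \<in> Units R"
      proof (rule ccontr)
        assume "a \<ominus> d \<notin> Units R"
        then have "a \<ominus> d \<in> I 1" using ac Units_iff by simp
        then have "disc (Mat2 a b c d) \<in> I 1" using c ac by (simp add: disc_def I_add I_mult)
        then show False using du Units_iff by blast
      qed
      then show ?thesis using t by (simp add: M)
    qed
    fix s assume s: "s \<in> carrier R"
    have sc: "N \<otimes> s \<in> carrier R" using s WN by simp
    show uG: "Mat2 \<one> \<zero> (N \<otimes> s) \<one> \<in> carrier (GL2 R)"
      using unip_conj(1)[OF sc] .
    fix x assume xB: "x \<in> B"
    then have x: "x \<in> carrier (GL2 R)" by (simp add: B_def)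
    from ex[OF x] obtain a b c d where M: "mconj x Y = Mat2 a b c d"
      and ac: "a \<in> carrier R" "b \<in> carrier R" "c \<in> carrier R" "d \<in> carrier R" by blast
    define u where "u = Mat2 \<one> \<zero> (N \<otimes> s) \<one>"
    have M': "e12 (mconj (u \<star> x) Y) = b" "e21 (mconj (u \<star> x) Y) = c \<oplus> N \<otimes> s \<otimes> (a \<ominus> d) \<ominus> N \<otimes> s \<otimes> (N \<otimes> s) \<otimes> b"
      using mconj_mult[OF uG x Y] unip_conj(2)[OF sc ac] by (simp_all add: M u_def)
    have c1: "c \<in> I 1" using xB by (simp add: B_def M)
    have "u \<otimes>\<^bsub>GL2 R\<^esub> x \<in> carrier (GL2 R)"
      using uG x by (simp add: group.is_monoid[OF group_GL2] monoid.m_closed u_def)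
    moreover have "c \<oplus> N \<otimes> s \<otimes> (a \<ominus> d) \<ominus> N \<otimes> s \<otimes> (N \<otimes> s) \<otimes> b \<in> I 1"
      using c1 N1 s WN ac by (intro I_add I_diff I_mult) auto
    ultimately have "u \<star> x \<in> B" by (simp add: B_def M' GL2_mult)
    then show "Mat2 \<one> \<zero> (N \<otimes> s) \<one> \<star> x \<in> B" by (simp add: u_def)
    \<comment> \<open>The quadratic term carries the factor \<open>W N N\<close>, which vanishes because \<open>N\<close> lies in the maximal ideal.\<close>
    have "t \<otimes> W \<otimes> (c \<oplus> N \<otimes> s \<otimes> (a \<ominus> d) \<ominus> N \<otimes> s \<otimes> (N \<otimes> s) \<otimes> b \<ominus> D \<otimes> b)
      = t \<otimes> W \<otimes> (c \<ominus> D \<otimes> b) \<oplus> (W \<otimes> N \<otimes> (t \<otimes> (a \<ominus> d)) \<otimes> s \<ominus> (W \<otimes> N \<otimes> N) \<otimes> (t \<otimes> s \<otimes> s \<otimes> b))"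
      using tc WN ac s D_carrier by algebra
    then have "t \<otimes> W \<otimes> (c \<oplus> N \<otimes> s \<otimes> (a \<ominus> d) \<ominus> N \<otimes> s \<otimes> (N \<otimes> s) \<otimes> b \<ominus> D \<otimes> b)
      = t \<otimes> W \<otimes> (c \<ominus> D \<otimes> b) \<oplus> W \<otimes> N \<otimes> (t \<otimes> (a \<ominus> d)) \<otimes> s"
      using kill[OF N1] ac tc WN s by (simp add: a_minus_def)
    then show "F (Mat2 \<one> \<zero> (N \<otimes> s) \<one> \<star> x) = F x * \<psi> (w [^] (r - 1) \<otimes> (t \<otimes> (e11 (mconj x Y) \<ominus> e22 (mconj x Y))) \<otimes> s)"
      using ac tc WN s M' by (simp add: F_def M u_def[symmetric] WN_eq[symmetric] psi_add del: One_nat_def)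
  qed
  moreover have "carrier (GL2 R) = A \<union> B" "A \<inter> B = {}"
    using ex Units_iff by (fastforce simp: A_def B_def)+
  moreover have "finite A" "finite B" using finite_GL2 by (auto simp: A_def B_def)
  ultimately have "(\<Sum>x\<in>carrier (GL2 R). F x) = 0"
    by (simp add: sum.union_disjoint)
  then show ?thesis by (simp add: F_def W_def)
qed

text \<open>At the last level \<open>D m\<^sub>1\<^sub>2\<close> disappears, and averaging over \<open>diag (v\<inverse>, 1)\<close> with \<open>v\<close> any unit evaluates the sum
  in terms of the number of \<open>x\<close> whose conjugate is upper triangular modulo \<open>w\<close>.\<close>

lemma sum_top:
  assumes t: "t \<in> Units R" and Y: "Y \<in> M2"
  defines "P \<equiv> {x \<in> carrier (GL2 R). e21 (mconj x Y) \<in> I 1}"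
  shows "(of_nat q - 1) * (\<Sum>x\<in>carrier (GL2 R). \<psi> (t \<otimes> w [^] (r - 1) \<otimes> (e21 (mconj x Y) \<ominus> D \<otimes> e12 (mconj x Y))))
    = of_nat q * of_nat (card P) - of_nat (card (carrier (GL2 R)))"
proof -
  define W where "W = w [^] (r - 1)"
  define f where "f x = \<psi> (W \<otimes> (t \<otimes> e21 (mconj x Y)))" for x
  have tc: "t \<in> carrier R" using t Units_closed by blast
  have W: "W \<in> carrier R" "W \<in> I (r - 1)" using I_mult_w[of \<one> "r - 1"] by (simp_all add: W_def)
  have kill: "W \<otimes> y = \<zero>" if "y \<in> I 1" for y
    using I_times[OF W(2) that] I_big[of r] r_pos by simp
  have ex: "\<exists>a b c d. mconj x Y = Mat2 a b c d \<and> a \<in> carrier R \<and> b \<in> carrier R \<and> c \<in> carrier R \<and> d \<in> carrier R"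
    if "x \<in> carrier (GL2 R)" for x
    using mconj_closed[OF that Y] by (auto elim!: M2_E)
  have f: "\<psi> (t \<otimes> W \<otimes> (e21 (mconj x Y) \<ominus> D \<otimes> e12 (mconj x Y))) = f x" if x: "x \<in> carrier (GL2 R)" for x
  proof -
    from ex[OF x] obtain a b c d where M: "mconj x Y = Mat2 a b c d"
      and ac: "a \<in> carrier R" "b \<in> carrier R" "c \<in> carrier R" "d \<in> carrier R" by blast
    have "t \<otimes> W \<otimes> (c \<ominus> D \<otimes> b) = W \<otimes> (t \<otimes> c) \<ominus> (W \<otimes> D) \<otimes> (t \<otimes> b)"
      using ac tc W(1) D_carrier by algebra
    then show ?thesis using kill[OF D] ac tc W(1) by (simp add: f_def M a_minus_def)
  qed
  have U: "of_nat (card (Units R)) = (of_nat q - 1) * (of_nat q :: complex) ^ (r - 1)"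
    using q_ge_2 by (simp add: card_Units of_nat_diff)
  have "of_nat (card (Units R)) * (\<Sum>x\<in>carrier (GL2 R). f x)
      = (\<Sum>v\<in>Units R. \<Sum>x\<in>carrier (GL2 R). f (Mat2 (inv v) \<zero> \<zero> \<one> \<star> x))"
    by (simp add: sum_left_mult[OF diag_conj(1)])
  also have "\<dots> = (\<Sum>x\<in>carrier (GL2 R). \<Sum>v\<in>Units R. \<psi> (W \<otimes> (t \<otimes> e21 (mconj x Y)) \<otimes> v))"
  proof (subst sum.swap, intro sum.cong refl)
    fix x v assume x: "x \<in> carrier (GL2 R)" and v: "v \<in> Units R"
    from ex[OF x] obtain a b c d where M: "mconj x Y = Mat2 a b c d"
      and ac: "a \<in> carrier R" "b \<in> carrier R" "c \<in> carrier R" "d \<in> carrier R" by blast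
    have "mconj (Mat2 (inv v) \<zero> \<zero> \<one> \<star> x) Y = Mat2 a (inv v \<otimes> b) (c \<otimes> v) d"
      using mconj_mult[OF diag_conj(1)[OF v] x Y] diag_conj(2)[OF v ac] by (simp add: M)
    then show "f (Mat2 (inv v) \<zero> \<zero> \<one> \<star> x) = \<psi> (W \<otimes> (t \<otimes> e21 (mconj x Y)) \<otimes> v)"
      using ac tc W(1) v Units_closed by (simp add: f_def M m_assoc)
  qed
  also have "\<dots> = (\<Sum>x\<in>carrier (GL2 R). if x \<in> P then of_nat (card (Units R)) else - of_nat (q ^ (r - 1)))"
  proof (intro sum.cong refl)
    fix x assume x: "x \<in> carrier (GL2 R)"
    from ex[OF x] have c: "e21 (mconj x Y) \<in> carrier R" by auto
    have "t \<otimes> e21 (mconj x Y) \<in> I 1 \<longleftrightarrow> x \<in> P"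
      using Units_prime[OF tc c] t x Units_iff by (auto simp: P_def)
    then show "(\<Sum>v\<in>Units R. \<psi> (W \<otimes> (t \<otimes> e21 (mconj x Y)) \<otimes> v)) = (if x \<in> P then of_nat (card (Units R)) else - of_nat (q ^ (r - 1)))"
      using psi_sum_Units[of "t \<otimes> e21 (mconj x Y)"] tc c by (simp add: W_def)
  qed
  also have "\<dots> = of_nat (card P) * of_nat (card (Units R)) - of_nat (card (carrier (GL2 R) - P)) * of_nat (q ^ (r - 1))"
  proof -
    have "P \<subseteq> carrier (GL2 R)" by (auto simp: P_def)
    then have "carrier (GL2 R) \<inter> {x. x \<in> P} = P" "carrier (GL2 R) \<inter> - {x. x \<in> P} = carrier (GL2 R) - P" by auto
    then show ?thesis using finite_GL2 by (simp add: sum.If_cases)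
  qed
  also have "of_nat (card (carrier (GL2 R) - P)) = (of_nat (card (carrier (GL2 R))) - of_nat (card P) :: complex)"
  proof -
    have "P \<subseteq> carrier (GL2 R)" by (auto simp: P_def)
    then show ?thesis using finite_GL2 by (simp add: card_Diff_subset finite_subset of_nat_diff card_mono)
  qed
  finally have "of_nat q ^ (r - 1) * ((of_nat q - 1) * (\<Sum>x\<in>carrier (GL2 R). f x))
      = of_nat q ^ (r - 1) * (of_nat q * of_nat (card P) - of_nat (card (carrier (GL2 R))))"
    by (simp add: U algebra_simps)
  then have "(of_nat q - 1) * (\<Sum>x\<in>carrier (GL2 R). f x) = of_nat q * of_nat (card P) - of_nat (card (carrier (GL2 R)))"
    using q_ge_2 by simp
  moreover have "(\<Sum>x\<in>carrier (GL2 R). \<psi> (t \<otimes> w [^] (r - 1) \<otimes> (e21 (mconj x Y) \<ominus> D \<otimes> e12 (mconj x Y))))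
      = (\<Sum>x\<in>carrier (GL2 R). f x)"
    by (intro sum.cong refl) (simp only: f W_def[symmetric])
  ultimately show ?thesis by (simp only:)
qed

end

section \<open>The character values\<close>

text \<open>The closing arithmetic for the three families, with \<open>n = r - 2\<close>: the factor in front of \<open>t\<close> is the order of
  \<open>H\<close>, and the right-hand sides combine the orders given by \<open>of_nat_cards\<close>.\<close>

lemma cancel_card_H:
  fixes Q X t c :: complex
  assumes Q: "Q \<noteq> 0" "Q - 1 \<noteq> 0"
  shows "(Q - 1) * Q ^ 5 * (Q ^ n) ^ 3 * t = c * ((Q - 1) ^ 2 * (Q + 1) * Q ^ 5 * (Q ^ n) ^ 4) \<Longrightarrow>
      t = (Q ^ 2 - 1) * Q ^ n * c"
    and "(Q - 1) * ((Q - 1) * Q ^ 5 * (Q ^ n) ^ 3 * t) =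
      c * (Q * (2 * (Q - 1) ^ 2 * Q ^ 5 * (Q ^ n) ^ 4) - (Q - 1) ^ 2 * (Q + 1) * Q ^ 5 * (Q ^ n) ^ 4) \<Longrightarrow>
      t = c * (Q - 1) * Q ^ n"
    and "(Q - 1) * ((Q - 1) * Q ^ 5 * (Q ^ n) ^ 3 * t) = - (c * ((Q - 1) ^ 2 * (Q + 1) * Q ^ 5 * (Q ^ n) ^ 4)) \<Longrightarrow>
      t = - (c * Q ^ n * (Q + 1))"
proof -
  define P where "P = Q - 1"
  have Qp: "Q = P + 1" by (simp add: P_def)
  define Z where "Z = Q ^ n"
  define h where "h = P * Q ^ 5 * Z ^ 3"
  have h: "h \<noteq> 0" and P: "P \<noteq> 0" using Q by (simp_all add: h_def P_def Z_def)
  have Z4: "Z ^ 4 = Z ^ 3 * Z" by (simp add: eval_nat_numeral)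
  show "t = (Q ^ 2 - 1) * Q ^ n * c" if "(Q - 1) * Q ^ 5 * (Q ^ n) ^ 3 * t = c * ((Q - 1) ^ 2 * (Q + 1) * Q ^ 5 * (Q ^ n) ^ 4)"
  proof -
    have "Q ^ 2 - 1 = P * (Q + 1)" by (simp add: P_def power2_eq_square algebra_simps)
    then have "h * t = h * ((Q ^ 2 - 1) * Z * c)"
      using that unfolding P_def[symmetric] Z_def[symmetric] Z4 h_def power2_eq_square by (simp add: ac_simps)
    then show ?thesis using h by (simp add: Z_def)
  qed
  show "t = c * (Q - 1) * Q ^ n" if "(Q - 1) * ((Q - 1) * Q ^ 5 * (Q ^ n) ^ 3 * t) =
      c * (Q * (2 * (Q - 1) ^ 2 * Q ^ 5 * (Q ^ n) ^ 4) - (Q - 1) ^ 2 * (Q + 1) * Q ^ 5 * (Q ^ n) ^ 4)"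
  proof -
    have "Q * (2 * P ^ 2 * Q ^ 5 * Z ^ 4) - P ^ 2 * (Q + 1) * Q ^ 5 * Z ^ 4 = (2 * Q - (Q + 1)) * (P ^ 2 * Q ^ 5 * Z ^ 4)"
      by (simp add: algebra_simps)
    also have "2 * Q - (Q + 1) = P" by (simp add: P_def)
    finally have "P * (h * t) = P * (h * (c * P * Z))"
      using that unfolding P_def[symmetric] Z_def[symmetric] Z4 h_def power2_eq_square by (simp add: ac_simps)
    then show ?thesis using h P by (simp add: Z_def P_def)
  qed
  show "t = - (c * Q ^ n * (Q + 1))"
    if "(Q - 1) * ((Q - 1) * Q ^ 5 * (Q ^ n) ^ 3 * t) = - (c * ((Q - 1) ^ 2 * (Q + 1) * Q ^ 5 * (Q ^ n) ^ 4))"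
  proof -
    have "P * (h * t) = P * (h * (- (c * Z * (Q + 1))))"
      using that unfolding P_def[symmetric] Z_def[symmetric] Z4 h_def power2_eq_square by (simp add: ac_simps)
    then have "h * t = h * (- (c * Z * (Q + 1)))" using P mult_left_cancel by blast
    then have "t = - (c * Z * (Q + 1))" using h mult_left_cancel by blast
    then show ?thesis by (simp only: Z_def)
  qed
qed

context split_data begin

context
  fixes chi :: "'a \<Rightarrow> complex"
  assumes chi: "chi \<in> hom (units_of R) complex_units"
begin

abbreviation "tr_Xi \<equiv> rep_character (Xi_twisted_rep R w l \<psi> chi D \<theta>)"

lemma chi_mult: "x \<in> Units R \<Longrightarrow> y \<in> Units R \<Longrightarrow> chi (x \<otimes> y) = chi x * chi y"
  using chi by (auto simp: hom_def units_of_def complex_units_def)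

lemma tr_affine:
  assumes g: "affine z W Y \<in> carrier (GL2 R)" and Y: "Y \<in> M2" and z: "z \<in> carrier R" and W: "W \<in> carrier R"
  shows "of_nat (card H) * tr_Xi (affine z W Y) = chi (mat2_det R (affine z W Y)) *
    (\<Sum>x\<in>carrier (GL2 R). if affine z W (mconj x Y) \<in> H then \<Theta> (affine z W (mconj x Y)) else 0)"
proof -
  have conj: "x \<otimes>\<^bsub>GL2 R\<^esub> affine z W Y \<otimes>\<^bsub>GL2 R\<^esub> inv\<^bsub>GL2 R\<^esub> x = affine z W (mconj x Y)"
    if "x \<in> carrier (GL2 R)" for x
    using mconj_affine[OF that Y z W] by (simp add: mconj_def minv_def GL2_mult)
  have "of_nat (card H) * tr_Xi (affine z W Y) = chi (mat2_det R (affine z W Y)) *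
    (\<Sum>x\<in>carrier (GL2 R). if x \<otimes>\<^bsub>GL2 R\<^esub> affine z W Y \<otimes>\<^bsub>GL2 R\<^esub> inv\<^bsub>GL2 R\<^esub> x \<in> H
        then \<Theta> (x \<otimes>\<^bsub>GL2 R\<^esub> affine z W Y \<otimes>\<^bsub>GL2 R\<^esub> inv\<^bsub>GL2 R\<^esub> x) else 0)"
    unfolding Xi_twisted_rep_def Xi_rep_def
    by (rule group.rep_character_twist_induced[OF group_GL2 finite_GL2 H_subgroup Theta_mult Theta_nz g])
  also have "(\<Sum>x\<in>carrier (GL2 R). if x \<otimes>\<^bsub>GL2 R\<^esub> affine z W Y \<otimes>\<^bsub>GL2 R\<^esub> inv\<^bsub>GL2 R\<^esub> x \<in> H
        then \<Theta> (x \<otimes>\<^bsub>GL2 R\<^esub> affine z W Y \<otimes>\<^bsub>GL2 R\<^esub> inv\<^bsub>GL2 R\<^esub> x) else 0)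
      = (\<Sum>x\<in>carrier (GL2 R). if affine z W (mconj x Y) \<in> H then \<Theta> (affine z W (mconj x Y)) else 0)"
    by (intro sum.cong refl) (simp only: conj)
  finally show ?thesis .
qed

lemma card_H_pos: "card H > 0"
proof -
  have "finite H" using subgroup.subset[OF H_subgroup] finite_GL2 by (rule finite_subset)
  then show ?thesis using subgroup.one_closed[OF H_subgroup] by (auto simp: card_gt_0_iff)
qed

lemma tr_low:
  assumes i: "i < l" and g: "affine z (w [^] i) Y \<in> carrier (GL2 R)" and Y: "Y \<in> M2"
    and z: "z \<in> carrier R" and disc: "disc Y \<in> Units R"
  shows "tr_Xi (affine z (w [^] i) Y) = 0"
proof -
  have "of_nat (card H) * tr_Xi (affine z (w [^] i) Y) = 0"
    using tr_affine[OF g Y z] affine_notin_H[OF i z] Y disc by (simp add: mconj_closed mconj_disc)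
  then show ?thesis using card_H_pos by simp
qed

lemma affine_GL2:
  assumes z: "z \<in> Units R" and W: "W \<in> I l" and Y: "Y \<in> M2"
  shows "affine z W Y \<in> carrier (GL2 R)"
  using Theta_affine(1)[OF z W Y] subgroup.subset[OF H_subgroup] by blast

lemma tr_high:
  assumes W: "W \<in> I l" and z: "z \<in> Units R" and Y: "Y \<in> M2"
  shows "of_nat (card H) * tr_Xi (affine z W Y) = chi (mat2_det R (affine z W Y)) * \<theta> (mat2_scalar R z) *
    (\<Sum>x\<in>carrier (GL2 R). \<psi> (inv z \<otimes> W \<otimes> (e21 (mconj x Y) \<ominus> D \<otimes> e12 (mconj x Y))))"
proof -
  have "(\<Sum>x\<in>carrier (GL2 R). if affine z W (mconj x Y) \<in> H then \<Theta> (affine z W (mconj x Y)) else 0)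
    = (\<Sum>x\<in>carrier (GL2 R). \<theta> (mat2_scalar R z) * \<psi> (inv z \<otimes> W \<otimes> (e21 (mconj x Y) \<ominus> D \<otimes> e12 (mconj x Y))))"
    using Y by (intro sum.cong refl) (simp add: Theta_affine[OF z W] mconj_closed)
  then show ?thesis
    using tr_affine[OF affine_GL2[OF z W Y] Y] z Units_closed I_closed[OF W] by (simp add: sum_distrib_left mult.assoc)
qed

lemma I_pow: "l \<le> i \<Longrightarrow> w [^] i \<in> I l"
  using I_mult_w[of \<one> i] I_mono[of l i] by simp

lemma tr_middle:
  assumes i: "l \<le> i" "i < r - 1" and z: "z \<in> Units R" and Y: "Y \<in> M2" and disc: "disc Y \<in> Units R"
  shows "tr_Xi (affine z (w [^] i) Y) = 0"
proof -
  have "of_nat (card H) * tr_Xi (affine z (w [^] i) Y) = 0"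
    using tr_high[OF I_pow[OF i(1)] z Y] sum_middle[OF i(2) _ Y disc, of "inv z"] z by simp
  then show ?thesis using card_H_pos by simp
qed

lemma r_ge_2: "r \<ge> 2" and l_le: "l \<le> r - 1"
  using r_eq l_pos by auto

lemma q_nonzero: "of_nat q \<noteq> (0::complex)" "of_nat q - 1 \<noteq> (0::complex)"
  using q_ge_2 by (auto simp: of_nat_eq_1_iff[symmetric])

lemma of_nat_cards:
  defines "Q \<equiv> of_nat q :: complex"
  shows "of_nat (card H) = (Q - 1) * Q ^ 5 * (Q ^ (r - 2)) ^ 3"
    and "of_nat (card (carrier (GL2 R))) = (Q - 1) ^ 2 * (Q + 1) * Q ^ 5 * (Q ^ (r - 2)) ^ 4"
    and "of_nat (card GL2_c + card GL2_d) = 2 * (Q - 1) ^ 2 * Q ^ 5 * (Q ^ (r - 2)) ^ 4"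
proof -
  obtain n where n: "r = n + 2" using r_ge_2 by (metis add.commute le_Suc_ex)
  have U: "of_nat (card (Units R)) = (Q - 1) * Q ^ (n + 1)"
    using q_ge_2 by (simp add: card_Units of_nat_diff n Q_def)
  define Z where "Z = Q ^ n"
  have e: "2 * r = n + n + 4" "r = n + 2" "r - 1 = n + 1" "r - 2 = n" using n by simp_all
  have p: "Q ^ (2 * r) = Z * Z * Q ^ 4" "Q ^ r = Z * Q ^ 2" "Q ^ (r - 1) = Z * Q" "Q ^ (n + 1) = Z * Q" "Q ^ (r - 2) = Z"
    unfolding e(1,3,4) unfolding e(2) Z_def by (simp_all only: power_add power_one_right)
  have s: "Q ^ 2 = Q * Q" "Q ^ 4 = Q * Q * Q * Q" "Q ^ 5 = Q * Q * Q * Q * Q" "Z ^ 3 = Z * Z * Z" "Z ^ 4 = Z * Z * Z * Z"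
    by (simp_all add: eval_nat_numeral)
  show "of_nat (card H) = (Q - 1) * Q ^ 5 * (Q ^ (r - 2)) ^ 3"
    unfolding card_H of_nat_mult of_nat_power U Q_def[symmetric] p s by (simp only: ac_simps)
  show "of_nat (card (carrier (GL2 R))) = (Q - 1) ^ 2 * (Q + 1) * Q ^ 5 * (Q ^ (r - 2)) ^ 4"
    unfolding card_GL2 of_nat_mult of_nat_add of_nat_power U Q_def[symmetric] p s power_mult_distrib
    by (simp add: algebra_simps power2_eq_square)
  show "of_nat (card GL2_c + card GL2_d) = 2 * (Q - 1) ^ 2 * Q ^ 5 * (Q ^ (r - 2)) ^ 4"
    unfolding card_GL2_c card_GL2_d of_nat_mult of_nat_add of_nat_power U Q_def[symmetric] p s power_mult_distrib
    by (simp add: algebra_simps power2_eq_square)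
qed

lemma tr_top:
  assumes z: "z \<in> Units R" and Y: "Y \<in> M2"
  shows "(of_nat q - 1) * (of_nat (card H) * tr_Xi (affine z (w [^] (r - 1)) Y))
    = chi (mat2_det R (affine z (w [^] (r - 1)) Y)) * \<theta> (mat2_scalar R z) *
      (of_nat q * of_nat (card {x \<in> carrier (GL2 R). e21 (mconj x Y) \<in> I 1}) - of_nat (card (carrier (GL2 R))))"
proof -
  have iz: "inv z \<in> Units R" using z by simp
  show ?thesis
    unfolding tr_high[OF I_pow[OF l_le] z Y] sum_top[OF iz Y, symmetric] by (simp only: mult.left_commute)
qed

text \<open>Scalar matrices are the case \<open>W = 0\<close>, where all summands are equal and only the index of \<open>H\<close> remains.\<close>

theorem tr_scalar:
  assumes z: "z \<in> Units R"
  shows "tr_Xi (mat2_scalar R z)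
    = (of_nat q ^ 2 - 1) * of_nat q ^ (r - 2) * chi (z [^] (2::nat)) * \<theta> (mat2_scalar R z)"
proof -
  have zc: "z \<in> carrier R" using z Units_closed by blast
  have s: "affine z \<zero> (mat2_scalar R \<one>) = mat2_scalar R z"
    using zc by (simp add: affine_def mat2_scalar_def)
  have one: "mat2_scalar R \<one> \<in> M2" by simp
  have "(\<Sum>x\<in>carrier (GL2 R). \<psi> (inv z \<otimes> \<zero> \<otimes> (e21 (mconj x (mat2_scalar R \<one>)) \<ominus> D \<otimes> e12 (mconj x (mat2_scalar R \<one>)))))
      = (\<Sum>x\<in>carrier (GL2 R). 1)"
  proof (intro sum.cong refl)
    fix x assume "x \<in> carrier (GL2 R)"
    from mconj_closed[OF this one]
    show "\<psi> (inv z \<otimes> \<zero> \<otimes> (e21 (mconj x (mat2_scalar R \<one>)) \<ominus> D \<otimes> e12 (mconj x (mat2_scalar R \<one>)))) = 1"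
      using z by (simp add: M2_iff)
  qed
  then have "of_nat (card H) * tr_Xi (mat2_scalar R z) = chi (mat2_det R (mat2_scalar R z)) * \<theta> (mat2_scalar R z) * of_nat (card (carrier (GL2 R)))"
    using tr_high[OF I_zero z one] by (simp add: s)
  also have "mat2_det R (mat2_scalar R z) = z [^] (2::nat)"
    using zc by (simp add: mat2_scalar_def a_minus_def numeral_2_eq_2)
  finally show ?thesis
    using cancel_card_H(1)[OF q_nonzero, of "r - 2" "tr_Xi (mat2_scalar R z)" "chi (z [^] (2::nat)) * \<theta> (mat2_scalar R z)"]
    unfolding of_nat_cards by (simp only: mult.assoc)
qed

theorem tr_diag:
  assumes i: "i \<le> r - 1" and \<alpha>: "\<alpha> \<in> Units R" and \<delta>: "\<delta> \<in> Units R"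
    and u: "u \<in> Units R" and diff: "\<alpha> \<ominus> \<delta> = w [^] i \<otimes> u"
  shows "tr_Xi (Mat2 \<alpha> \<zero> \<zero> \<delta>)
    = (if i = r - 1 then 1 else 0) * chi \<alpha> * chi \<delta> * \<theta> (mat2_scalar R \<delta>) * (of_nat q - 1) * of_nat q ^ (r - 2)"
proof -
  define Y where "Y = Mat2 u \<zero> \<zero> \<zero>"
  have c: "\<alpha> \<in> carrier R" "\<delta> \<in> carrier R" "u \<in> carrier R" using assms Units_closed by auto
  have Y: "Y \<in> M2" using c by (simp add: Y_def)
  have "\<alpha> = \<delta> \<oplus> (\<alpha> \<ominus> \<delta>)" using c by algebra
  then have g: "Mat2 \<alpha> \<zero> \<zero> \<delta> = affine \<delta> (w [^] i) Y"
    using c by (simp add: diff affine_def Y_def)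
  have det: "mat2_det R (affine \<delta> (w [^] i) Y) = \<alpha> \<otimes> \<delta>"
    using c by (simp add: g[symmetric] a_minus_def)
  have gG: "affine \<delta> (w [^] i) Y \<in> carrier (GL2 R)"
    using c \<alpha> \<delta> det by (simp add: carrier_GL2) (simp add: g[symmetric])
  have disc: "disc Y \<in> Units R"
    using u c by (simp add: disc_def Y_def a_minus_def)
  consider "i < l" | "l \<le> i" "i < r - 1" | "i = r - 1" using i by linarith
  then show ?thesis
  proof cases
    case 1
    then show ?thesis using tr_low[OF 1 gG Y c(2) disc] l_le by (simp add: g)
  next
    case 2
    then show ?thesis using tr_middle[OF 2 \<delta> Y disc] by (simp add: g)
  next
    case 3
    have "{x \<in> carrier (GL2 R). e21 (mconj x Y) \<in> I 1} = GL2_c \<union> GL2_d"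
      using e21_mconj_E11[OF _ u] by (auto simp: Y_def GL2_c_def GL2_d_def)
    moreover have "finite GL2_c" "finite GL2_d" using finite_GL2 by (auto simp: GL2_c_def GL2_d_def)
    ultimately have "card {x \<in> carrier (GL2 R). e21 (mconj x Y) \<in> I 1} = card GL2_c + card GL2_d"
      using GL2_c_d_disjoint by (simp add: card_Un_disjoint)
    then have "(of_nat q - 1) * (of_nat (card H) * tr_Xi (Mat2 \<alpha> \<zero> \<zero> \<delta>))
      = chi \<alpha> * chi \<delta> * \<theta> (mat2_scalar R \<delta>) * (of_nat q * of_nat (card GL2_c + card GL2_d) - of_nat (card (carrier (GL2 R))))"
      using tr_top[OF \<delta> Y] det \<alpha> \<delta> by (simp only: g 3 chi_mult)
    then show ?thesis
      using cancel_card_H(2)[OF q_nonzero] 3 unfolding of_nat_cards by simp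
  qed
qed

theorem tr_nonsplit:
  assumes i: "i \<le> r - 1" and \<alpha>: "\<alpha> \<in> carrier R" and \<beta>: "\<beta> \<in> Units R" and \<epsilon>: "\<epsilon> \<in> Units R"
    and nonsq: "\<not> (\<exists>x\<in>carrier R. \<epsilon> = x \<otimes> x)"
    and det: "\<alpha> [^] (2::nat) \<ominus> \<epsilon> \<otimes> \<beta> [^] (2::nat) \<otimes> w [^] (2 * i) \<in> Units R"
  shows "tr_Xi (Mat2 \<alpha> (w [^] i \<otimes> \<epsilon> \<otimes> \<beta>) (w [^] i \<otimes> \<beta>) \<alpha>)
    = (if i < r - 1 then 0
       else - (chi (\<alpha> [^] (2::nat)) * \<theta> (mat2_scalar R \<alpha>) * of_nat q ^ (r - 2) * (of_nat q + 1)))"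
proof -
  define Y where "Y = Mat2 \<zero> (\<epsilon> \<otimes> \<beta>) \<beta> \<zero>"
  have c: "\<alpha> \<in> carrier R" "\<beta> \<in> carrier R" "\<epsilon> \<in> carrier R" using assms Units_closed by auto
  have Y: "Y \<in> M2" using c by (simp add: Y_def)
  have g: "Mat2 \<alpha> (w [^] i \<otimes> \<epsilon> \<otimes> \<beta>) (w [^] i \<otimes> \<beta>) \<alpha> = affine \<alpha> (w [^] i) Y"
    using c by (simp add: affine_def Y_def m_assoc)
  have "w [^] (2 * i) = w [^] i \<otimes> w [^] i" by (simp add: nat_pow_mult mult_2)
  moreover have "\<alpha> \<otimes> \<alpha> \<ominus> W \<otimes> \<epsilon> \<otimes> \<beta> \<otimes> (W \<otimes> \<beta>) = \<alpha> \<otimes> \<alpha> \<ominus> \<epsilon> \<otimes> (\<beta> \<otimes> \<beta>) \<otimes> (W \<otimes> W)" if "W \<in> carrier R" for W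
    using that c by algebra
  ultimately have det_eq: "mat2_det R (affine \<alpha> (w [^] i) Y) = \<alpha> [^] (2::nat) \<ominus> \<epsilon> \<otimes> \<beta> [^] (2::nat) \<otimes> w [^] (2 * i)"
    using c by (simp add: g[symmetric] numeral_2_eq_2)
  have gG: "affine \<alpha> (w [^] i) Y \<in> carrier (GL2 R)"
    using c det det_eq by (simp add: carrier_GL2) (simp add: g[symmetric])
  have disc: "disc Y \<in> Units R"
  proof -
    define p where "p = \<epsilon> \<otimes> \<beta> \<otimes> \<beta>"
    have p: "p \<in> Units R" "p \<in> carrier R" using \<epsilon> \<beta> c by (simp_all add: p_def)
    have "p \<oplus> p \<oplus> (p \<oplus> p) = (\<one> \<oplus> \<one>) \<otimes> ((\<one> \<oplus> \<one>) \<otimes> p)"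
      using p by (simp add: l_distr r_distr)
    then have "disc Y = (\<one> \<oplus> \<one>) \<otimes> ((\<one> \<oplus> \<one>) \<otimes> p)"
      using p by (simp add: disc_def Y_def p_def[symmetric] a_minus_def)
    then show ?thesis using two_unit p by simp
  qed
  show ?thesis
  proof (cases "i < l")
    case True
    then show ?thesis using tr_low[OF True gG Y \<alpha> disc] l_le by (simp add: g)
  next
    case False
    then have \<alpha>U: "\<alpha> \<in> Units R" using nonsplit_unit[OF _ c(1,3,2) det] l_pos by simp
    show ?thesis
    proof (cases "i < r - 1")
      case True
      then show ?thesis using tr_middle[OF _ True \<alpha>U Y disc] False by (simp add: g)
    next
      case iF: False
      then have i': "i = r - 1" using i by simp
      have "2 * i \<ge> r" using i' r_ge_2 by simp
      then have "w [^] (2 * i) = \<zero>" using I_mult_w[of \<one> "2 * i"] I_big[of "2 * i"] by simp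
      then have det': "mat2_det R (affine \<alpha> (w [^] i) Y) = \<alpha> [^] (2::nat)" using det_eq c by (simp add: a_minus_def)
      have empty: "{x \<in> carrier (GL2 R). e21 (mconj x Y) \<in> I 1} = {}"
        using e21_mconj_nonsquare[OF _ \<epsilon> \<beta> nonsq] by (auto simp: Y_def)
      have "(of_nat q - 1) * (of_nat (card H) * tr_Xi (affine \<alpha> (w [^] i) Y))
        = - (chi (\<alpha> [^] (2::nat)) * \<theta> (mat2_scalar R \<alpha>) * of_nat (card (carrier (GL2 R))))"
        using tr_top[OF \<alpha>U Y, unfolded empty] det' by (simp add: i' del: One_nat_def)
      then show ?thesis
        using cancel_card_H(3)[OF q_nonzero] iF unfolding of_nat_cards g by simp
    qed
  qed
qed

end

end

section \<open>Quotients of the valuation ring\<close>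

context nonarch_local_field begin

abbreviation "\<O> \<equiv> val_ring absv"
abbreviation "M \<equiv> max_ideal absv"

lemma absv_one [simp]: "absv 1 = 1"
  using absv_mult[of 1 1] absv_eq_0_iff[of 1] by simp

lemma absv_zero [simp]: "absv 0 = 0"
  using absv_eq_0_iff by simp

lemma absv_minus [simp]: "absv (- x) = absv x"
proof -
  have "absv (- 1) * absv (- 1) = 1" using absv_mult[of "- 1" "- 1"] by simp
  then have "absv (- 1) = 1"
    using absv_nonneg[of "- 1"] by (metis abs_of_nonneg power2_eq_1_iff power2_eq_square abs_1 abs_minus_cancel)
  then show ?thesis using absv_mult[of "- 1" x] by simp
qed

lemma absv_diff: "absv (x - y) \<le> max (absv x) (absv y)"
  using absv_ultrametric[of x "- y"] by simp

lemma val_ring_simps [simp]: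
  "carrier \<O> = {x. absv x \<le> 1}" "x \<otimes>\<^bsub>\<O>\<^esub> y = x * y" "\<one>\<^bsub>\<O>\<^esub> = 1" "\<zero>\<^bsub>\<O>\<^esub> = 0" "x \<oplus>\<^bsub>\<O>\<^esub> y = x + y"
  by (simp_all add: val_ring_def)

lemma cring_val_ring: "cring \<O>"
proof (intro cringI abelian_groupI comm_monoidI)
  fix x assume "x \<in> carrier \<O>"
  then show "\<exists>y\<in>carrier \<O>. y \<oplus>\<^bsub>\<O>\<^esub> x = \<zero>\<^bsub>\<O>\<^esub>" by (intro bexI[of _ "- x"]) auto
next
  fix x y assume "x \<in> carrier \<O>" "y \<in> carrier \<O>"
  then show "x \<oplus>\<^bsub>\<O>\<^esub> y \<in> carrier \<O>" "x \<otimes>\<^bsub>\<O>\<^esub> y \<in> carrier \<O>"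
    using absv_ultrametric[of x y] absv_nonneg by (auto simp: absv_mult mult_le_one)
qed (auto simp: algebra_simps)

lemma val_ring_minus:
  assumes "absv x \<le> 1" "absv y \<le> 1" shows "x \<ominus>\<^bsub>\<O>\<^esub> y = x - y"
proof -
  interpret V: cring \<O> by (rule cring_val_ring)
  have "\<ominus>\<^bsub>\<O>\<^esub> y = - y" using assms by (intro V.minus_equality) auto
  then show ?thesis by (simp add: a_minus_def)
qed

lemma PIdl_O: "PIdl\<^bsub>\<O>\<^esub> a = {y * a | y. absv y \<le> 1}"
  by (auto simp: cgenideal_def)

text \<open>If \<open>2\<close> were in the maximal ideal, the additive order of \<open>1\<close> in the residue field would be a divisor of
  \<open>2\<close> other than \<open>1\<close>.\<close>

lemma two_notin_M:
  assumes "ring_char (residue_field absv) \<noteq> 2" and M: "ideal M \<O>"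
  shows "1 + 1 \<notin> M"
proof
  assume two: "1 + 1 \<in> M"
  interpret V: cring \<O> by (rule cring_val_ring)
  interpret k: ring "residue_field absv" unfolding residue_field_def using M by (rule ideal.quotient_is_ring)
  interpret h: ring_hom_ring \<O> "residue_field absv" "(+>\<^bsub>\<O>\<^esub>) M"
    unfolding residue_field_def using M by (rule ideal.rcos_ring_hom_ring)
  have A: "group (add_monoid (residue_field absv))" by (rule k.add.is_group)
  have le: "absv (1 + 1) \<le> 1" using absv_ultrametric[of 1 1] by simp
  have eq: "M +>\<^bsub>\<O>\<^esub> x = \<zero>\<^bsub>residue_field absv\<^esub> \<longleftrightarrow> x \<in> M" if "absv x \<le> 1" for x
    using V.quotient_eq_iff_same_a_r_cos[OF M, of x 0] that h.hom_zero by (simp add: val_ring_minus)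
  have "M +>\<^bsub>\<O>\<^esub> (1 + 1) = \<zero>\<^bsub>residue_field absv\<^esub>"
    using eq[OF le] two by simp
  then have "\<one>\<^bsub>residue_field absv\<^esub> \<oplus>\<^bsub>residue_field absv\<^esub> \<one>\<^bsub>residue_field absv\<^esub> = \<zero>\<^bsub>residue_field absv\<^esub>"
    using h.hom_add[of 1 1] h.hom_one by simp
  then have "group.ord (add_monoid (residue_field absv)) \<one>\<^bsub>residue_field absv\<^esub> dvd 2"
    using group.pow_eq_id[OF A, of "\<one>\<^bsub>residue_field absv\<^esub>" 2] by (simp add: numeral_2_eq_2 nat_pow_def)
  moreover have "group.ord (add_monoid (residue_field absv)) \<one>\<^bsub>residue_field absv\<^esub> \<noteq> 1"
  proof
    assume "group.ord (add_monoid (residue_field absv)) \<one>\<^bsub>residue_field absv\<^esub> = 1"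
    then have "\<one>\<^bsub>residue_field absv\<^esub> = \<zero>\<^bsub>residue_field absv\<^esub>"
      using group.ord_eq_1[OF A, of "\<one>\<^bsub>residue_field absv\<^esub>"] by simp
    then have "M +>\<^bsub>\<O>\<^esub> 1 = \<zero>\<^bsub>residue_field absv\<^esub>"
      using h.hom_one by simp
    then have "1 \<in> M" using eq[of 1] by simp
    then show False by (simp add: max_ideal_def)
  qed
  ultimately have "group.ord (add_monoid (residue_field absv)) \<one>\<^bsub>residue_field absv\<^esub> = 2"
    by (metis prime_nat_iff two_is_prime_nat)
  then show False using assms(1) by (simp add: ring_char_def)
qed

end

locale uniformized_field = nonarch_local_field absv for absv :: "'f::field \<Rightarrow> real" +
  fixes \<pi> :: 'f and r :: nat
  assumes pi: "uniformizer absv \<pi>" and r_pos: "r \<ge> 1"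
begin

abbreviation "R \<equiv> quot_ring absv \<pi> r"
abbreviation "\<rho> \<equiv> quot_map absv \<pi> r"

lemma pi_simps: "absv \<pi> \<le> 1" "\<pi> \<noteq> 0" "M = PIdl\<^bsub>\<O>\<^esub> \<pi>"
  using pi by (auto simp: uniformizer_def)

lemma pi_less: "absv \<pi> < 1"
proof -
  have "1 * \<pi> \<in> PIdl\<^bsub>\<O>\<^esub> \<pi>" unfolding PIdl_O by (intro CollectI exI[of _ 1]) simp
  then have "\<pi> \<in> M" unfolding pi_simps(3) by simp
  then show ?thesis by (simp add: max_ideal_def)
qed

lemma absv_pi_pow: "absv (\<pi> ^ n) \<le> 1"
  by (induction n) (auto simp: absv_mult pi_simps mult_le_one absv_nonneg)

lemma ideal_pow: "ideal (PIdl\<^bsub>\<O>\<^esub> (\<pi> ^ n)) \<O>"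
  using cring.cgenideal_ideal[OF cring_val_ring, of "\<pi> ^ n"] absv_pi_pow by simp

lemma ideal_M: "ideal M \<O>"
  using ideal_pow[of 1] pi_simps by simp

lemma cring_R: "cring R"
  unfolding quot_ring_def using ideal_pow cring_val_ring by (rule ideal.quotient_is_cring)

lemma hom: "ring_hom_ring \<O> R \<rho>"
proof -
  have "\<rho> = (+>\<^bsub>\<O>\<^esub>) (PIdl\<^bsub>\<O>\<^esub> (\<pi> ^ r))" by (rule ext) (simp add: quot_map_def)
  then show ?thesis unfolding quot_ring_def using ideal.rcos_ring_hom_ring[OF ideal_pow] by simp
qed

lemma surj: "A \<in> carrier R \<Longrightarrow> \<exists>x. absv x \<le> 1 \<and> A = \<rho> x"
  by (auto simp: quot_ring_def FactRing_def A_RCOSETS_def' quot_map_def)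

lemma \<rho>_closed: "absv x \<le> 1 \<Longrightarrow> \<rho> x \<in> carrier R"
  by (auto simp: quot_ring_def FactRing_def A_RCOSETS_def' quot_map_def)

lemma \<rho>_eq_iff:
  assumes "absv x \<le> 1" "absv y \<le> 1"
  shows "\<rho> x = \<rho> y \<longleftrightarrow> x - y \<in> PIdl\<^bsub>\<O>\<^esub> (\<pi> ^ r)"
  using ring.quotient_eq_iff_same_a_r_cos[OF cring.axioms(1)[OF cring_val_ring] ideal_pow, of x y r] assms
  by (simp add: quot_map_def val_ring_minus)

lemma \<rho>_simps:
  assumes "absv x \<le> 1" "absv y \<le> 1"
  shows "\<rho> (x + y) = \<rho> x \<oplus>\<^bsub>R\<^esub> \<rho> y" "\<rho> (x * y) = \<rho> x \<otimes>\<^bsub>R\<^esub> \<rho> y" "\<rho> (x - y) = \<rho> x \<ominus>\<^bsub>R\<^esub> \<rho> y"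
proof -
  interpret h: ring_hom_ring \<O> R \<rho> by (rule hom)
  show "\<rho> (x + y) = \<rho> x \<oplus>\<^bsub>R\<^esub> \<rho> y" "\<rho> (x * y) = \<rho> x \<otimes>\<^bsub>R\<^esub> \<rho> y"
    using h.hom_add[of x y] h.hom_mult[of x y] assms by simp_all
  have "\<rho> (x - y) \<oplus>\<^bsub>R\<^esub> \<rho> y = \<rho> x"
    using h.hom_add[of "x - y" y] assms absv_diff[of x y] by simp
  then have "\<rho> x \<ominus>\<^bsub>R\<^esub> \<rho> y = (\<rho> (x - y) \<oplus>\<^bsub>R\<^esub> \<rho> y) \<ominus>\<^bsub>R\<^esub> \<rho> y" by simp
  also have "\<dots> = \<rho> (x - y)"
    using \<rho>_closed[of "x - y"] \<rho>_closed[OF assms(2)] assms absv_diff[of x y]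
    by (simp add: a_minus_def h.S.a_assoc h.S.r_neg)
  finally show "\<rho> (x - y) = \<rho> x \<ominus>\<^bsub>R\<^esub> \<rho> y" ..
qed

lemma \<rho>_zero: "\<rho> 0 = \<zero>\<^bsub>R\<^esub>" and \<rho>_one: "\<rho> 1 = \<one>\<^bsub>R\<^esub>"
proof -
  interpret h: ring_hom_ring \<O> R \<rho> by (rule hom)
  show "\<rho> 0 = \<zero>\<^bsub>R\<^esub>" "\<rho> 1 = \<one>\<^bsub>R\<^esub>" using h.hom_zero h.hom_one by simp_all
qed

lemma \<rho>_pow: "\<rho> \<pi> [^]\<^bsub>R\<^esub> (n::nat) = \<rho> (\<pi> ^ n)"
proof (induction n)
  case 0
  then show ?case by (simp add: nat_pow_def \<rho>_one)
next
  case (Suc n)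
  interpret R: cring R by (rule cring_R)
  show ?case using \<rho>_simps(2)[OF absv_pi_pow[of n] pi_simps(1)] Suc by (simp add: mult.commute)
qed

text \<open>This transfers divisibility by powers of the uniformizer between the valuation ring and its quotient; the
  annihilator and transversal conditions of a chain ring rest on it.\<close>

lemma \<rho>_in_PIdl:
  assumes x: "absv x \<le> 1" and n: "n \<le> r"
  shows "\<rho> x \<in> PIdl\<^bsub>R\<^esub> (\<rho> (\<pi> ^ n)) \<longleftrightarrow> x \<in> PIdl\<^bsub>\<O>\<^esub> (\<pi> ^ n)"
proof
  assume "\<rho> x \<in> PIdl\<^bsub>R\<^esub> (\<rho> (\<pi> ^ n))"
  then obtain Y where "Y \<in> carrier R" "\<rho> x = Y \<otimes>\<^bsub>R\<^esub> \<rho> (\<pi> ^ n)" by (auto simp: cgenideal_def)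
  then obtain y where y: "absv y \<le> 1" "\<rho> x = \<rho> (y * \<pi> ^ n)"
    using surj \<rho>_simps(2) absv_pi_pow by metis
  have "absv (y * \<pi> ^ n) \<le> 1" using y absv_pi_pow absv_nonneg by (simp add: absv_mult mult_le_one)
  then have "x - y * \<pi> ^ n \<in> PIdl\<^bsub>\<O>\<^esub> (\<pi> ^ r)" using \<rho>_eq_iff x y by simp
  then obtain z where z: "absv z \<le> 1" "x - y * \<pi> ^ n = z * \<pi> ^ r" by (auto simp: PIdl_O)
  have "\<pi> ^ r = \<pi> ^ (r - n) * \<pi> ^ n" using n by (simp add: power_add[symmetric])
  then have "x = (y + z * \<pi> ^ (r - n)) * \<pi> ^ n" using z(2) by (simp add: algebra_simps)
  moreover have "absv (y + z * \<pi> ^ (r - n)) \<le> 1"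
    using absv_ultrametric[of y "z * \<pi> ^ (r - n)"] y z absv_pi_pow absv_nonneg
    by (smt (verit) absv_mult max_def mult_le_one)
  ultimately show "x \<in> PIdl\<^bsub>\<O>\<^esub> (\<pi> ^ n)" by (auto simp: PIdl_O)
next
  assume "x \<in> PIdl\<^bsub>\<O>\<^esub> (\<pi> ^ n)"
  then obtain y where "absv y \<le> 1" "x = y * \<pi> ^ n" by (auto simp: PIdl_O)
  then show "\<rho> x \<in> PIdl\<^bsub>R\<^esub> (\<rho> (\<pi> ^ n))"
    using \<rho>_simps(2) absv_pi_pow \<rho>_closed by (auto simp: cgenideal_def)
qed

text \<open>The images of representatives of the residue classes form the transversal in terms of which \<open>q\<close> enters.\<close>

definition rep :: "'f set \<Rightarrow> 'f" where "rep A = (SOME x. absv x \<le> 1 \<and> A = M +>\<^bsub>\<O>\<^esub> x)"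
definition residues :: "'f set set" where "residues = (\<lambda>A. \<rho> (rep A)) ` carrier (residue_field absv)"

lemma rep: "A \<in> carrier (residue_field absv) \<Longrightarrow> absv (rep A) \<le> 1 \<and> A = M +>\<^bsub>\<O>\<^esub> rep A"
  unfolding rep_def by (rule someI_ex) (auto simp: residue_field_def FactRing_def A_RCOSETS_def')

lemma M_coset_eq_iff:
  assumes "absv x \<le> 1" "absv y \<le> 1"
  shows "M +>\<^bsub>\<O>\<^esub> x = M +>\<^bsub>\<O>\<^esub> y \<longleftrightarrow> \<rho> x \<ominus>\<^bsub>R\<^esub> \<rho> y \<in> PIdl\<^bsub>R\<^esub> (\<rho> \<pi>)"
proof -
  have "M +>\<^bsub>\<O>\<^esub> x = M +>\<^bsub>\<O>\<^esub> y \<longleftrightarrow> x - y \<in> M"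
    using ring.quotient_eq_iff_same_a_r_cos[OF cring.axioms(1)[OF cring_val_ring] ideal_M, of x y] assms
    by (simp add: val_ring_minus)
  also have "\<dots> \<longleftrightarrow> \<rho> (x - y) \<in> PIdl\<^bsub>R\<^esub> (\<rho> \<pi>)"
    using \<rho>_in_PIdl[of "x - y" 1] absv_diff[of x y] assms r_pos pi_simps(3) by simp
  finally show ?thesis using \<rho>_simps(3)[OF assms] by simp
qed

lemma chain_ring_quot:
  assumes p: "ring_char (residue_field absv) \<noteq> 2"
  shows "chain_ring R (\<rho> \<pi>) r (card (carrier (residue_field absv))) residues"
proof -
  interpret R: cring R by (rule cring_R)
  have inj_res: "A = B" if A: "A \<in> carrier (residue_field absv)" and B: "B \<in> carrier (residue_field absv)"
    and h: "\<rho> (rep A) \<ominus>\<^bsub>R\<^esub> \<rho> (rep B) \<in> PIdl\<^bsub>R\<^esub> (\<rho> \<pi>)" for A B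
    using M_coset_eq_iff[of "rep A" "rep B"] rep[OF A] rep[OF B] h by simp
  have pi1: "absv (\<pi> ^ n) \<le> 1" for n by (rule absv_pi_pow)
  show ?thesis
  proof (unfold_locales)
    show "\<rho> \<pi> \<in> carrier R" using \<rho>_closed pi_simps by simp
    show "1 \<le> r" by (rule r_pos)
    show "\<rho> \<pi> [^]\<^bsub>R\<^esub> r = \<zero>\<^bsub>R\<^esub>"
      unfolding \<rho>_pow \<rho>_zero[symmetric] using \<rho>_eq_iff[of "\<pi> ^ r" 0] pi1
      by (auto simp: PIdl_O intro!: exI[of _ 1])
    show "\<rho> \<pi> [^]\<^bsub>R\<^esub> (r - 1) \<noteq> \<zero>\<^bsub>R\<^esub>"
    proof
      assume "\<rho> \<pi> [^]\<^bsub>R\<^esub> (r - 1) = \<zero>\<^bsub>R\<^esub>"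
      then have "\<pi> ^ (r - 1) - 0 \<in> PIdl\<^bsub>\<O>\<^esub> (\<pi> ^ r)"
        unfolding \<rho>_pow \<rho>_zero[symmetric] using \<rho>_eq_iff[of "\<pi> ^ (r - 1)" 0] pi1 by simp
      then obtain y where y: "absv y \<le> 1" "\<pi> ^ (r - 1) = y * \<pi> ^ r" by (auto simp: PIdl_O)
      moreover have "\<pi> ^ r = \<pi> * \<pi> ^ (r - 1)" using r_pos by (cases r) auto
      ultimately have "y * \<pi> = 1" using pi_simps(2) by simp
      then have "absv y * absv \<pi> = 1" using absv_mult[of y \<pi>] by simp
      moreover have "absv y * absv \<pi> \<le> 1 * absv \<pi>" using y(1) absv_nonneg by (intro mult_right_mono)
      ultimately show False using pi_less by simp
    qed
    show "A \<in> Units R \<or> A \<in> PIdl\<^bsub>R\<^esub> (\<rho> \<pi>)" if A: "A \<in> carrier R" for A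
    proof -
      obtain x where x: "absv x \<le> 1" "A = \<rho> x" using surj[OF A] by blast
      show ?thesis
      proof (cases "absv x = 1")
        case True
        then have "x \<noteq> 0" by auto
        then have inv: "absv (1 / x) = 1" "x * (1 / x) = 1"
          using absv_mult[of x "1 / x"] True by simp_all
        then have "\<rho> x \<otimes>\<^bsub>R\<^esub> \<rho> (1 / x) = \<one>\<^bsub>R\<^esub>"
          using \<rho>_simps(2)[of x "1 / x"] x(1) by (simp add: \<rho>_one)
        then have "\<rho> x \<in> Units R"
          using R.unit_factor[of "\<rho> x" "\<rho> (1 / x)"] \<rho>_closed x(1) inv by simp
        then show ?thesis using x by simp
      next
        case False
        then have "x \<in> PIdl\<^bsub>\<O>\<^esub> (\<pi> ^ 1)" using x pi_simps(3) by (auto simp: max_ideal_def)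
        then show ?thesis using \<rho>_in_PIdl[of x 1] x r_pos by simp
      qed
    qed
    show "A \<in> PIdl\<^bsub>R\<^esub> (\<rho> \<pi> [^]\<^bsub>R\<^esub> (r - i))"
      if A: "A \<in> carrier R" and i: "i \<le> r" and z: "\<rho> \<pi> [^]\<^bsub>R\<^esub> i \<otimes>\<^bsub>R\<^esub> A = \<zero>\<^bsub>R\<^esub>" for A i
    proof -
      obtain x where x: "absv x \<le> 1" "A = \<rho> x" using surj[OF A] by blast
      have "\<rho> (\<pi> ^ i * x) = \<rho> 0" using z x \<rho>_simps(2)[OF pi1 x(1)] by (simp add: \<rho>_pow \<rho>_zero)
      moreover have "absv (\<pi> ^ i * x) \<le> 1" using x pi1 absv_nonneg by (simp add: absv_mult mult_le_one)
      ultimately have "\<pi> ^ i * x \<in> PIdl\<^bsub>\<O>\<^esub> (\<pi> ^ r)" using \<rho>_eq_iff[of "\<pi> ^ i * x" 0] by simp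
      then obtain y where y: "absv y \<le> 1" "\<pi> ^ i * x = y * \<pi> ^ r" by (auto simp: PIdl_O)
      moreover have "\<pi> ^ r = \<pi> ^ i * \<pi> ^ (r - i)" using i by (simp add: power_add[symmetric])
      ultimately have "x = y * \<pi> ^ (r - i)" using pi_simps(2) by simp
      then have "x \<in> PIdl\<^bsub>\<O>\<^esub> (\<pi> ^ (r - i))" using y by (auto simp: PIdl_O)
      then show ?thesis using \<rho>_in_PIdl[of x "r - i"] x by (simp add: \<rho>_pow)
    qed
    show "residues \<subseteq> carrier R" using rep \<rho>_closed by (auto simp: residues_def)
    show "finite residues" using finite_residue_field by (simp add: residues_def)
    have "inj_on (\<lambda>A. \<rho> (rep A)) (carrier (residue_field absv))"
    proof (rule inj_onI)
      fix A B assume A: "A \<in> carrier (residue_field absv)" and B: "B \<in> carrier (residue_field absv)"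
        and "\<rho> (rep A) = \<rho> (rep B)"
      then have "\<rho> (rep A) \<ominus>\<^bsub>R\<^esub> \<rho> (rep B) = \<rho> 0"
        using \<rho>_simps(3)[of "rep A" "rep A"] rep by simp
      moreover have "\<rho> 0 \<in> PIdl\<^bsub>R\<^esub> (\<rho> \<pi>)"
        using \<rho>_in_PIdl[of 0 1] r_pos by (auto simp: PIdl_O intro: exI[of _ 0])
      ultimately show "A = B" using inj_res A B by simp
    qed
    then show "card residues = card (carrier (residue_field absv))"
      by (simp add: residues_def card_image)
    show "\<exists>t\<in>residues. A \<ominus>\<^bsub>R\<^esub> t \<in> PIdl\<^bsub>R\<^esub> (\<rho> \<pi>)" if A: "A \<in> carrier R" for A
    proof -
      obtain x where x: "absv x \<le> 1" "A = \<rho> x" using surj[OF A] by blast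
      have k: "M +>\<^bsub>\<O>\<^esub> x \<in> carrier (residue_field absv)"
        using x by (auto simp: residue_field_def FactRing_def A_RCOSETS_def')
      have "A \<ominus>\<^bsub>R\<^esub> \<rho> (rep (M +>\<^bsub>\<O>\<^esub> x)) \<in> PIdl\<^bsub>R\<^esub> (\<rho> \<pi>)"
        using M_coset_eq_iff[OF x(1), of "rep (M +>\<^bsub>\<O>\<^esub> x)"] rep[OF k] x by simp
      then show ?thesis using k by (auto simp: residues_def)
    qed
    show "t = t'" if "t \<in> residues" "t' \<in> residues" "t \<ominus>\<^bsub>R\<^esub> t' \<in> PIdl\<^bsub>R\<^esub> (\<rho> \<pi>)" for t t'
      using that inj_res by (auto simp: residues_def)
    show "\<one>\<^bsub>R\<^esub> \<oplus>\<^bsub>R\<^esub> \<one>\<^bsub>R\<^esub> \<in> Units R"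
    proof -
      have le: "absv (1 + 1) \<le> 1" using absv_ultrametric[of 1 1] by simp
      have "1 + 1 \<notin> M" using two_notin_M[OF p ideal_M] .
      then have one: "absv (1 + 1) = 1" using le by (simp add: max_ideal_def)
      then have nz: "(1 + 1 :: 'f) \<noteq> 0" by (metis absv_zero zero_neq_one)
      then have inv: "absv (1 / (1 + 1)) = 1" using absv_mult[of "1 + 1" "1 / (1 + 1)"] one by simp
      have "\<rho> (1 + 1) \<otimes>\<^bsub>R\<^esub> \<rho> (1 / (1 + 1)) = \<one>\<^bsub>R\<^esub>"
        using \<rho>_simps(2)[OF le, of "1 / (1 + 1)"] inv nz by (simp add: \<rho>_one)
      then have "\<rho> (1 + 1) \<in> Units R"
        using R.unit_factor[of "\<rho> (1 + 1)" "\<rho> (1 / (1 + 1))"] \<rho>_closed le inv by simp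
      then show ?thesis using \<rho>_simps(1)[of 1 1] by (simp add: \<rho>_one)
    qed
  qed
qed

lemma chain_ring_char_quot:
  assumes p: "ring_char (residue_field absv) \<noteq> 2"
    and psi: "additive_character_of_level absv \<pi> r \<psi>"
  shows "chain_ring_char R (\<rho> \<pi>) r (card (carrier (residue_field absv))) residues (descend \<psi>)"
proof -
  interpret R: cring R by (rule cring_R)
  have hom: "\<psi> (x + y) = \<psi> x * \<psi> y" "\<psi> x \<noteq> 0" if "absv x \<le> 1" "absv y \<le> 1" for x y
    using psi that by (auto simp: additive_character_of_level_def hom_def complex_units_def)
  have triv: "\<psi> x = 1" if "x \<in> PIdl\<^bsub>\<O>\<^esub> (\<pi> ^ r)" for x
    using psi that by (simp add: additive_character_of_level_def)
  have PO: "absv x \<le> 1" if "x \<in> PIdl\<^bsub>\<O>\<^esub> (\<pi> ^ r)" for x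
    using ideal.Icarr[OF ideal_pow that] by simp
  have desc: "descend \<psi> (\<rho> x) = \<psi> x" if x: "absv x \<le> 1" for x
  proof -
    have "0 \<in> PIdl\<^bsub>\<O>\<^esub> (\<pi> ^ r)" by (auto simp: PIdl_O intro: exI[of _ 0])
    then have "\<psi> ` \<rho> x = {\<psi> x}"
      using triv PO x by (auto simp: quot_map_def a_r_coset_def' hom image_iff intro!: bexI[of _ 0])
    then show ?thesis by (simp add: descend_def)
  qed
  have "descend \<psi> \<in> hom (add_monoid R) complex_units"
  proof (rule homI)
    fix A assume "A \<in> carrier (add_monoid R)"
    then obtain x where x: "absv x \<le> 1" "A = \<rho> x" using surj by auto
    then show "descend \<psi> A \<in> carrier complex_units" using hom(2)[of x x] by (simp add: desc complex_units_def)
    fix B assume "B \<in> carrier (add_monoid R)"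
    then obtain y where y: "absv y \<le> 1" "B = \<rho> y" using surj by auto
    have "absv (x + y) \<le> 1" using absv_ultrametric[of x y] x y by simp
    then show "descend \<psi> (A \<otimes>\<^bsub>add_monoid R\<^esub> B) = descend \<psi> A \<otimes>\<^bsub>complex_units\<^esub> descend \<psi> B"
      using x y hom \<rho>_simps(1)[of x y, symmetric] by (simp add: desc complex_units_def)
  qed
  moreover have "\<exists>A\<in>carrier R. descend \<psi> (\<rho> \<pi> [^]\<^bsub>R\<^esub> (r - 1) \<otimes>\<^bsub>R\<^esub> A) \<noteq> 1"
  proof -
    obtain y where y: "absv y \<le> 1" "\<psi> (y * \<pi> ^ (r - 1)) \<noteq> 1"
      using psi by (auto simp: additive_character_of_level_def PIdl_O)
    have "absv (\<pi> ^ (r - 1) * y) \<le> 1" using y absv_pi_pow absv_nonneg by (simp add: absv_mult mult_le_one)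
    then have "descend \<psi> (\<rho> \<pi> [^]\<^bsub>R\<^esub> (r - 1) \<otimes>\<^bsub>R\<^esub> \<rho> y) = \<psi> (\<pi> ^ (r - 1) * y)"
      using \<rho>_simps(2)[OF absv_pi_pow y(1), symmetric] by (simp add: \<rho>_pow desc)
    then show ?thesis using y \<rho>_closed by (metis mult.commute)
  qed
  ultimately show ?thesis
    using chain_ring_quot[OF p] by (simp add: chain_ring_char_def chain_ring_char_axioms_def)
qed

end

section \<open>The theorem for the quotient of a local field\<close>

theorem mainTheorem10:
  fixes absv :: "'f::field \<Rightarrow> real" and \<pi> :: 'f and \<psi> :: "'f \<Rightarrow> complex"
    and q r l :: nat
    and R :: "'f set ring" and w :: "'f set" and \<psi>r :: "'f set \<Rightarrow> complex"
    and a \<Delta> \<Delta>h \<epsilon> :: "'f set"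
    and \<theta> :: "'f set mat2 \<Rightarrow> complex" and chi \<sigma> :: "'f set \<Rightarrow> complex"
    and \<Xi> :: "('f set mat2, 'f set mat2) fun_rep"
  assumes F: "nonarch_local_field absv"
    and pi: "uniformizer absv \<pi>"
    and q: "q = card (carrier (residue_field absv))"
    and p: "ring_char (residue_field absv) \<noteq> 2"
    and r: "r \<ge> 2" "even r" and l: "l = r div 2"
    and psi: "additive_character_of_level absv \<pi> r \<psi>"
    and R: "R = quot_ring absv \<pi> r" and w: "w = quot_map absv \<pi> r \<pi>"
    and psir: "\<psi>r = descend \<psi>"
    and Delta: "\<Delta> \<in> PIdl\<^bsub>quot_ring absv \<pi> l\<^esub> (quot_map absv \<pi> l \<pi>)"
    and Delta_hat: "\<Delta>h \<in> PIdl\<^bsub>R\<^esub> w" "is_lift absv \<pi> r l \<Delta>h \<Delta>"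
    and theta: "\<theta> \<in> hom ((GL2 R)\<lparr>carrier := S_group R \<Delta>h\<rparr>) complex_units"
    and theta_psi: "\<And>k. k \<in> S_group R \<Delta>h \<inter> cong_subgroup R w l \<Longrightarrow>
                      \<theta> k = psi_beta R \<psi>r (beta_hat R \<Delta>h) k"
    and a: "a \<in> carrier (quot_ring absv \<pi> l)"
    and chi_hom: "chi \<in> hom (units_of R) complex_units"
    and chi_a: "\<And>ah z. is_lift absv \<pi> r l ah a \<Longrightarrow> z \<in> carrier R \<Longrightarrow>
                  chi (\<one>\<^bsub>R\<^esub> \<oplus>\<^bsub>R\<^esub> w [^]\<^bsub>R\<^esub> l \<otimes>\<^bsub>R\<^esub> z) = \<psi>r (w [^]\<^bsub>R\<^esub> l \<otimes>\<^bsub>R\<^esub> ah \<otimes>\<^bsub>R\<^esub> z)"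
    and Xi: "\<Xi> = Xi_twisted_rep R w l \<psi>r chi \<Delta>h \<theta>"
    and sigma: "\<And>\<alpha>. \<alpha> \<in> Units R \<Longrightarrow> \<sigma> \<alpha> = \<theta> (mat2_scalar R \<alpha>)"
    and eps: "\<epsilon> \<in> Units R" "\<not> (\<exists>x\<in>carrier R. \<epsilon> = x \<otimes>\<^bsub>R\<^esub> x)"
  shows
    "(\<forall>\<alpha>\<in>Units R.
        rep_character \<Xi> (mat2_scalar R \<alpha>)
          = (of_nat q ^ 2 - 1) * of_nat q ^ (r - 2) * chi (\<alpha> [^]\<^bsub>R\<^esub> (2::nat)) * \<sigma> \<alpha>) \<and>
     (\<forall>i\<le>r - 1. \<forall>\<alpha>\<in>Units R. \<forall>\<delta>\<in>Units R.
        (\<exists>u\<in>Units R. \<alpha> \<ominus>\<^bsub>R\<^esub> \<delta> = w [^]\<^bsub>R\<^esub> i \<otimes>\<^bsub>R\<^esub> u) \<longrightarrow>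
        rep_character \<Xi> (Mat2 \<alpha> \<zero>\<^bsub>R\<^esub> \<zero>\<^bsub>R\<^esub> \<delta>)
          = (if i = r - 1 then 1 else 0) * chi \<alpha> * chi \<delta> * \<sigma> \<delta> * (of_nat q - 1) * of_nat q ^ (r - 2)) \<and>
     (\<forall>i\<le>r - 1. \<forall>\<alpha>\<in>carrier R. \<forall>\<beta>\<in>Units R.
        \<alpha> [^]\<^bsub>R\<^esub> (2::nat) \<ominus>\<^bsub>R\<^esub> \<epsilon> \<otimes>\<^bsub>R\<^esub> \<beta> [^]\<^bsub>R\<^esub> (2::nat) \<otimes>\<^bsub>R\<^esub> w [^]\<^bsub>R\<^esub> (2 * i) \<in> Units R \<longrightarrow>
        rep_character \<Xi> (Mat2 \<alpha> (w [^]\<^bsub>R\<^esub> i \<otimes>\<^bsub>R\<^esub> \<epsilon> \<otimes>\<^bsub>R\<^esub> \<beta>) (w [^]\<^bsub>R\<^esub> i \<otimes>\<^bsub>R\<^esub> \<beta>) \<alpha>)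
          = (if i < r - 1 then 0
             else - (chi (\<alpha> [^]\<^bsub>R\<^esub> (2::nat)) * \<sigma> \<alpha> * of_nat q ^ (r - 2) * (of_nat q + 1))))"
proof -
  have r1: "1 \<le> r" using r(1) by simp
  interpret U: uniformized_field absv \<pi> r
    using F pi r1 by (intro uniformized_field.intro uniformized_field_axioms.intro)
  have chain: "chain_ring_char R w r q U.residues \<psi>r"
    using U.chain_ring_char_quot[OF p psi] by (simp only: R w q psir)
  interpret chain_ring_char R w r q U.residues \<psi>r by (rule chain)
  interpret split_data R w r q U.residues \<psi>r l \<Delta>h \<theta>
  proof
    show "r = 2 * l" using r(2) l by simp
    show "\<Delta>h \<in> I 1" using Delta_hat(1) by (simp add: I_def)
    show "\<theta> \<in> hom ((GL2 R)\<lparr>carrier := S_group R \<Delta>h\<rparr>) complex_units" by (rule theta)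
    show "\<theta> k = psi_beta R \<psi>r (beta_hat R \<Delta>h) k" if "k \<in> S_group R \<Delta>h \<inter> cong_subgroup R w l" for k
      using that by (rule theta_psi)
  qed
  show ?thesis
    unfolding Xi
  proof (intro conjI ballI allI impI)
    fix \<alpha> assume \<alpha>: "\<alpha> \<in> Units R"
    show "rep_character (Xi_twisted_rep R w l \<psi>r chi \<Delta>h \<theta>) (mat2_scalar R \<alpha>)
        = (of_nat q ^ 2 - 1) * of_nat q ^ (r - 2) * chi (\<alpha> [^]\<^bsub>R\<^esub> (2::nat)) * \<sigma> \<alpha>"
      unfolding sigma[OF \<alpha>] by (rule tr_scalar[OF chi_hom \<alpha>])
  next
    fix i \<alpha> \<delta> assume i: "i \<le> r - 1" and \<alpha>: "\<alpha> \<in> Units R" and \<delta>: "\<delta> \<in> Units R"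
      and "\<exists>u\<in>Units R. \<alpha> \<ominus>\<^bsub>R\<^esub> \<delta> = w [^]\<^bsub>R\<^esub> i \<otimes>\<^bsub>R\<^esub> u"
    then obtain u where u: "u \<in> Units R" "\<alpha> \<ominus>\<^bsub>R\<^esub> \<delta> = w [^]\<^bsub>R\<^esub> i \<otimes>\<^bsub>R\<^esub> u" by blast
    show "rep_character (Xi_twisted_rep R w l \<psi>r chi \<Delta>h \<theta>) (Mat2 \<alpha> \<zero>\<^bsub>R\<^esub> \<zero>\<^bsub>R\<^esub> \<delta>)
        = (if i = r - 1 then 1 else 0) * chi \<alpha> * chi \<delta> * \<sigma> \<delta> * (of_nat q - 1) * of_nat q ^ (r - 2)"
      unfolding sigma[OF \<delta>] by (rule tr_diag[OF chi_hom i \<alpha> \<delta> u])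
  next
    fix i \<alpha> \<beta> assume i: "i \<le> r - 1" and \<alpha>: "\<alpha> \<in> carrier R" and \<beta>: "\<beta> \<in> Units R"
      and det: "\<alpha> [^]\<^bsub>R\<^esub> (2::nat) \<ominus>\<^bsub>R\<^esub> \<epsilon> \<otimes>\<^bsub>R\<^esub> \<beta> [^]\<^bsub>R\<^esub> (2::nat) \<otimes>\<^bsub>R\<^esub> w [^]\<^bsub>R\<^esub> (2 * i) \<in> Units R"
    have "\<sigma> \<alpha> = \<theta> (mat2_scalar R \<alpha>)" if "\<not> i < r - 1"
    proof (rule sigma, rule nonsplit_unit[OF _ \<alpha> _ _ det])
      show "1 \<le> i" using that r(1) by simp
      show "\<epsilon> \<in> carrier R" "\<beta> \<in> carrier R" using eps(1) \<beta> by (auto intro: Units_closed)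
    qed
    then show "rep_character (Xi_twisted_rep R w l \<psi>r chi \<Delta>h \<theta>)
          (Mat2 \<alpha> (w [^]\<^bsub>R\<^esub> i \<otimes>\<^bsub>R\<^esub> \<epsilon> \<otimes>\<^bsub>R\<^esub> \<beta>) (w [^]\<^bsub>R\<^esub> i \<otimes>\<^bsub>R\<^esub> \<beta>) \<alpha>)
        = (if i < r - 1 then 0
           else - (chi (\<alpha> [^]\<^bsub>R\<^esub> (2::nat)) * \<sigma> \<alpha> * of_nat q ^ (r - 2) * (of_nat q + 1)))"
      using tr_nonsplit[OF chi_hom i \<alpha> \<beta> eps(1) eps(2) det] by simp
  qed
qed

end
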